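(* If $F$ is a fixed finite forest with connected components $T_1,\ldots,T_d$, then, as $n\to\infty$, $$\mathbb{P}_n(F\subseteq M_n) = (1+o_{|E(F)|}(1))\prod_{i=1}^d \mathbb{P}_n(T_i\subseteq M_n).$$
   Context: $K_n$ is the complete graph on $[n]=\{1,\ldots,n\}$, with i.i.d. uniform $[0,1]$ edge weights $(w_e)_{e\in E(K_n)}$; $\mathbb{P}_n$ denotes the corresponding law. $M_n$ is the minimum spanning tree: the almost surely unique spanning tree of $K_n$ minimizing the total weight. Fixed trees and forests are finite abstract graphs independent of $n$. For a forest $G$ and $n\ge |V(G)|$, assign distinct labels in $[n]$ to the vertices of $G$; the event $G\subseteq M_n$ means that this fixed labeled copy of $G$ is contained in $M_n$. By vertex exchangeability its probability does not depend on the labeling; the common value is $\mathbb{P}_n(G\subseteq M_n)$. The notation $o_{|E(F)|}(1)$ denotes a quantity tending to $0$ as $n\to\infty$, at a rate that may depend on the number of edges $|E(F)|$. *)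

theory Defs
  imports "HOL-Probability.Probability" "HOL-Combinatorics.Permutations"
begin

(* Finite simple graphs: a vertex set together with a set of two-element subsets of it.
   The notions forest and tree of the AFP entry Graph_Theory are not used, since a symmetric
   pair of arcs is already a cycle there. *)

type_synonym 'a graph = "'a set \<times> 'a set set"

abbreviation verts :: "'a graph \<Rightarrow> 'a set" where "verts \<equiv> fst"
abbreviation edges :: "'a graph \<Rightarrow> 'a set set" where "edges \<equiv> snd"

definition two_subsets :: "'a set \<Rightarrow> 'a set set" where
  "two_subsets V = {e. e \<subseteq> V \<and> card e = 2}"

definition fin_graph :: "'a graph \<Rightarrow> bool" where
  "fin_graph G \<longleftrightarrow> finite (verts G) \<and> edges G \<subseteq> two_subsets (verts G)"

definition adj :: "'a graph \<Rightarrow> ('a \<times> 'a) set" where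
  "adj G = {(u, v). {u, v} \<in> edges G}"

definition connected_graph :: "'a graph \<Rightarrow> bool" where
  "connected_graph G \<longleftrightarrow> verts G \<noteq> {} \<and> (\<forall>u\<in>verts G. \<forall>v\<in>verts G. (u, v) \<in> (adj G)\<^sup>*)"

(* A cycle is given by the list of its distinct vertices, at least three. *)
definition is_cycle :: "'a graph \<Rightarrow> 'a list \<Rightarrow> bool" where
  "is_cycle G vs \<longleftrightarrow> length vs \<ge> 3 \<and> distinct vs \<and>
     (\<forall>i. Suc i < length vs \<longrightarrow> {vs ! i, vs ! Suc i} \<in> edges G) \<and> {last vs, hd vs} \<in> edges G"

definition is_forest :: "'a graph \<Rightarrow> bool" where
  "is_forest G \<longleftrightarrow> fin_graph G \<and> (\<nexists>vs. is_cycle G vs)"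

definition is_tree :: "'a graph \<Rightarrow> bool" where
  "is_tree G \<longleftrightarrow> is_forest G \<and> connected_graph G"

definition component_of :: "'a graph \<Rightarrow> 'a \<Rightarrow> 'a graph" where
  "component_of G v = (let C = {u \<in> verts G. (v, u) \<in> (adj G)\<^sup>*} in (C, {e \<in> edges G. e \<subseteq> C}))"

definition components :: "'a graph \<Rightarrow> 'a graph set" where
  "components G = component_of G ` verts G"

definition K_edges :: "nat \<Rightarrow> nat set set" where
  "K_edges n = two_subsets {1..n}"

definition weights :: "nat \<Rightarrow> (nat set \<Rightarrow> real) measure" where
  "weights n = (\<Pi>\<^sub>M e\<in>K_edges n. uniform_measure lborel {0..1})"

(* Spanning trees of the complete graph are identified with their edge sets. *)
definition spanning_tree :: "nat \<Rightarrow> nat set set \<Rightarrow> bool" where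
  "spanning_tree n T \<longleftrightarrow> T \<subseteq> K_edges n \<and> is_tree ({1..n}, T)"

definition minimal_spanning_tree :: "nat \<Rightarrow> (nat set \<Rightarrow> real) \<Rightarrow> nat set set \<Rightarrow> bool" where
  "minimal_spanning_tree n w T \<longleftrightarrow> spanning_tree n T \<and>
     (\<forall>T'. spanning_tree n T' \<longrightarrow> (\<Sum>e\<in>T. w e) \<le> (\<Sum>e\<in>T'. w e))"

(* The minimizer is almost surely unique; on the null set where it is not, the value is
   set to the empty set. *)
definition mst :: "nat \<Rightarrow> (nat set \<Rightarrow> real) \<Rightarrow> nat set set" where
  "mst n w = (if \<exists>!T. minimal_spanning_tree n w T
              then THE T. minimal_spanning_tree n w T else {})"

definition labelling :: "nat \<Rightarrow> 'a graph \<Rightarrow> ('a \<Rightarrow> nat) \<Rightarrow> bool" where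
  "labelling n G \<phi> \<longleftrightarrow> inj_on \<phi> (verts G) \<and> \<phi> ` verts G \<subseteq> {1..n}"

definition labelled_in_mst :: "nat \<Rightarrow> 'a graph \<Rightarrow> ('a \<Rightarrow> nat) \<Rightarrow> (nat set \<Rightarrow> real) set" where
  "labelled_in_mst n G \<phi> = {w \<in> space (weights n). (`) \<phi> ` edges G \<subseteq> mst n w}"

(* The common value over all labellings of the probability that the labelled copy of G lies
   in the minimum spanning tree; see in_mst_prob_eq below. It is only meaningful when G has
   at most n vertices, as otherwise there is no labelling. *)
definition in_mst_prob :: "nat \<Rightarrow> 'a graph \<Rightarrow> real" where
  "in_mst_prob n G =
     (THE p. \<forall>\<phi>. labelling n G \<phi> \<longrightarrow> measure (weights n) (labelled_in_mst n G \<phi>) = p)"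


lemma prob_space_unif: "prob_space (uniform_measure lborel {0..1::real})"
  by (rule prob_space_uniform_measure) auto

lemma finite_K_edges: "finite (K_edges n)"
proof -
  have "K_edges n \<subseteq> Pow {1..n}" by (auto simp: K_edges_def two_subsets_def)
  then show ?thesis by (rule finite_subset) simp
qed

lemma finite_spanning_trees: "finite {T. spanning_tree n T}"
proof -
  have "{T. spanning_tree n T} \<subseteq> Pow (K_edges n)" by (auto simp: spanning_tree_def)
  then show ?thesis by (rule finite_subset) (simp add: finite_K_edges)
qed

lemma minimal_spanning_tree_sets:
  "{w \<in> space (weights n). minimal_spanning_tree n w T} \<in> sets (weights n)"
proof (cases "spanning_tree n T")
  case True
  have meas: "(\<lambda>w. \<Sum>e\<in>S. w e) \<in> borel_measurable (weights n)" if "spanning_tree n S" for S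
  proof (rule borel_measurable_sum)
    fix e assume "e \<in> S"
    then have "e \<in> K_edges n" using that by (auto simp: spanning_tree_def)
    then have "(\<lambda>w. w e) \<in> measurable (weights n) (uniform_measure lborel {0..1})"
      unfolding weights_def by (rule measurable_component_singleton)
    then show "(\<lambda>w. w e) \<in> borel_measurable (weights n)"
      by (simp add: measurable_def)
  qed
  have "{w \<in> space (weights n). minimal_spanning_tree n w T} =
      {w \<in> space (weights n). \<forall>T'\<in>{T'. spanning_tree n T'}. (\<Sum>e\<in>T. w e) \<le> (\<Sum>e\<in>T'. w e)}"
    using True by (auto simp: minimal_spanning_tree_def)
  also have "\<dots> \<in> sets (weights n)"
    by (rule sets.sets_Collect_finite_All)
      (auto intro!: borel_measurable_le meas True finite_spanning_trees)
  finally show ?thesis .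
next
  case False
  then show ?thesis by (simp add: minimal_spanning_tree_def)
qed

lemma labelled_in_mst_sets: "labelled_in_mst n G \<phi> \<in> sets (weights n)"
proof -
  define U where "U = (\<lambda>w T. minimal_spanning_tree n w T \<and>
      (\<forall>T'\<in>{T'. spanning_tree n T'}. minimal_spanning_tree n w T' \<longrightarrow> T' = T))"
  let ?A = "(`) \<phi> ` edges G"
  have st: "spanning_tree n T" if "minimal_spanning_tree n w T" for w T
    using that by (simp add: minimal_spanning_tree_def)
  have eq: "?A \<subseteq> mst n w \<longleftrightarrow> (\<exists>T\<in>{T. spanning_tree n T}. U w T \<and> ?A \<subseteq> T)
      \<or> (\<not> (\<exists>T\<in>{T. spanning_tree n T}. U w T) \<and> ?A \<subseteq> {})" for w
  proof (cases "\<exists>T. U w T")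
    case True
    then obtain T where T: "U w T" by (rule exE)
    have m: "minimal_spanning_tree n w T" using T unfolding U_def by (rule conjunct1)
    have u: "T' = T" if "minimal_spanning_tree n w T'" for T'
      using T st[OF that] that unfolding U_def by simp
    have ex: "\<exists>!T. minimal_spanning_tree n w T" using m u by (rule ex1I)
    have "mst n w = T" unfolding mst_def if_P[OF ex] using m u by (rule the_equality)
    moreover have "T' = T" if "U w T'" for T'
      using that u unfolding U_def by simp
    ultimately show ?thesis using T st[OF m] by (metis mem_Collect_eq)
  next
    case False
    have "\<not> (\<exists>!T. minimal_spanning_tree n w T)"
    proof
      assume "\<exists>!T. minimal_spanning_tree n w T"
      then obtain T where "minimal_spanning_tree n w T"
        "\<And>T'. minimal_spanning_tree n w T' \<Longrightarrow> T' = T" by (auto elim: ex1E)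
      then have "U w T" unfolding U_def by blast
      then show False using False by simp
    qed
    then have "mst n w = {}" unfolding mst_def by simp
    then show ?thesis using False by simp
  qed
  have U: "{w \<in> space (weights n). U w T} \<in> sets (weights n)" for T
  proof -
    have "{w \<in> space (weights n). \<forall>T'\<in>{T'. spanning_tree n T'}.
        minimal_spanning_tree n w T' \<longrightarrow> T' = T} \<in> sets (weights n)"
    proof (rule sets.sets_Collect_finite_All[OF _ finite_spanning_trees])
      fix T' show "{w \<in> space (weights n). minimal_spanning_tree n w T' \<longrightarrow> T' = T}
          \<in> sets (weights n)"
      proof (cases "T' = T")
        case False
        then show ?thesis
          using sets.sets_Collect_neg[OF minimal_spanning_tree_sets[of n T']] by simp
      qed simp
    qed
    from sets.sets_Collect_conj[OF this minimal_spanning_tree_sets[of n T]]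
    show ?thesis unfolding U_def .
  qed
  have ex: "{w \<in> space (weights n). \<exists>T\<in>{T. spanning_tree n T}. U w T \<and> Q T}
      \<in> sets (weights n)" for Q
  proof (rule sets.sets_Collect_finite_Ex[OF _ finite_spanning_trees])
    fix T show "{w \<in> space (weights n). U w T \<and> Q T} \<in> sets (weights n)"
      using U[of T] by (cases "Q T") simp_all
  qed
  have none: "{w \<in> space (weights n). \<not> (\<exists>T\<in>{T. spanning_tree n T}. U w T) \<and> ?A \<subseteq> {}}
      \<in> sets (weights n)"
    using sets.sets_Collect_neg[OF ex[of "\<lambda>_. True"]] by (cases "?A \<subseteq> {}") simp_all
  show ?thesis
    unfolding labelled_in_mst_def eq by (rule sets.sets_Collect_disj[OF none ex])
qed

lemma two_subsets_permutes:
  assumes "\<pi> permutes V" "T \<subseteq> two_subsets V"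
  shows "(`) \<pi> ` T \<subseteq> two_subsets V"
proof -
  have "inj \<pi>" using assms(1) by (rule permutes_inj)
  then have "card (\<pi> ` e) = card e" for e by (meson card_image inj_on_subset subset_UNIV)
  moreover have "e \<subseteq> V \<Longrightarrow> \<pi> ` e \<subseteq> V" for e using permutes_image[OF assms(1)] by blast
  ultimately show ?thesis using assms(2) by (auto simp: two_subsets_def)
qed

lemma spanning_tree_permutes:
  assumes p: "\<pi> permutes {1..n}" and T: "spanning_tree n T"
  shows "spanning_tree n ((`) \<pi> ` T)"
proof -
  let ?G = "({1..n}, T)" and ?H = "({1..n}, (`) \<pi> ` T)"
  have inv: "inv \<pi> (\<pi> x) = x" "\<pi> (inv \<pi> x) = x" for x using permutes_inverses[OF p] by auto
  have sub: "(`) \<pi> ` T \<subseteq> K_edges n"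
    using two_subsets_permutes[OF p] T by (simp add: spanning_tree_def K_edges_def)
  have pull: "{inv \<pi> a, inv \<pi> b} \<in> T" if "{a, b} \<in> (`) \<pi> ` T" for a b
  proof -
    from that obtain e where e: "e \<in> T" "{a, b} = \<pi> ` e" by auto
    have "inv \<pi> ` {a, b} = e" unfolding e(2) using inv by (simp add: image_image)
    then show ?thesis using e(1) by simp
  qed
  have nocyc: "\<not> is_cycle ?H vs" for vs
  proof
    assume c: "is_cycle ?H vs"
    have inj: "inj (inv \<pi>)" using permutes_inv[OF p] by (rule permutes_inj)
    have ne: "vs \<noteq> []" using c by (auto simp: is_cycle_def)
    have "distinct (map (inv \<pi>) vs)"
      using c inj by (simp add: is_cycle_def distinct_map inj_on_subset[OF inj])
    then have "is_cycle ?G (map (inv \<pi>) vs)"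
      using c ne pull by (auto simp: is_cycle_def last_map hd_map)
    then show False using T by (auto simp: spanning_tree_def is_tree_def is_forest_def)
  qed
  have step: "(\<pi> u, \<pi> v) \<in> (adj ?H)\<^sup>*" if "(u, v) \<in> (adj ?G)\<^sup>*" for u v
    using that
  proof (induction rule: rtrancl_induct)
    case base
    then show ?case by simp
  next
    case (step y z)
    then have "{y, z} \<in> T" by (simp add: adj_def)
    then have "\<pi> ` {y, z} \<in> (`) \<pi> ` T" by blast
    then have "(\<pi> y, \<pi> z) \<in> adj ?H" by (simp add: adj_def)
    then show ?case using step.IH by simp
  qed
  have "connected_graph ?H"
    unfolding connected_graph_def
  proof (intro conjI ballI)
    show "verts ?H \<noteq> {}" using T
      by (simp add: spanning_tree_def is_tree_def connected_graph_def)
    fix u v assume "u \<in> verts ?H" "v \<in> verts ?H"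
    then have "inv \<pi> u \<in> {1..n}" "inv \<pi> v \<in> {1..n}"
      using permutes_in_image[OF permutes_inv[OF p]] by auto
    then have "(inv \<pi> u, inv \<pi> v) \<in> (adj ?G)\<^sup>*"
      using T by (simp add: spanning_tree_def is_tree_def connected_graph_def)
    from step[OF this] show "(u, v) \<in> (adj ?H)\<^sup>*" by (simp add: inv)
  qed
  then show ?thesis using sub nocyc
    by (simp add: spanning_tree_def is_tree_def is_forest_def fin_graph_def K_edges_def)
qed

lemma permutes_image_cancel:
  assumes "\<pi> permutes V"
  shows "(`) \<pi> ` (`) (inv \<pi>) ` T = T" "(`) (inv \<pi>) ` (`) \<pi> ` T = T"
  using permutes_inverses[OF assms] by (simp_all add: image_image)

lemma mst_permutes:
  assumes p: "\<pi> permutes {1..n}"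
  shows "mst n w = (`) \<pi> ` mst n (\<lambda>e\<in>K_edges n. w (\<pi> ` e))"
proof -
  let ?w = "\<lambda>e\<in>K_edges n. w (\<pi> ` e)"
  let ?P = "\<lambda>T. (`) \<pi> ` T" and ?Q = "\<lambda>T. (`) (inv \<pi>) ` T"
  note PQ = permutes_image_cancel[OF p]
  note ip = permutes_inv[OF p]
  have injP: "inj ((`) \<pi>)" using permutes_inj[OF p] by (simp add: inj_image_eq_iff inj_def)
  have sm: "(\<Sum>e\<in>?P T. w e) = (\<Sum>e\<in>T. ?w e)" if "spanning_tree n T" for T
  proof -
    have "(\<Sum>e\<in>?P T. w e) = (\<Sum>e\<in>T. w (\<pi> ` e))"
      by (subst sum.reindex) (auto intro: inj_on_subset[OF injP])
    also have "\<dots> = (\<Sum>e\<in>T. ?w e)"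
      using that by (intro sum.cong) (auto simp: spanning_tree_def)
    finally show ?thesis .
  qed
  have fwd: "minimal_spanning_tree n w (?P T)" if m: "minimal_spanning_tree n ?w T" for T
    unfolding minimal_spanning_tree_def
  proof (intro conjI allI impI)
    have T: "spanning_tree n T" using m by (simp only: minimal_spanning_tree_def)
    then show "spanning_tree n (?P T)" by (rule spanning_tree_permutes[OF p])
    fix T' assume "spanning_tree n T'"
    then have Q: "spanning_tree n (?Q T')" by (rule spanning_tree_permutes[OF ip])
    then have "(\<Sum>e\<in>T. ?w e) \<le> (\<Sum>e\<in>?Q T'. ?w e)"
      using m unfolding minimal_spanning_tree_def by blast
    then show "(\<Sum>e\<in>?P T. w e) \<le> (\<Sum>e\<in>T'. w e)"
      using sm[OF T] sm[OF Q] PQ(1) by simp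
  qed
  have bwd: "minimal_spanning_tree n ?w (?Q T)" if m: "minimal_spanning_tree n w T" for T
    unfolding minimal_spanning_tree_def
  proof (intro conjI allI impI)
    have T: "spanning_tree n T" using m by (simp only: minimal_spanning_tree_def)
    then show Q: "spanning_tree n (?Q T)" by (rule spanning_tree_permutes[OF ip])
    fix T' assume T': "spanning_tree n T'"
    then have "spanning_tree n (?P T')" by (rule spanning_tree_permutes[OF p])
    then have "(\<Sum>e\<in>T. w e) \<le> (\<Sum>e\<in>?P T'. w e)"
      using m unfolding minimal_spanning_tree_def by blast
    then show "(\<Sum>e\<in>?Q T. ?w e) \<le> (\<Sum>e\<in>T'. ?w e)"
      using sm[OF T'] sm[OF Q] PQ(1) by simp
  qed
  show ?thesis
  proof (cases "\<exists>!T. minimal_spanning_tree n ?w T")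
    case True
    then obtain T where T: "minimal_spanning_tree n ?w T"
      and u: "\<And>T'. minimal_spanning_tree n ?w T' \<Longrightarrow> T' = T" by blast
    have u': "T' = ?P T" if "minimal_spanning_tree n w T'" for T'
      using u[OF bwd[OF that]] PQ(1) by metis
    have ex: "\<exists>!T. minimal_spanning_tree n w T" using fwd[OF T] u' by blast
    have "mst n ?w = T" unfolding mst_def if_P[OF True] using T u by (rule the_equality)
    moreover have "mst n w = ?P T"
      unfolding mst_def if_P[OF ex] using fwd[OF T] u' by (rule the_equality)
    ultimately show ?thesis by simp
  next
    case False
    have "\<not> (\<exists>!T. minimal_spanning_tree n w T)"
    proof
      assume "\<exists>!T. minimal_spanning_tree n w T"
      then obtain T where T: "minimal_spanning_tree n w T"
        and u: "\<And>T'. minimal_spanning_tree n w T' \<Longrightarrow> T' = T" by blast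
      have "T' = ?Q T" if "minimal_spanning_tree n ?w T'" for T'
        using u[OF fwd[OF that]] PQ(2) by metis
      then show False using False bwd[OF T] by blast
    qed
    then show ?thesis using False by (simp add: mst_def)
  qed
qed

lemma labelling_permutation:
  assumes G: "finite (verts G)" and f: "labelling n G \<phi>" and g: "labelling n G \<psi>"
  obtains \<pi> where "\<pi> permutes {1..n}" "\<And>v. v \<in> verts G \<Longrightarrow> \<pi> (\<phi> v) = \<psi> v"
proof -
  let ?V = "verts G" and ?N = "{1..n}"
  have f': "inj_on \<phi> ?V" "\<phi> ` ?V \<subseteq> ?N" and g': "inj_on \<psi> ?V" "\<psi> ` ?V \<subseteq> ?N"
    using f g by (auto simp: labelling_def)
  have "card (?N - \<phi> ` ?V) = card (?N - \<psi> ` ?V)"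
    using f' g' G by (simp add: card_Diff_subset card_image)
  then obtain h where h: "bij_betw h (?N - \<phi> ` ?V) (?N - \<psi> ` ?V)"
    using finite_same_card_bij[of "?N - \<phi> ` ?V" "?N - \<psi> ` ?V"] by auto
  define \<pi> where
    "\<pi> x = (if x \<in> \<phi> ` ?V then \<psi> (the_inv_into ?V \<phi> x) else if x \<in> ?N then h x else x)" for x
  have val: "\<pi> (\<phi> v) = \<psi> v" if "v \<in> ?V" for v
    using that f' by (simp add: \<pi>_def the_inv_into_f_f)
  have "bij_betw (\<lambda>x. \<psi> (the_inv_into ?V \<phi> x)) (\<phi> ` ?V) (\<psi> ` ?V)"
    using bij_betw_trans[OF bij_betw_the_inv_into[OF inj_on_imp_bij_betw[OF f'(1)]]
        inj_on_imp_bij_betw[OF g'(1)]] by (simp add: o_def)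
  then have b1: "bij_betw \<pi> (\<phi> ` ?V) (\<psi> ` ?V)"
    by (rule bij_betw_cong[THEN iffD1, rotated]) (simp add: \<pi>_def)
  have b2: "bij_betw \<pi> (?N - \<phi> ` ?V) (?N - \<psi> ` ?V)"
    using h by (rule bij_betw_cong[THEN iffD1, rotated]) (simp add: \<pi>_def)
  have "bij_betw \<pi> (\<phi> ` ?V \<union> (?N - \<phi> ` ?V)) (\<psi> ` ?V \<union> (?N - \<psi> ` ?V))"
    using b1 b2 by (rule bij_betw_combine) auto
  moreover have "\<phi> ` ?V \<union> (?N - \<phi> ` ?V) = ?N" "\<psi> ` ?V \<union> (?N - \<psi> ` ?V) = ?N"
    using f' g' by auto
  ultimately have "bij_betw \<pi> ?N ?N" by simp
  moreover have "\<pi> x = x" if "x \<notin> ?N" for x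
    using that f'(2) by (auto simp: \<pi>_def)
  ultimately have "\<pi> permutes ?N" by (rule bij_imp_permutes)
  then show thesis using val that by blast
qed

lemma labelled_in_mst_exchangeable:
  assumes G: "fin_graph G" and f: "labelling n G \<phi>" and g: "labelling n G \<psi>"
  shows "measure (weights n) (labelled_in_mst n G \<phi>) = measure (weights n) (labelled_in_mst n G \<psi>)"
proof -
  have "finite (verts G)" using G by (simp add: fin_graph_def)
  from labelling_permutation[OF this f g] obtain \<pi>
    where p: "\<pi> permutes {1..n}" and val: "\<And>v. v \<in> verts G \<Longrightarrow> \<pi> (\<phi> v) = \<psi> v"
    by blast
  let ?E = "K_edges n" and ?U = "uniform_measure lborel {0..1::real}"
  let ?g = "\<lambda>w. \<lambda>e\<in>?E. w (\<pi> ` e)"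
  have injP: "inj ((`) \<pi>)" using permutes_inj[OF p] by (simp add: inj_image_eq_iff inj_def)
  have funP: "(`) \<pi> \<in> ?E \<rightarrow> ?E"
    using two_subsets_permutes[OF p, of ?E] by (auto simp: K_edges_def)
  have d: "distr (weights n) (weights n) ?g = weights n"
    unfolding weights_def
    by (rule distr_PiM_reindex[where M = "\<lambda>_. ?U" and K = ?E and I = ?E and f = "(`) \<pi>"])
      (use prob_space_unif inj_on_subset[OF injP] funP in auto)
  have gm: "?g \<in> measurable (weights n) (weights n)"
    unfolding weights_def
    by (rule measurable_restrict) (use funP in \<open>auto intro!: measurable_component_singleton\<close>)
  have img: "(`) \<pi> ` (`) \<phi> ` edges G = (`) \<psi> ` edges G"
  proof -
    have "\<pi> ` \<phi> ` e = \<psi> ` e" if "e \<in> edges G" for e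
    proof -
      have "e \<subseteq> verts G" using that G by (auto simp: fin_graph_def two_subsets_def)
      then have "(\<lambda>v. \<pi> (\<phi> v)) ` e = \<psi> ` e" by (intro image_cong refl val) (rule subsetD)
      then show ?thesis by (simp only: image_image)
    qed
    then have "(\<lambda>e. \<pi> ` \<phi> ` e) ` edges G = (`) \<psi> ` edges G" by (rule image_cong[OF refl])
    then show ?thesis by (simp only: image_image)
  qed
  have "?g -` labelled_in_mst n G \<phi> \<inter> space (weights n) = labelled_in_mst n G \<psi>"
  proof -
    have "((`) \<phi> ` edges G \<subseteq> mst n (?g w)) = ((`) \<psi> ` edges G \<subseteq> mst n w)" for w
      unfolding mst_permutes[OF p, of w] img[symmetric]
      by (rule inj_image_subset_iff[OF injP, symmetric])
    moreover have "?g w \<in> space (weights n)" if "w \<in> space (weights n)" for w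
      using that by (rule measurable_space[OF gm])
    ultimately show ?thesis
      unfolding labelled_in_mst_def by (intro set_eqI) (auto simp del: restrict_apply)
  qed
  then show ?thesis
    using measure_distr[OF gm labelled_in_mst_sets[of n G \<phi>]] unfolding d by (simp only:)
qed

theorem in_mst_prob_eq:
  assumes "fin_graph G" "labelling n G \<phi>"
  shows "in_mst_prob n G = measure (weights n) (labelled_in_mst n G \<phi>)"
  unfolding in_mst_prob_def
  by (rule the_equality) (use assms labelled_in_mst_exchangeable in blast)+

end

theory Submission
  imports Defs "HOL-Real_Asymp.Real_Asymp"
begin

text \<open>Let X be the number of embeddings of a tree T into the minimum spanning tree M of n
  vertices. By exchangeability the mean of X is the number of injections times the probability that
  T lies in M, and it is at least of order n. Changing the weight of an edge e affects M only
  if e is in M before or after, and then one edge is exchanged for another. So only O(n) edges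
  contribute to the Efron-Stein bound, each by a power of the maximal degree of M, whose moments
  are o(sqrt n), since all edges of M are light. Hence the variance of X is o(n^2). For a forest
  consisting of A and T, the product of the two embedding counts is the count for the union plus the
  few pairs of embeddings that meet, so that the probability factorises up to a factor 1 + o(1); the
  claim follows by induction on the number of edges.\<close>

section \<open>Reachability and the cycle criterion for the minimum spanning tree\<close>

text \<open>The error may depend only on the number of edges, while the forest is arbitrary and may
  have up to \<open>n\<close> vertices; so all estimates use vertex and edge counts alone. A
  labelled copy lies in the tree with probability at least of order \<open>n\<close> to the minus
  number of edges, so the mean count of a forest is at least of order \<open>n\<close> to the number
  of its components. For the forest A the count itself is at most this order times a power of the
  maximal degree. Hence only T needs a variance bound, and the relative error of splitting off T is
  a degree moment divided by \<open>sqrt n\<close>. T must be connected: an exchanged edge then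
  disturbs only maps that hit one vertex, and these number at most a power of the degree, whereas
  further components could move freely and cost powers of \<open>n\<close>. In the Efron-Stein bound
  the weight of an edge is not resampled; the edge is deleted. This calls for a description of the
  tree that survives deletion and is defined for all weights, which a minimiser is not. The cycle
  criterion \<open>kruskal\<close> is such a description, and it agrees with the minimiser almost
  surely.\<close>

definition reach :: "'a set set \<Rightarrow> ('a \<times> 'a) set" where
  "reach E = {(u, v). {u, v} \<in> E}\<^sup>*"

text \<open>The cycle criterion: an edge is discarded exactly when strictly lighter edges already
  join its ends. In this form it makes sense for every edge set, connected or not, and for every
  \<open>w\<close>; deleting an edge just means a smaller \<open>E\<close>.\<close>

definition kruskal :: "'a set set \<Rightarrow> ('a set \<Rightarrow> real) \<Rightarrow> 'a set set" where
  "kruskal E w = {e \<in> E. \<forall>u v. e = {u, v} \<longrightarrow> (u, v) \<notin> reach {g \<in> E. w g < w e}}"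

text \<open>Acyclicity without cycle lists: every edge is a bridge. A loop is excluded as well,
  because a vertex reaches itself.\<close>

definition bridges_only :: "'a set set \<Rightarrow> bool" where
  "bridges_only E \<longleftrightarrow> (\<forall>u v. {u, v} \<in> E \<longrightarrow> (u, v) \<notin> reach (E - {{u, v}}))"

lemma adj_rtrancl: "(adj G)\<^sup>* = reach (edges G)"
  by (simp add: adj_def reach_def)

lemma reach_refl [simp]: "(u, u) \<in> reach E"
  by (simp add: reach_def)

lemma reach_edge: "{u, v} \<in> E \<Longrightarrow> (u, v) \<in> reach E"
  by (auto simp: reach_def)

lemma reach_trans: "(u, v) \<in> reach E \<Longrightarrow> (v, x) \<in> reach E \<Longrightarrow> (u, x) \<in> reach E"
  unfolding reach_def by (rule rtrancl_trans)

lemma reach_sym: "(u, v) \<in> reach E \<Longrightarrow> (v, u) \<in> reach E"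
proof -
  have "sym {(u, v). {u, v} \<in> E}" by (auto simp: sym_def insert_commute)
  then show "(u, v) \<in> reach E \<Longrightarrow> (v, u) \<in> reach E"
    unfolding reach_def by (meson sym_rtrancl symD)
qed

lemma reach_subst:
  assumes "(u, v) \<in> reach E" "\<And>a b. {a, b} \<in> E \<Longrightarrow> (a, b) \<in> reach E'"
  shows "(u, v) \<in> reach E'"
  using assms(1) unfolding reach_def[of E]
  by (induction rule: rtrancl_induct) (auto intro: reach_trans assms(2))

lemma reach_mono: "(u, v) \<in> reach E \<Longrightarrow> E \<subseteq> E' \<Longrightarrow> (u, v) \<in> reach E'"
  by (erule reach_subst) (auto intro: reach_edge)

text \<open>Induction along the walk. It may cross the new edge repeatedly, but every crossing leads
  back to one of the three cases.\<close>

lemma reach_insertD: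
  assumes "(a, b) \<in> reach (insert {u, v} E)"
  shows "(a, b) \<in> reach E \<or> (a, u) \<in> reach E \<and> (v, b) \<in> reach E
    \<or> (a, v) \<in> reach E \<and> (u, b) \<in> reach E"
  using assms unfolding reach_def[of "insert {u, v} E"]
proof (induction rule: rtrancl_induct)
  case base
  then show ?case by simp
next
  case (step y z)
  show ?case
  proof (cases "{y, z} \<in> E")
    case True
    then show ?thesis using step.IH reach_edge[OF True] by (meson reach_trans)
  next
    case False
    then have "y = u \<and> z = v \<or> y = v \<and> z = u"
      using step.hyps by (auto simp: doubleton_eq_iff)
    then show ?thesis using step.IH by (auto intro: reach_trans)
  qed
qed

lemma reach_closed:
  assumes "(u, v) \<in> reach E" "u \<in> S" "\<And>a b. {a, b} \<in> E \<Longrightarrow> a \<in> S \<Longrightarrow> b \<in> S"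
  shows "v \<in> S"
  using assms(1,2) unfolding reach_def
  by (induction rule: rtrancl_induct) (auto intro: assms(3))

text \<open>The walk is made simple as it grows: when the next vertex already lies on the path, the
  path is cut back to that vertex.\<close>

lemma reach_path:
  assumes "(u, v) \<in> reach E"
  shows "\<exists>vs. vs \<noteq> [] \<and> hd vs = u \<and> last vs = v \<and> distinct vs \<and>
    (\<forall>i. Suc i < length vs \<longrightarrow> {vs ! i, vs ! Suc i} \<in> E)"
  using assms unfolding reach_def
proof (induction rule: rtrancl_induct)
  case base
  then show ?case by (intro exI[of _ "[u]"]) auto
next
  case (step y z)
  then obtain vs where vs: "vs \<noteq> []" "hd vs = u" "last vs = y" "distinct vs"
    "\<And>i. Suc i < length vs \<Longrightarrow> {vs ! i, vs ! Suc i} \<in> E" by blast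
  show ?case
  proof (cases "z \<in> set vs")
    case False
    show ?thesis
    proof (intro exI[of _ "vs @ [z]"] conjI allI impI)
      fix i assume i: "Suc i < length (vs @ [z])"
      show "{(vs @ [z]) ! i, (vs @ [z]) ! Suc i} \<in> E"
      proof (cases "Suc i < length vs")
        case True
        then show ?thesis using vs(5)[OF True] by (simp add: nth_append)
      next
        case False
        then have "Suc i = length vs" using i by simp
        then have "vs ! i = y" using vs(1,3) by (metis last_conv_nth diff_Suc_1)
        then show ?thesis using step.hyps \<open>Suc i = length vs\<close> by (simp add: nth_append)
      qed
    qed (use vs False in auto)
  next
    case True
    then obtain k where k: "k < length vs" "vs ! k = z" by (auto simp: in_set_conv_nth)
    show ?thesis
    proof (intro exI[of _ "take (Suc k) vs"] conjI allI impI)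
      show "last (take (Suc k) vs) = z"
        using k by (simp add: take_Suc_conv_app_nth)
    qed (use vs k in auto)
  qed
qed

text \<open>A route between the ends of an edge that avoids it closes up to a cycle with it. The
  path cannot have one vertex, since the ends differ, nor two, since the edge itself was removed; so
  it has the three that \<open>is_cycle\<close> demands.\<close>

lemma forest_bridges_only:
  assumes "is_forest G"
  shows "bridges_only (edges G)"
  unfolding bridges_only_def
proof (intro allI impI notI)
  fix u v assume e: "{u, v} \<in> edges G" and r: "(u, v) \<in> reach (edges G - {{u, v}})"
  have ne: "u \<noteq> v" using assms e by (auto simp: is_forest_def fin_graph_def two_subsets_def)
  from reach_path[OF r] obtain vs where vs: "vs \<noteq> []" "hd vs = u" "last vs = v" "distinct vs"
    "\<And>i. Suc i < length vs \<Longrightarrow> {vs ! i, vs ! Suc i} \<in> edges G - {{u, v}}" by blast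
  have "length vs \<noteq> 1" using vs ne by (auto simp: length_Suc_conv)
  moreover have "length vs \<noteq> 2"
  proof
    assume l: "length vs = 2"
    then have "vs ! 0 = u" "vs ! Suc 0 = v" using vs by (auto simp: hd_conv_nth last_conv_nth)
    then show False using vs(5)[of 0] l by auto
  qed
  moreover have "length vs \<noteq> 0" using vs by simp
  ultimately have "length vs \<ge> 3" by linarith
  then have "is_cycle G vs" using vs e by (auto simp: is_cycle_def insert_commute)
  then show False using assms by (auto simp: is_forest_def)
qed

text \<open>Without its closing edge a cycle still joins the ends of that edge. Having at least
  three distinct vertices keeps the closing edge apart from all consecutive pairs.\<close>

lemma bridges_only_no_cycle:
  assumes "bridges_only (edges G)"
  shows "\<not> is_cycle G vs"
proof
  assume c: "is_cycle G vs"
  let ?e = "{hd vs, last vs}"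
  have l: "length vs \<ge> 3" "distinct vs" using c by (auto simp: is_cycle_def)
  have ne: "vs \<noteq> []" using l by auto
  have step: "{vs ! i, vs ! Suc i} \<in> edges G - {?e}" if "Suc i < length vs" for i
  proof -
    have "{vs ! i, vs ! Suc i} \<noteq> {vs ! 0, vs ! (length vs - 1)}"
    proof
      assume "{vs ! i, vs ! Suc i} = {vs ! 0, vs ! (length vs - 1)}"
      then consider "vs ! i = vs ! 0" "vs ! Suc i = vs ! (length vs - 1)" | "vs ! Suc i = vs ! 0"
        unfolding doubleton_eq_iff by metis
      then show False
      proof cases
        case 1
        have "i < length vs" "0 < length vs" "length vs - 1 < length vs" using that by auto
        then have "i = 0" "Suc i = length vs - 1"
          using 1 that nth_eq_iff_index_eq[OF l(2)] by blast+
        then show False using l(1) by linarith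
      next
        case 2
        then show False using that l nth_eq_iff_index_eq[OF l(2), of "Suc i" 0] by linarith
      qed
    qed
    then show ?thesis using c that ne
      by (auto simp: is_cycle_def hd_conv_nth last_conv_nth)
  qed
  have "(hd vs, vs ! i) \<in> reach (edges G - {?e})" if "i < length vs" for i
    using that
  proof (induction i)
    case 0
    then show ?case using ne by (simp add: hd_conv_nth)
  next
    case (Suc i)
    then show ?case using reach_trans[OF _ reach_edge[OF step[of i]]] by simp
  qed
  from this[of "length vs - 1"] have "(hd vs, last vs) \<in> reach (edges G - {?e})"
    using ne by (simp add: last_conv_nth)
  moreover have "?e \<in> edges G" using c by (simp add: is_cycle_def insert_commute)
  ultimately show False using assms by (auto simp: bridges_only_def)
qed

lemma bridges_only_subset:
  assumes "bridges_only E" "E' \<subseteq> E"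
  shows "bridges_only E'"
  unfolding bridges_only_def
proof (intro allI impI notI)
  fix u v assume "{u, v} \<in> E'" "(u, v) \<in> reach (E' - {{u, v}})"
  then have "{u, v} \<in> E" "(u, v) \<in> reach (E - {{u, v}})"
    using assms(2) by (auto elim: reach_mono)
  then show False using assms(1) by (auto simp: bridges_only_def)
qed

text \<open>If an old edge \<open>{a, b}\<close> stopped being a bridge, its detour would pass
  through \<open>{u, v}\<close>; together with \<open>{a, b}\<close> the detour would then join
  \<open>u\<close> and \<open>v\<close> inside \<open>E\<close>.\<close>

lemma bridges_only_insert:
  assumes E: "bridges_only E" and uv: "(u, v) \<notin> reach E"
  shows "bridges_only (insert {u, v} E)"
  unfolding bridges_only_def
proof (intro allI impI notI)
  fix a b assume ab: "{a, b} \<in> insert {u, v} E"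
    and r: "(a, b) \<in> reach (insert {u, v} E - {{a, b}})"
  show False
  proof (cases "{a, b} = {u, v}")
    case True
    then have "(a, b) \<in> reach E" using r by (auto elim!: reach_mono)
    then show False using True uv reach_sym by (metis doubleton_eq_iff)
  next
    case False
    then have e: "{a, b} \<in> E" using ab by simp
    have "insert {u, v} E - {{a, b}} = insert {u, v} (E - {{a, b}})" using False by auto
    then consider "(a, b) \<in> reach (E - {{a, b}})"
      | "(a, u) \<in> reach (E - {{a, b}})" "(v, b) \<in> reach (E - {{a, b}})"
      | "(a, v) \<in> reach (E - {{a, b}})" "(u, b) \<in> reach (E - {{a, b}})"
      using reach_insertD[of a b u v "E - {{a, b}}"] r by auto
    then show False
    proof cases
      case 1
      then show False using E e by (auto simp: bridges_only_def)
    next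
      case 2
      then have "(a, u) \<in> reach E" "(v, b) \<in> reach E" by (auto elim: reach_mono)
      then show False using uv reach_edge[OF e] by (meson reach_sym reach_trans)
    next
      case 3
      then have "(a, v) \<in> reach E" "(u, b) \<in> reach E" by (auto elim: reach_mono)
      then show False using uv reach_edge[OF e] by (meson reach_sym reach_trans)
    qed
  qed
qed

section \<open>The minimum spanning tree through the cycle criterion\<close>

lemma kruskal_subset: "kruskal E w \<subseteq> E"
  by (auto simp: kruskal_def)

text \<open>The edges are added in order of increasing weight. Each one joins two vertices that the
  strictly lighter edges, hence those added before it, leave separate; injectivity turns the weak
  order of \<open>finite_ranking_induct\<close> into a strict one.\<close>

lemma kruskal_bridges_only:
  assumes fin: "finite E" and inj: "inj_on w E" and two: "\<And>e. e \<in> E \<Longrightarrow> card e = 2"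
  shows "bridges_only (kruskal E w)"
proof -
  have fK: "finite (kruskal E w)" using fin kruskal_subset by (rule rev_finite_subset)
  have "S \<subseteq> kruskal E w \<longrightarrow> bridges_only S" if "finite S" for S
    using that
  proof (induction S rule: finite_ranking_induct[where f = w])
    case empty
    then show ?case by (simp add: bridges_only_def)
  next
    case (insert x S)
    show ?case
    proof
      assume sub: "insert x S \<subseteq> kruskal E w"
      show "bridges_only (insert x S)"
      proof (cases "x \<in> S")
        case True
        then show ?thesis using insert sub by (simp add: insert_absorb)
      next
        case False
        have xK: "x \<in> kruskal E w" and xE: "x \<in> E" using sub kruskal_subset[of E w] by auto
        obtain u v where x: "x = {u, v}" using two[OF xE] by (auto simp: card_2_iff)
        have "S \<subseteq> {g \<in> E. w g < w x}"
        proof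
          fix g assume g: "g \<in> S"
          then have gE: "g \<in> E" using sub kruskal_subset[of E w] by auto
          have "g \<noteq> x" using g False by auto
          then have "w g \<noteq> w x" using inj gE xE by (auto dest: inj_onD)
          then show "g \<in> {g \<in> E. w g < w x}" using insert.hyps(2)[OF g] gE by simp
        qed
        moreover have "(u, v) \<notin> reach {g \<in> E. w g < w x}"
          using xK x by (auto simp: kruskal_def)
        ultimately have "(u, v) \<notin> reach S" by (meson reach_mono)
        then show ?thesis unfolding x
          using insert sub by (intro bridges_only_insert) auto
      qed
    qed
  qed
  then show ?thesis using fK by blast
qed

text \<open>Strong induction on the number of lighter edges: a discarded edge is replaced by a walk
  of strictly lighter ones, whose ends are already joined inside \<open>kruskal E w\<close>.\<close>

lemma kruskal_reach:
  assumes fin: "finite E" and e: "{u, v} \<in> E"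
  shows "(u, v) \<in> reach (kruskal E w)"
proof -
  have "\<forall>u v. e = {u, v} \<longrightarrow> (u, v) \<in> reach (kruskal E w)" if "e \<in> E" for e
    using that
  proof (induction "card {g \<in> E. w g < w e}" arbitrary: e rule: less_induct)
    case less
    show ?case
    proof (cases "e \<in> kruskal E w")
      case True
      then show ?thesis by (auto intro: reach_edge)
    next
      case False
      then obtain a b where ab: "e = {a, b}" "(a, b) \<in> reach {g \<in> E. w g < w e}"
        using less.prems by (auto simp: kruskal_def)
      have "(a, b) \<in> reach (kruskal E w)"
        using ab(2)
      proof (rule reach_subst)
        fix c d assume cd: "{c, d} \<in> {g \<in> E. w g < w e}"
        have "{g \<in> E. w g < w {c, d}} \<subset> {g \<in> E. w g < w e}" using cd by auto
        then have "card {g \<in> E. w g < w {c, d}} < card {g \<in> E. w g < w e}"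
          using fin by (intro psubset_card_mono) auto
        then show "(c, d) \<in> reach (kruskal E w)" using less.hyps cd by blast
      qed
      then show ?thesis using ab(1) reach_sym by (auto simp: doubleton_eq_iff)
    qed
  qed
  then show ?thesis using e by blast
qed

lemma spanning_tree_iff:
  assumes "n \<ge> 1"
  shows "spanning_tree n T \<longleftrightarrow> T \<subseteq> K_edges n \<and> bridges_only T \<and>
    (\<forall>u\<in>{1..n}. \<forall>v\<in>{1..n}. (u, v) \<in> reach T)"
proof -
  have "fin_graph ({1..n}, T) \<longleftrightarrow> T \<subseteq> K_edges n"
    by (simp add: fin_graph_def K_edges_def)
  moreover have "(\<nexists>vs. is_cycle ({1..n}, T) vs) \<longleftrightarrow> bridges_only T" if "T \<subseteq> K_edges n"
    using that bridges_only_no_cycle[of "({1..n}, T)"] forest_bridges_only[of "({1..n}, T)"]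
    by (auto simp: is_forest_def fin_graph_def K_edges_def)
  ultimately show ?thesis using assms
    by (auto simp: spanning_tree_def is_tree_def is_forest_def connected_graph_def adj_rtrancl)
qed

lemma kruskal_spanning_tree:
  assumes n: "n \<ge> 1" and inj: "inj_on w (K_edges n)"
  shows "spanning_tree n (kruskal (K_edges n) w)"
  unfolding spanning_tree_iff[OF n]
proof (intro conjI ballI kruskal_subset)
  show "bridges_only (kruskal (K_edges n) w)"
    by (rule kruskal_bridges_only[OF finite_K_edges inj]) (simp add: K_edges_def two_subsets_def)
  fix u v assume uv: "u \<in> {1..n}" "v \<in> {1..n}"
  show "(u, v) \<in> reach (kruskal (K_edges n) w)"
  proof (cases "u = v")
    case False
    then have "{u, v} \<in> K_edges n" using uv by (auto simp: K_edges_def two_subsets_def)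
    then show ?thesis by (rule kruskal_reach[OF finite_K_edges])
  qed simp
qed

text \<open>Removing \<open>{c, d}\<close> splits the tree into two sides, with \<open>a\<close> and
  \<open>b\<close> on different sides. The new edge therefore reconnects \<open>c\<close> with
  \<open>d\<close>, and every old walk can be rerouted.\<close>

lemma spanning_tree_exchange:
  assumes n: "n \<ge> 1" and T: "spanning_tree n T"
    and g: "{c, d} \<in> T" and f: "{a, b} \<in> K_edges n" "(a, b) \<notin> reach (T - {{c, d}})"
  shows "spanning_tree n (insert {a, b} (T - {{c, d}}))"
  unfolding spanning_tree_iff[OF n]
proof (intro conjI ballI)
  let ?T = "T - {{c, d}}" and ?T' = "insert {a, b} (T - {{c, d}})"
  note T' = T[unfolded spanning_tree_iff[OF n]]
  show "?T' \<subseteq> K_edges n" using T' f by auto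
  show "bridges_only ?T'" using T' f by (auto intro!: bridges_only_insert elim: bridges_only_subset)
  have ab: "a \<in> {1..n}" "b \<in> {1..n}" using f by (auto simp: K_edges_def two_subsets_def)
  have "insert {c, d} ?T = T" using g by auto
  then have "(a, b) \<in> reach (insert {c, d} ?T)" using ab T' by auto
  then have "(a, c) \<in> reach ?T \<and> (d, b) \<in> reach ?T \<or> (a, d) \<in> reach ?T \<and> (c, b) \<in> reach ?T"
    using reach_insertD f(2) by metis
  then have "(a, c) \<in> reach ?T' \<and> (d, b) \<in> reach ?T' \<or> (a, d) \<in> reach ?T' \<and> (c, b) \<in> reach ?T'"
    by (meson reach_mono subset_insertI)
  moreover have "(a, b) \<in> reach ?T'" by (simp add: reach_edge)
  ultimately have cd: "(c, d) \<in> reach ?T'" by (meson reach_sym reach_trans)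
  fix u v assume "u \<in> {1..n}" "v \<in> {1..n}"
  then have "(u, v) \<in> reach T" using T' by blast
  then show "(u, v) \<in> reach ?T'"
  proof (rule reach_subst)
    fix x y assume "{x, y} \<in> T"
    then show "(x, y) \<in> reach ?T'"
      using cd by (cases "{x, y} = {c, d}") (auto simp: doubleton_eq_iff intro: reach_edge reach_sym)
  qed
qed

text \<open>Suppose a minimal tree had an edge \<open>g\<close> that closes a cycle with lighter
  edges. One of these crosses the split of \<open>T - {g}\<close>, and exchanging it for
  \<open>g\<close> lowers the total. So \<open>T\<close> lies inside the acyclic
  \<open>kruskal\<close> set, and a spanning set cannot be properly contained in an acyclic
  one.\<close>

lemma minimal_spanning_tree_kruskal:
  assumes n: "n \<ge> 1" and inj: "inj_on w (K_edges n)" and T: "minimal_spanning_tree n w T"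
  shows "T = kruskal (K_edges n) w"
proof -
  let ?E = "K_edges n"
  have st: "spanning_tree n T" using T by (simp add: minimal_spanning_tree_def)
  note st' = st[unfolded spanning_tree_iff[OF n]]
  have finT: "finite T" using st' finite_K_edges finite_subset by blast
  have sub: "T \<subseteq> kruskal ?E w"
  proof (rule ccontr)
    assume "\<not> T \<subseteq> kruskal ?E w"
    then obtain g where g: "g \<in> T" "g \<notin> kruskal ?E w" by blast
    then obtain c d where cd: "g = {c, d}" "(c, d) \<in> reach {h \<in> ?E. w h < w g}"
      using st' by (auto simp: kruskal_def)
    have "(c, d) \<notin> reach (T - {{c, d}})" using st' g cd by (auto simp: bridges_only_def)
    then obtain a b where ab: "{a, b} \<in> {h \<in> ?E. w h < w g}" "(a, b) \<notin> reach (T - {{c, d}})"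
      using reach_subst[OF cd(2)] by blast
    let ?T' = "insert {a, b} (T - {{c, d}})"
    have st2: "spanning_tree n ?T'"
      using g cd(1) ab by (intro spanning_tree_exchange[OF n st]) auto
    have "{a, b} \<notin> T - {{c, d}}" using ab(2) reach_edge by metis
    then have "sum w ?T' = w {a, b} + sum w (T - {{c, d}})" using finT by simp
    also have "\<dots> < w {c, d} + sum w (T - {{c, d}})" using ab(1) cd(1) by simp
    also have "\<dots> = sum w T" using g(1) cd(1) finT by (simp add: sum.remove)
    finally show False using T st2 by (auto simp: minimal_spanning_tree_def)
  qed
  moreover have "kruskal ?E w \<subseteq> T"
  proof
    fix e assume e: "e \<in> kruskal ?E w"
    then have "e \<in> ?E" using kruskal_subset by blast
    then obtain u v where uv: "e = {u, v}" "u \<in> {1..n}" "v \<in> {1..n}"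
      by (auto simp: K_edges_def two_subsets_def card_2_iff)
    show "e \<in> T"
    proof (rule ccontr)
      assume "e \<notin> T"
      then have "T \<subseteq> kruskal ?E w - {{u, v}}" using sub uv by auto
      then have "(u, v) \<in> reach (kruskal ?E w - {{u, v}})" using st' uv reach_mono by metis
      moreover have "bridges_only (kruskal ?E w)"
        using kruskal_spanning_tree[OF n inj] by (simp add: spanning_tree_iff[OF n])
      ultimately show False using e uv by (auto simp: bridges_only_def)
    qed
  qed
  ultimately show ?thesis by (rule equalityI)
qed

lemma mst_eq_kruskal:
  assumes n: "n \<ge> 1" and inj: "inj_on w (K_edges n)"
  shows "mst n w = kruskal (K_edges n) w"
proof -
  have "{T. spanning_tree n T} \<noteq> {}" using kruskal_spanning_tree[OF n inj] by blast
  from arg_min_if_finite[OF finite_spanning_trees this, of "sum w"]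
  obtain T where "spanning_tree n T" "\<And>T'. spanning_tree n T' \<Longrightarrow> \<not> sum w T' < sum w T"
    by blast
  then have T: "minimal_spanning_tree n w T"
    by (auto simp: minimal_spanning_tree_def not_less)
  then have "\<exists>!T. minimal_spanning_tree n w T"
    using minimal_spanning_tree_kruskal[OF n inj] by blast
  then have "minimal_spanning_tree n w (mst n w)"
    unfolding mst_def by (simp add: theI')
  then show ?thesis by (rule minimal_spanning_tree_kruskal[OF n inj])
qed

section \<open>The effect of deleting one edge\<close>

text \<open>The discarded edge has a detour of lighter edges, present below every threshold below
  which the edge itself is present. Deleting it thus changes no reachability relation of the
  criterion.\<close>

lemma kruskal_delete_nonmember:
  assumes fin: "finite E" and e: "e \<in> E" "e \<notin> kruskal E w"
  shows "kruskal (E - {e}) w = kruskal E w"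
proof -
  obtain u v where uv: "e = {u, v}" "(u, v) \<in> reach {g \<in> E. w g < w e}"
    using e by (auto simp: kruskal_def)
  have "(a, b) \<in> reach {g \<in> E. w g < t} \<longleftrightarrow> (a, b) \<in> reach {g \<in> E - {e}. w g < t}" for a b t
  proof
    assume "(a, b) \<in> reach {g \<in> E. w g < t}"
    then show "(a, b) \<in> reach {g \<in> E - {e}. w g < t}"
    proof (rule reach_subst)
      fix c d assume cd: "{c, d} \<in> {g \<in> E. w g < t}"
      show "(c, d) \<in> reach {g \<in> E - {e}. w g < t}"
      proof (cases "{c, d} = e")
        case True
        have "(u, v) \<in> reach {g \<in> E - {e}. w g < t}"
          using uv(2) by (rule reach_mono) (use True cd in auto)
        then show ?thesis using True uv(1) reach_sym by (auto simp: doubleton_eq_iff)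
      qed (use cd in \<open>auto intro: reach_edge\<close>)
    qed
  qed (auto elim: reach_mono)
  then show ?thesis using e(2) by (auto simp: kruskal_def)
qed

lemma kruskal_delete_supset: "kruskal E w - {e} \<subseteq> kruskal (E - {e}) w"
proof
  fix f assume f: "f \<in> kruskal E w - {e}"
  have "(u, v) \<notin> reach {g \<in> E - {e}. w g < w f}" if "f = {u, v}" for u v
  proof
    assume "(u, v) \<in> reach {g \<in> E - {e}. w g < w f}"
    then have "(u, v) \<in> reach {g \<in> E. w g < w f}" by (rule reach_mono) auto
    then show False using f that by (auto simp: kruskal_def)
  qed
  then show "f \<in> kruskal (E - {e}) w" using f by (auto simp: kruskal_def)
qed

text \<open>A new edge \<open>h\<close> enters because its lighter connections all ran through
  \<open>e = {u, v}\<close>; without \<open>e\<close>, lighter edges still tie one end of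
  \<open>h\<close> to \<open>u\<close> and the other to \<open>v\<close>. Of two such edges the
  lighter one reconnects \<open>u\<close> and \<open>v\<close> below the weight of the heavier,
  which therefore closes a cycle.\<close>

lemma kruskal_delete_le_one:
  assumes inj: "inj_on w E" and e: "e \<in> E" "card e = 2"
    and f: "f \<in> kruskal (E - {e}) w - kruskal E w"
    and g: "g \<in> kruskal (E - {e}) w - kruskal E w"
  shows "f = g"
proof -
  obtain u v where uv: "e = {u, v}" using e by (auto simp: card_2_iff)
  have *: False if f: "f \<in> kruskal (E - {e}) w - kruskal E w"
    and g: "g \<in> kruskal (E - {e}) w - kruskal E w" and lt: "w f < w g" for f g
  proof -
    have sep: "\<exists>a b. h = {a, b} \<and> (a, b) \<notin> reach {g \<in> E - {e}. w g < w h} \<and>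
        (a, u) \<in> reach {g \<in> E - {e}. w g < w h} \<and> (v, b) \<in> reach {g \<in> E - {e}. w g < w h}"
      if h: "h \<in> kruskal (E - {e}) w - kruskal E w" for h
    proof -
      let ?S = "{g \<in> E - {e}. w g < w h}"
      obtain a b where ab: "h = {a, b}" "(a, b) \<in> reach {g \<in> E. w g < w h}"
        using h by (auto simp: kruskal_def)
      have n: "(a, b) \<notin> reach ?S" "(b, a) \<notin> reach ?S"
      proof -
        show "(a, b) \<notin> reach ?S" using h ab(1) by (simp add: kruskal_def)
        then show "(b, a) \<notin> reach ?S" using reach_sym by metis
      qed
      have "(a, b) \<in> reach (insert {u, v} ?S)"
        using ab(2) by (rule reach_mono) (use uv in auto)
      then have "(a, u) \<in> reach ?S \<and> (v, b) \<in> reach ?S \<or> (a, v) \<in> reach ?S \<and> (u, b) \<in> reach ?S"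
        using n(1) by (auto dest: reach_insertD)
      then show ?thesis
      proof
        assume "(a, u) \<in> reach ?S \<and> (v, b) \<in> reach ?S"
        then show ?thesis using n(1) ab(1) by blast
      next
        assume r: "(a, v) \<in> reach ?S \<and> (u, b) \<in> reach ?S"
        have "(b, u) \<in> reach ?S" "(v, a) \<in> reach ?S" using r by (blast intro: reach_sym)+
        moreover have "h = {b, a}" using ab(1) by (simp add: insert_commute)
        ultimately show ?thesis using n(2) by blast
      qed
    qed
    obtain a b where ab: "f = {a, b}" "(a, u) \<in> reach {g \<in> E - {e}. w g < w f}"
      "(v, b) \<in> reach {g \<in> E - {e}. w g < w f}" using sep[OF f] by blast
    obtain c d where cd: "(c, d) \<notin> reach {h \<in> E - {e}. w h < w g}"
      "(c, u) \<in> reach {h \<in> E - {e}. w h < w g}" "(v, d) \<in> reach {h \<in> E - {e}. w h < w g}"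
      using sep[OF g] by blast
    let ?S = "{h \<in> E - {e}. w h < w g}"
    have "(a, u) \<in> reach ?S" "(v, b) \<in> reach ?S"
      using ab(2,3) lt by (auto elim!: reach_mono)
    moreover have "(a, b) \<in> reach ?S"
      using f ab(1) lt by (auto simp: kruskal_def intro!: reach_edge)
    ultimately show False using cd by (meson reach_sym reach_trans)
  qed
  have "f \<in> E" "g \<in> E" using f g kruskal_subset by blast+
  moreover have "w f = w g" using *[OF f g] *[OF g f] by (meson linorder_less_linear)
  ultimately show ?thesis using inj by (auto dest: inj_onD)
qed

section \<open>The Efron-Stein inequality\<close>

lemma (in prob_space) integrable_bounded:
  fixes F :: "'a \<Rightarrow> real"
  assumes "F \<in> borel_measurable M" "\<And>x. \<bar>F x\<bar> \<le> B"
  shows "integrable M F"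
  by (rule integrable_const_bound[where B = B]) (use assms in auto)

lemma (in prob_space) integral_sq_shift:
  fixes F :: "'a \<Rightarrow> real"
  assumes F: "F \<in> borel_measurable M" "\<And>x. \<bar>F x\<bar> \<le> B"
  shows "(\<integral>x. (F x - c)\<^sup>2 \<partial>M) = (\<integral>x. (F x)\<^sup>2 \<partial>M) - 2 * c * (\<integral>x. F x \<partial>M) + c\<^sup>2"
proof -
  have i1: "integrable M F" using F by (rule integrable_bounded)
  have i2: "integrable M (\<lambda>x. (F x)\<^sup>2)"
  proof (rule integrable_bounded[where B = "B\<^sup>2"])
    show "\<bar>(F x)\<^sup>2\<bar> \<le> B\<^sup>2" for x
      using power_mono[OF F(2)[of x], of 2] by simp
  qed (use F(1) in measurable)
  have "(\<integral>x. (F x - c)\<^sup>2 \<partial>M) = (\<integral>x. (F x)\<^sup>2 - 2 * c * F x + c\<^sup>2 \<partial>M)"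
    by (simp add: power2_diff algebra_simps)
  also have "\<dots> = (\<integral>x. (F x)\<^sup>2 \<partial>M) - 2 * c * (\<integral>x. F x \<partial>M) + c\<^sup>2"
    using i1 i2 by (simp add: prob_space)
  finally show ?thesis .
qed

lemma (in prob_space) integral_sq_le:
  fixes F :: "'a \<Rightarrow> real"
  assumes F: "F \<in> borel_measurable M" "\<And>x. \<bar>F x\<bar> \<le> B"
  shows "(\<integral>x. F x \<partial>M)\<^sup>2 \<le> (\<integral>x. (F x)\<^sup>2 \<partial>M)"
proof -
  have "0 \<le> (\<integral>x. (F x - (\<integral>x. F x \<partial>M))\<^sup>2 \<partial>M)" by simp
  also have "\<dots> = (\<integral>x. (F x)\<^sup>2 \<partial>M) - (\<integral>x. F x \<partial>M)\<^sup>2"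
    unfolding integral_sq_shift[OF F] by (simp add: power2_eq_square)
  finally show ?thesis by simp
qed

text \<open>The two sides differ by the square of the mean minus \<open>c\<close>.\<close>

lemma (in prob_space) integral_var_le:
  fixes F :: "'a \<Rightarrow> real"
  assumes F: "F \<in> borel_measurable M" "\<And>x. \<bar>F x\<bar> \<le> B"
  shows "(\<integral>x. (F x)\<^sup>2 \<partial>M) - (\<integral>x. F x \<partial>M)\<^sup>2 \<le> (\<integral>x. (F x - c)\<^sup>2 \<partial>M)"
proof -
  have "0 \<le> ((\<integral>x. F x \<partial>M) - c)\<^sup>2" by simp
  then show ?thesis
    unfolding integral_sq_shift[OF F] by (simp add: power2_diff algebra_simps)
qed

lemma efron_stein:
  fixes f :: "('i \<Rightarrow> 'a) \<Rightarrow> real" and g :: "'i \<Rightarrow> ('i \<Rightarrow> 'a) \<Rightarrow> real"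
  assumes prob: "\<And>i. prob_space (M i)" and I: "finite I"
    and f: "f \<in> borel_measurable (PiM I M)" "\<And>x. \<bar>f x\<bar> \<le> B"
    and g: "\<And>i. i \<in> I \<Longrightarrow> g i \<in> borel_measurable (PiM I M)" "\<And>i x. i \<in> I \<Longrightarrow> \<bar>g i x\<bar> \<le> B"
    and gi: "\<And>i x y. i \<in> I \<Longrightarrow> g i (x(i := y)) = g i x"
  shows "(\<integral>x. (f x)\<^sup>2 \<partial>PiM I M) - (\<integral>x. f x \<partial>PiM I M)\<^sup>2 \<le> (\<Sum>i\<in>I. \<integral>x. (f x - g i x)\<^sup>2 \<partial>PiM I M)"
  using I f g gi
proof (induction I arbitrary: f g rule: finite_induct)
  case empty
  show ?case by (simp add: PiM_empty lebesgue_integral_count_space_finite)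
next
  case (insert i I)
  interpret product_sigma_finite M
    by (rule product_sigma_finite.intro) (rule prob_space_imp_sigma_finite[OF prob])
  note meas = insert.prems(1,3) and bd = insert.prems(2,4) and gi = insert.prems(5)
  let ?P = "PiM I M" and ?Q = "PiM (insert i I) M"
  interpret N: prob_space "M i" by (rule prob)
  interpret P: prob_space ?P by (rule prob_space_PiM[OF prob])
  interpret Q: prob_space ?Q by (rule prob_space_PiM[OF prob])
  define A where "A F x = (\<integral>y. F (x(i := y)) \<partial>M i)" for F :: "('i \<Rightarrow> 'a) \<Rightarrow> real" and x
  have B: "B \<ge> 0" using bd(1) by (meson abs_ge_zero order_trans)
  have Am [measurable]: "A F \<in> borel_measurable ?P" if F [measurable]: "F \<in> borel_measurable ?Q" for F
    unfolding A_def
    by measurable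
  have Fy: "(\<lambda>y. F (x(i := y))) \<in> borel_measurable (M i)"
    if [measurable]: "F \<in> borel_measurable ?Q" and [measurable]: "x \<in> space ?P" for F :: "('i \<Rightarrow> 'a) \<Rightarrow> real" and x
    using measurable_comp[OF measurable_component_update[OF that(2) insert.hyps(2)] that(1)]
    by (simp add: comp_def)
  \<comment> \<open>The bound is claimed for every \<open>x\<close>, also outside the space, where
    the integrand may fail to be integrable; the integral is then 0 by convention.\<close>
  have Ab: "\<bar>A F x\<bar> \<le> C" if b: "\<And>x. \<bar>F x\<bar> \<le> C" for F x C
  proof (cases "integrable (M i) (\<lambda>y. F (x(i := y)))")
    case True
    have "\<bar>A F x\<bar> \<le> (\<integral>y. \<bar>F (x(i := y))\<bar> \<partial>M i)"
      unfolding A_def by (rule integral_abs_bound)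
    also have "\<dots> \<le> (\<integral>y. C \<partial>M i)"
      by (rule integral_mono) (use True b in auto)
    finally show ?thesis by (simp add: N.prob_space)
  next
    case False
    have "0 \<le> C" using b by (meson abs_ge_zero order_trans)
    then show ?thesis unfolding A_def using False by (simp add: not_integrable_integral_eq)
  qed
  have fub: "(\<integral>x. F x \<partial>?Q) = (\<integral>x. A F x \<partial>?P)"
    if "F \<in> borel_measurable ?Q" "\<And>x. \<bar>F x\<bar> \<le> C" for F C
    unfolding A_def
    by (rule product_integral_insert[OF insert.hyps Q.integrable_bounded[OF that]])
  have sqb: "\<bar>t\<^sup>2\<bar> \<le> C\<^sup>2" if "\<bar>t\<bar> \<le> C" for t C :: real
    using that by (simp add: abs_le_square_iff[symmetric])
  have db: "\<bar>f x - g j x\<bar> \<le> 2 * B" if "j \<in> insert i I" for j x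
    using bd(1)[of x] bd(2)[OF that, of x] by linarith
  note m = meas(1) meas(2)
  let ?h = "A f" and ?g = "\<lambda>j. A (g j)"
  have d: "(\<lambda>x. (f x - g j x)\<^sup>2) \<in> borel_measurable ?Q" "\<And>x. \<bar>(f x - g j x)\<^sup>2\<bar> \<le> (2 * B)\<^sup>2"
    if "j \<in> insert i I" for j
    using m that sqb[OF db[OF that]] by auto
  have s: "(\<lambda>x. (f x)\<^sup>2) \<in> borel_measurable ?Q" "\<And>x. \<bar>(f x)\<^sup>2\<bar> \<le> B\<^sup>2"
    using m sqb[OF bd(1)] by auto
  have IH: "(\<integral>x. (?h x)\<^sup>2 \<partial>?P) - (\<integral>x. ?h x \<partial>?P)\<^sup>2 \<le> (\<Sum>j\<in>I. \<integral>x. (?h x - ?g j x)\<^sup>2 \<partial>?P)"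
  proof (rule insert.IH)
    show "?h \<in> borel_measurable ?P" using m by measurable
    show "\<bar>?h x\<bar> \<le> B" for x by (rule Ab[OF bd(1)])
    fix j assume j: "j \<in> I"
    show "?g j \<in> borel_measurable ?P" by (rule Am[OF m(2)[OF insertI2[OF j]]])
    show "\<bar>?g j x\<bar> \<le> B" for x by (rule Ab[OF bd(2)[OF insertI2[OF j]]])
    have "i \<noteq> j" using j insert.hyps by auto
    then have "j \<noteq> i" by simp
    then have "g j ((x(j := y))(i := z)) = g j (x(i := z))" for x y z
      using gi[OF insertI2[OF j], of "x(i := z)" y] by (simp only: fun_upd_twist[OF \<open>j \<noteq> i\<close>])
    then show "?g j (x(j := y)) = ?g j x" for x y
      unfolding A_def by (simp only:)
  qed
  have p1: "A (\<lambda>x. (f x)\<^sup>2) x - (?h x)\<^sup>2 \<le> A (\<lambda>x. (f x - g i x)\<^sup>2) x" if "x \<in> space ?P" for x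
    using N.integral_var_le[OF Fy[OF m(1) that] bd(1), of "g i x"]
    unfolding A_def gi[OF insertI1] .
  \<comment> \<open>Jensen's inequality in coordinate \<open>i\<close>: averaging can only bring
    \<open>f\<close> and \<open>g j\<close> closer in square mean.\<close>
  have p2: "(?h x - ?g j x)\<^sup>2 \<le> A (\<lambda>x. (f x - g j x)\<^sup>2) x" if x: "x \<in> space ?P" and j: "j \<in> I" for x j
  proof -
    have j': "j \<in> insert i I" using j by simp
    have i1: "integrable (M i) (\<lambda>y. f (x(i := y)))"
      by (rule N.integrable_bounded[OF Fy[OF m(1) x] bd(1)])
    have i2: "integrable (M i) (\<lambda>y. g j (x(i := y)))"
      by (rule N.integrable_bounded[OF Fy[OF m(2)[OF j'] x] bd(2)[OF j']])
    have "?h x - ?g j x = (\<integral>y. f (x(i := y)) - g j (x(i := y)) \<partial>M i)"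
      unfolding A_def using i1 i2 by simp
    also have "\<dots>\<^sup>2 \<le> (\<integral>y. (f (x(i := y)) - g j (x(i := y)))\<^sup>2 \<partial>M i)"
      using i1 i2 db[OF j'] by (intro N.integral_sq_le[where B = "2 * B"]) auto
    finally show ?thesis unfolding A_def .
  qed
  have hb: "\<bar>(?h x)\<^sup>2\<bar> \<le> B\<^sup>2" for x by (rule sqb[OF Ab[OF bd(1)]])
  have ih: "integrable ?P (\<lambda>x. (?h x)\<^sup>2)"
    by (rule P.integrable_bounded[OF _ hb]) (use m in measurable)
  have isq: "integrable ?P (A (\<lambda>x. (f x)\<^sup>2))"
    by (rule P.integrable_bounded[OF Am[OF s(1)] Ab[OF s(2)]])
  have idf: "integrable ?P (A (\<lambda>x. (f x - g j x)\<^sup>2))" if "j \<in> insert i I" for j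
    by (rule P.integrable_bounded[OF Am[OF d(1)[OF that]] Ab[OF d(2)[OF that]]])
  have idh: "integrable ?P (\<lambda>x. (?h x - ?g j x)\<^sup>2)" if "j \<in> I" for j
  proof (rule P.integrable_bounded[where B = "(2 * B)\<^sup>2"])
    show "(\<lambda>x. (?h x - ?g j x)\<^sup>2) \<in> borel_measurable ?P"
      using Am[OF m(1)] Am[OF m(2)[OF insertI2[OF that]]] by measurable
    show "\<bar>(?h x - ?g j x)\<^sup>2\<bar> \<le> (2 * B)\<^sup>2" for x
    proof (rule sqb)
      have "\<bar>?h x\<bar> \<le> B" by (rule Ab[OF bd(1)])
      moreover have "\<bar>?g j x\<bar> \<le> B" by (rule Ab[OF bd(2)[OF insertI2[OF that]]])
      ultimately show "\<bar>?h x - ?g j x\<bar> \<le> 2 * B" by linarith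
    qed
  qed
  have "(\<integral>x. (f x)\<^sup>2 \<partial>?Q) - (\<integral>x. f x \<partial>?Q)\<^sup>2
      = (\<integral>x. A (\<lambda>x. (f x)\<^sup>2) x - (?h x)\<^sup>2 \<partial>?P) + ((\<integral>x. (?h x)\<^sup>2 \<partial>?P) - (\<integral>x. ?h x \<partial>?P)\<^sup>2)"
    unfolding fub[OF s] fub[OF m(1) bd(1)] using isq ih by simp
  also have "\<dots> \<le> (\<integral>x. A (\<lambda>x. (f x - g i x)\<^sup>2) x \<partial>?P) + (\<Sum>j\<in>I. \<integral>x. (?h x - ?g j x)\<^sup>2 \<partial>?P)"
    by (intro add_mono IH integral_mono) (use isq ih idf p1 in auto)
  also have "\<dots> \<le> (\<integral>x. A (\<lambda>x. (f x - g i x)\<^sup>2) x \<partial>?P)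
      + (\<Sum>j\<in>I. \<integral>x. A (\<lambda>x. (f x - g j x)\<^sup>2) x \<partial>?P)"
    by (intro add_mono order_refl sum_mono integral_mono) (use idh idf p2 in auto)
  also have "\<dots> = (\<Sum>j\<in>insert i I. \<integral>x. (f x - g j x)\<^sup>2 \<partial>?Q)"
    using insert.hyps by (simp add: fub[OF d])
  finally show ?case .
qed

section \<open>The law of the weights\<close>

abbreviation unif :: "real measure" where
  "unif \<equiv> uniform_measure lborel {0..1}"

lemma prob_space_weights: "prob_space (weights n)"
  unfolding weights_def by (rule prob_space_PiM[OF prob_space_unif])

lemma unif_less:
  assumes "0 \<le> p" "p \<le> 1"
  shows "measure unif {..<p} = p" "measure unif {p..} = 1 - p"
proof -
  have "{0..1} \<inter> {..<p} = {0..<p}" "{0..1} \<inter> {p..} = {p..1}" using assms by auto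
  then show "measure unif {..<p} = p" "measure unif {p..} = 1 - p"
    using assms by (simp_all add: measure_uniform_measure)
qed

lemma weights_box:
  assumes J: "J \<subseteq> K_edges n" and B: "\<And>e. e \<in> J \<Longrightarrow> B e \<in> sets borel"
  shows "measure (weights n) {w \<in> space (weights n). \<forall>e\<in>J. w e \<in> B e} = (\<Prod>e\<in>J. measure unif (B e))"
    "{w \<in> space (weights n). \<forall>e\<in>J. w e \<in> B e} \<in> sets (weights n)"
proof -
  interpret product_prob_space "\<lambda>_. unif" "K_edges n"
    by (rule product_prob_spaceI) (rule prob_space_unif)
  have fJ: "finite J" using J finite_K_edges by (rule finite_subset)
  have eq: "{w \<in> space (weights n). \<forall>e\<in>J. w e \<in> B e} = prod_emb (K_edges n) (\<lambda>_. unif) J (Pi\<^sub>E J B)"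
    unfolding prod_emb_def weights_def using J by (auto simp: space_PiM Pi_iff)
  show "measure (weights n) {w \<in> space (weights n). \<forall>e\<in>J. w e \<in> B e} = (\<Prod>e\<in>J. measure unif (B e))"
    unfolding eq unfolding weights_def by (rule measure_PiM_emb) (use J fJ B in auto)
  show "{w \<in> space (weights n). \<forall>e\<in>J. w e \<in> B e} \<in> sets (weights n)"
    unfolding eq unfolding weights_def by (rule sets_PiM_I) (use J fJ B in auto)
qed

lemma component_measurable: "e \<in> K_edges n \<Longrightarrow> (\<lambda>w. w e) \<in> borel_measurable (weights n)"
proof -
  assume "e \<in> K_edges n"
  then have "(\<lambda>w. w e) \<in> measurable (weights n) unif"
    unfolding weights_def by (rule measurable_component_singleton)
  then show ?thesis by (simp add: measurable_def)
qed

text \<open>Fubini in the coordinate \<open>f\<close>: with the other weights fixed, only the single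
  value \<open>x e\<close> is bad, and a point has measure zero.\<close>

lemma AE_weights_neq:
  assumes e: "e \<in> K_edges n" and f: "f \<in> K_edges n" and ne: "e \<noteq> f"
  shows "AE w in weights n. w e \<noteq> w f"
proof -
  interpret product_sigma_finite "\<lambda>_ :: nat set. unif"
    by (rule product_sigma_finite.intro) (rule prob_space_imp_sigma_finite[OF prob_space_unif])
  let ?I = "K_edges n - {f}"
  let ?A = "{w \<in> space (weights n). w e = w f}"
  have I: "K_edges n = insert f ?I" using f by auto
  have A [measurable]: "?A \<in> sets (weights n)"
    using component_measurable[OF e] component_measurable[OF f] by measurable
  have "emeasure (weights n) ?A = (\<integral>\<^sup>+w. indicator ?A w \<partial>weights n)" by simp
  also have "\<dots> = (\<integral>\<^sup>+w. indicator ?A w \<partial>PiM (insert f ?I) (\<lambda>_. unif))"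
    unfolding weights_def using I by simp
  also have "\<dots> = (\<integral>\<^sup>+x. \<integral>\<^sup>+y. indicator ?A (x(f := y)) \<partial>unif \<partial>PiM ?I (\<lambda>_. unif))"
  proof (rule product_nn_integral_insert)
    show "indicator ?A \<in> borel_measurable (PiM (insert f ?I) (\<lambda>_. unif))"
      using A unfolding I[symmetric] weights_def by measurable
  qed (use finite_K_edges in auto)
  also have "\<dots> \<le> (\<integral>\<^sup>+x. \<integral>\<^sup>+y. indicator {x e} y \<partial>unif \<partial>PiM ?I (\<lambda>_. unif))"
    using ne by (intro nn_integral_mono) (auto simp: indicator_def)
  also have "\<dots> = 0"
  proof -
    have "emeasure unif {t} = 0" for t
    proof -
      have "emeasure lborel ({0..1} \<inter> {t}) \<le> emeasure lborel {t}" by (rule emeasure_mono) auto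
      then show ?thesis by simp
    qed
    then show ?thesis by simp
  qed
  finally have "emeasure (weights n) ?A = 0" by simp
  then have "AE w in weights n. w \<notin> ?A" using A by (intro AE_not_in) auto
  then show ?thesis by (rule AE_mp) (auto intro!: AE_I2)
qed

lemma AE_weights_inj: "AE w in weights n. inj_on w (K_edges n)"
proof -
  have "AE w in weights n. \<forall>e\<in>K_edges n. \<forall>f\<in>K_edges n. e \<noteq> f \<longrightarrow> w e \<noteq> w f"
  proof (intro AE_finite_allI finite_K_edges)
    fix e f assume "e \<in> K_edges n" "f \<in> K_edges n"
    then show "AE w in weights n. e \<noteq> f \<longrightarrow> w e \<noteq> w f"
      using AE_weights_neq[of e n f] by (cases "e = f") auto
  qed
  then show ?thesis by (rule AE_mp) (rule AE_I2, unfold inj_on_def, blast)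
qed

lemma AE_mst_eq_kruskal: "n \<ge> 1 \<Longrightarrow> AE w in weights n. mst n w = kruskal (K_edges n) w"
  by (rule AE_mp[OF AE_weights_inj]) (rule AE_I2, rule impI, rule mst_eq_kruskal)

section \<open>Measurability and integrability of functions of the tree\<close>

text \<open>Equality with a given subset of \<open>E\<close> is a finite conjunction of membership
  conditions.\<close>

lemma set_valued_measurable:
  assumes E: "finite E" and sub: "\<And>x. x \<in> space M \<Longrightarrow> \<Phi> x \<subseteq> E"
    and m: "\<And>e. e \<in> E \<Longrightarrow> {x \<in> space M. e \<in> \<Phi> x} \<in> sets M"
  shows "\<Phi> \<in> measurable M (count_space (Pow E))"
proof (rule measurable_count_space_eq2[THEN iffD2])
  show "finite (Pow E)" using E by simp
  show "\<Phi> \<in> space M \<rightarrow> Pow E \<and> (\<forall>a\<in>Pow E. \<Phi> -` {a} \<inter> space M \<in> sets M)"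
  proof (intro conjI ballI)
    show "\<Phi> \<in> space M \<rightarrow> Pow E" using sub by auto
    fix S assume S: "S \<in> Pow E"
    have "\<Phi> -` {S} \<inter> space M = {x \<in> space M. \<forall>e\<in>E. e \<in> \<Phi> x \<longleftrightarrow> e \<in> S}"
    proof (intro set_eqI iffI)
      fix x assume "x \<in> {x \<in> space M. \<forall>e\<in>E. e \<in> \<Phi> x \<longleftrightarrow> e \<in> S}"
      then have x: "x \<in> space M" "\<forall>e\<in>E. e \<in> \<Phi> x \<longleftrightarrow> e \<in> S" by auto
      moreover have "\<Phi> x \<subseteq> E" by (rule sub[OF x(1)])
      ultimately have "\<Phi> x = S" using S by blast
      then show "x \<in> \<Phi> -` {S} \<inter> space M" using x by simp
    qed auto
    also have "\<dots> \<in> sets M"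
    proof (rule sets.sets_Collect_finite_All[OF _ E])
      fix e assume e: "e \<in> E"
      show "{x \<in> space M. (e \<in> \<Phi> x) = (e \<in> S)} \<in> sets M"
        using m[OF e] sets.sets_Collect_neg[OF m[OF e]] by (cases "e \<in> S") auto
    qed
    finally show "\<Phi> -` {S} \<inter> space M \<in> sets M" .
  qed
qed

text \<open>Membership of \<open>e\<close> depends only on the set of edges lighter than
  \<open>e\<close>, and that random set is measurable because the comparisons
  \<open>w g < w e\<close> are; so the set-valued criterion applies twice.\<close>

lemma kruskal_measurable:
  assumes E: "E \<subseteq> K_edges n"
  shows "kruskal E \<in> measurable (weights n) (count_space (Pow E))"
proof (rule set_valued_measurable)
  show fE: "finite E" using E finite_K_edges by (rule finite_subset)
  show "kruskal E w \<subseteq> E" for w by (rule kruskal_subset)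
  fix e assume e: "e \<in> E"
  have "(\<lambda>w. {g \<in> E. w g < w e}) \<in> measurable (weights n) (count_space (Pow E))"
  proof (rule set_valued_measurable[OF fE])
    fix g assume "g \<in> E"
    then have "(\<lambda>w. w g) \<in> borel_measurable (weights n)" "(\<lambda>w. w e) \<in> borel_measurable (weights n)"
      using e E by (auto intro!: component_measurable)
    then have "{w \<in> space (weights n). w g < w e} \<in> sets (weights n)" by measurable
    then show "{w \<in> space (weights n). g \<in> {g \<in> E. w g < w e}} \<in> sets (weights n)"
      using \<open>g \<in> E\<close> by simp
  qed auto
  note m = this
  have "(\<lambda>w. {g \<in> E. w g < w e}) -` {S \<in> Pow E. \<forall>u v. e = {u, v} \<longrightarrow> (u, v) \<notin> reach S}
      \<inter> space (weights n) \<in> sets (weights n)"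
    by (rule measurable_sets[OF m]) auto
  also have "(\<lambda>w. {g \<in> E. w g < w e}) -` {S \<in> Pow E. \<forall>u v. e = {u, v} \<longrightarrow> (u, v) \<notin> reach S}
      \<inter> space (weights n) = {w \<in> space (weights n). e \<in> kruskal E w}"
    using e by (auto simp: kruskal_def)
  finally show "{w \<in> space (weights n). e \<in> kruskal E w} \<in> sets (weights n)" .
qed

lemma kruskal_fun_measurable:
  fixes h :: "nat set set \<Rightarrow> real"
  assumes E: "E \<subseteq> K_edges n"
  shows "(\<lambda>w. h (kruskal E w)) \<in> borel_measurable (weights n)"
  using measurable_comp[OF kruskal_measurable[OF E], of h borel] by (simp add: comp_def)

text \<open>Only finitely many edge sets occur as values, so the bound is uniform in
  \<open>w\<close> and in the underlying edge set. This settles integrability for every real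
  statistic of the tree.\<close>

lemma kruskal_fun_bounded:
  fixes h :: "nat set set \<Rightarrow> real"
  obtains B where "\<And>E w. E \<subseteq> K_edges n \<Longrightarrow> \<bar>h (kruskal E w)\<bar> \<le> B"
proof
  fix E w assume "E \<subseteq> K_edges n"
  then have "kruskal E w \<in> Pow (K_edges n)" using kruskal_subset by blast
  then show "\<bar>h (kruskal E w)\<bar> \<le> Max ((\<lambda>S. \<bar>h S\<bar>) ` Pow (K_edges n))"
    using finite_K_edges[of n] by (intro Max_ge) auto
qed

lemma kruskal_fun_integrable:
  fixes h :: "nat set set \<Rightarrow> real"
  assumes E: "E \<subseteq> K_edges n"
  shows "integrable (weights n) (\<lambda>w. h (kruskal E w))"
proof -
  interpret prob_space "weights n" by (rule prob_space_weights)
  obtain B where "\<And>E w. E \<subseteq> K_edges n \<Longrightarrow> \<bar>h (kruskal E w)\<bar> \<le> B"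
    using kruskal_fun_bounded[of n h] by blast
  then show ?thesis
    by (intro integrable_const_bound[where B = B] kruskal_fun_measurable E) (use E in auto)
qed

section \<open>Counting embeddings\<close>

text \<open>The maps are extensional, so that a map on a union is determined by its two
  restrictions. Injectivity is left to \<open>embeddings\<close>: the bounds by degrees hold for all
  edge-preserving maps.\<close>

definition homs :: "nat \<Rightarrow> 'a set \<Rightarrow> 'a set set \<Rightarrow> nat set set \<Rightarrow> ('a \<Rightarrow> nat) set" where
  "homs n V E M = {\<phi> \<in> V \<rightarrow>\<^sub>E {1..n}. (`) \<phi> ` E \<subseteq> M}"

definition embeddings :: "nat \<Rightarrow> 'a set \<Rightarrow> 'a set set \<Rightarrow> nat set set \<Rightarrow> ('a \<Rightarrow> nat) set" where
  "embeddings n V E M = {\<phi> \<in> homs n V E M. inj_on \<phi> V}"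

text \<open>Finiteness is part of the notion because an infinite set has cardinality 0.\<close>

definition deg_le :: "nat \<Rightarrow> nat set set \<Rightarrow> nat \<Rightarrow> bool" where
  "deg_le n M D \<longleftrightarrow> finite M \<and> (\<forall>x\<in>{1..n}. card {e \<in> M. x \<in> e} \<le> D)"

lemma finite_homs: "finite V \<Longrightarrow> finite (homs n V E M)"
  by (rule finite_subset[of _ "V \<rightarrow>\<^sub>E {1..n}"]) (auto simp: homs_def intro: finite_PiE)

lemma embeddings_subset_homs: "embeddings n V E M \<subseteq> homs n V E M"
  by (auto simp: embeddings_def)

lemma finite_embeddings: "finite V \<Longrightarrow> finite (embeddings n V E M)"
  by (rule finite_subset[OF embeddings_subset_homs finite_homs])

lemma card_neighbours:
  assumes "deg_le n M D" "a \<in> {1..n}"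
  shows "finite {y. {a, y} \<in> M}" "card {y. {a, y} \<in> M} \<le> D"
proof -
  have inj: "inj_on (\<lambda>y. {a, y}) {y. {a, y} \<in> M}"
    by (rule inj_onI) (auto simp: doubleton_eq_iff)
  have sub: "(\<lambda>y. {a, y}) ` {y. {a, y} \<in> M} \<subseteq> {e \<in> M. a \<in> e}" by auto
  have fin: "finite {e \<in> M. a \<in> e}" using assms by (simp add: deg_le_def)
  show "finite {y. {a, y} \<in> M}" using inj sub fin by (rule inj_on_finite)
  have "card {y. {a, y} \<in> M} \<le> card {e \<in> M. a \<in> e}" using inj sub fin by (rule card_inj_on_le)
  also have "\<dots> \<le> D" using assms unfolding deg_le_def by blast
  finally show "card {y. {a, y} \<in> M} \<le> D" .
qed

text \<open>The maps are built up one vertex at a time, each new vertex being adjacent to an old one.\<close>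

lemma card_homs_rooted:
  assumes V: "finite V" "E \<subseteq> two_subsets V" and r: "r \<in> V" "\<And>v. v \<in> V \<Longrightarrow> (r, v) \<in> reach E"
    and M: "deg_le n M D"
  shows "card {\<phi> \<in> homs n V E M. \<phi> r = x} \<le> D ^ (card V - 1)"
proof -
  define C where "C S = {\<phi> \<in> S \<rightarrow>\<^sub>E {1..n}. \<phi> r = x \<and> (\<forall>e\<in>E. e \<subseteq> S \<longrightarrow> \<phi> ` e \<in> M)}" for S
  have finC: "finite (C S)" if "S \<subseteq> V" for S
    by (rule finite_subset[of _ "S \<rightarrow>\<^sub>E {1..n}"])
      (use that V finite_subset in \<open>auto simp: C_def intro!: finite_PiE\<close>)
  have grow: "\<exists>S\<subseteq>V. r \<in> S \<and> card S = Suc k \<and> card (C S) \<le> D ^ k" if "Suc k \<le> card V" for k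
    using that
  proof (induction k)
    case 0
    have "C {r} \<subseteq> {\<lambda>v\<in>{r}. x}"
    proof
      fix \<phi> assume "\<phi> \<in> C {r}"
      then have \<phi>: "\<phi> r = x" "\<phi> \<in> extensional {r}" by (simp_all add: C_def PiE_iff)
      have "\<phi> v = (\<lambda>v\<in>{r}. x) v" for v
        using \<phi> by (cases "v = r") (simp_all add: extensional_def)
      then show "\<phi> \<in> {\<lambda>v\<in>{r}. x}" by (simp add: fun_eq_iff)
    qed
    then have "card (C {r}) \<le> 1" using card_mono[of "{\<lambda>v\<in>{r}. x}" "C {r}"] by simp
    then show ?case using r(1) by (intro exI[of _ "{r}"]) auto
  next
    case (Suc k)
    then obtain S where S: "S \<subseteq> V" "r \<in> S" "card S = Suc k" "card (C S) \<le> D ^ k" by auto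
    \<comment> \<open>Otherwise \<open>S\<close> would be closed under adjacency and, as
      \<open>r\<close> reaches every vertex, exhaust \<open>V\<close>.\<close>
    have "\<exists>s v. s \<in> S \<and> v \<notin> S \<and> {s, v} \<in> E"
    proof (rule ccontr)
      assume no: "\<not> ?thesis"
      have "V \<subseteq> S"
      proof
        fix v assume "v \<in> V"
        from reach_closed[OF r(2)[OF this] S(2)] no show "v \<in> S" by blast
      qed
      then show False using S Suc.prems by auto
    qed
    then obtain s v where sv: "s \<in> S" "v \<notin> S" "{s, v} \<in> E" by blast
    have vV: "v \<in> V" using sv(3) V(2) by (auto simp: two_subsets_def)
    have fS: "finite S" using S(1) V(1) finite_subset by blast
    \<comment> \<open>An extended map is fixed by its restriction and by the image of
      \<open>v\<close>, one of at most \<open>D\<close> neighbours of the image of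
      \<open>s\<close>.\<close>
    have "C (insert v S) \<subseteq> (\<lambda>(\<psi>, y). \<psi>(v := y)) ` (SIGMA \<psi>:C S. {y. {\<psi> s, y} \<in> M})"
    proof
      fix \<phi> assume \<phi>: "\<phi> \<in> C (insert v S)"
      let ?\<psi> = "restrict \<phi> S"
      have "?\<psi> \<in> C S"
      proof -
        have "?\<psi> ` e = \<phi> ` e" if "e \<subseteq> S" for e using that by (intro image_cong) auto
        then show ?thesis using \<phi> S(2) by (auto simp: C_def PiE_iff)
      qed
      moreover have "{?\<psi> s, \<phi> v} \<in> M"
      proof -
        have "{s, v} \<subseteq> insert v S" using sv(1) by simp
        moreover have "\<forall>e\<in>E. e \<subseteq> insert v S \<longrightarrow> \<phi> ` e \<in> M" using \<phi> by (simp add: C_def)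
        ultimately have "\<phi> ` {s, v} \<in> M" using sv(3) by blast
        then show ?thesis using sv by simp
      qed
      moreover have "\<phi> = ?\<psi>(v := \<phi> v)"
      proof
        fix u
        have "\<phi> \<in> extensional (insert v S)" using \<phi> by (simp add: C_def PiE_iff)
        then show "\<phi> u = (?\<psi>(v := \<phi> v)) u" by (simp add: extensional_def)
      qed
      ultimately show "\<phi> \<in> (\<lambda>(\<psi>, y). \<psi>(v := y)) ` (SIGMA \<psi>:C S. {y. {\<psi> s, y} \<in> M})"
        by (intro image_eqI[of _ _ "(?\<psi>, \<phi> v)"]) auto
    qed
    moreover have nb: "finite {y. {\<psi> s, y} \<in> M}" "card {y. {\<psi> s, y} \<in> M} \<le> D" if "\<psi> \<in> C S" for \<psi>
    proof -
      have "\<psi> \<in> S \<rightarrow>\<^sub>E {1..n}" using that by (simp add: C_def)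
      then have "\<psi> s \<in> {1..n}" using sv(1) by (rule PiE_mem)
      from card_neighbours[OF M this]
      show "finite {y. {\<psi> s, y} \<in> M}" "card {y. {\<psi> s, y} \<in> M} \<le> D" .
    qed
    ultimately have "card (C (insert v S)) \<le> card (SIGMA \<psi>:C S. {y. {\<psi> s, y} \<in> M})"
      using finC[OF S(1)] by (intro surj_card_le) auto
    also have "\<dots> = (\<Sum>\<psi>\<in>C S. card {y. {\<psi> s, y} \<in> M})"
      using finC[OF S(1)] nb by (simp add: card_SigmaI)
    also have "\<dots> \<le> card (C S) * D"
      using sum_bounded_above[of "C S" "\<lambda>\<psi>. card {y. {\<psi> s, y} \<in> M}" D] nb by simp
    also have "\<dots> \<le> D ^ Suc k" using S(4) by simp
    finally show ?case using S sv(2) fS vV by (intro exI[of _ "insert v S"]) auto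
  qed
  have c: "card V \<ge> 1" using V r(1) by (metis card_gt_0_iff empty_iff less_eq_Suc_le One_nat_def)
  obtain S where S: "S \<subseteq> V" "card S = Suc (card V - 1)" "card (C S) \<le> D ^ (card V - 1)"
    using grow[of "card V - 1"] c by auto
  have SV: "S = V" using S(1,2) c V(1) by (intro card_subset_eq) auto
  have "{\<phi> \<in> homs n V E M. \<phi> r = x} \<subseteq> C S"
  proof
    fix \<phi> assume "\<phi> \<in> {\<phi> \<in> homs n V E M. \<phi> r = x}"
    then have "\<phi> \<in> V \<rightarrow>\<^sub>E {1..n}" "\<phi> r = x" "\<And>e. e \<in> E \<Longrightarrow> \<phi> ` e \<in> M" by (auto simp: homs_def)
    then show "\<phi> \<in> C S" unfolding C_def SV by blast
  qed
  then have "card {\<phi> \<in> homs n V E M. \<phi> r = x} \<le> card (C S)"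
    by (rule card_mono[OF finC[OF S(1)]])
  then show ?thesis using S(3) by (rule order_trans)
qed

text \<open>Some vertex \<open>v\<close> is sent to \<open>x\<close>, and it can serve as the root.
  No factor \<open>n\<close> appears, which is what makes local changes of the target cheap.\<close>

lemma card_homs_hit:
  assumes V: "finite V" "E \<subseteq> two_subsets V" and r: "\<And>u v. u \<in> V \<Longrightarrow> v \<in> V \<Longrightarrow> (u, v) \<in> reach E"
    and M: "deg_le n M D"
  shows "card {\<phi> \<in> homs n V E M. x \<in> \<phi> ` V} \<le> card V * D ^ (card V - 1)"
proof -
  have "{\<phi> \<in> homs n V E M. x \<in> \<phi> ` V} = (\<Union>v\<in>V. {\<phi> \<in> homs n V E M. \<phi> v = x})" by auto
  also have "card \<dots> \<le> (\<Sum>v\<in>V. card {\<phi> \<in> homs n V E M. \<phi> v = x})"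
    by (rule card_UN_le[OF V(1)])
  also have "\<dots> \<le> (\<Sum>v\<in>V. D ^ (card V - 1))"
    using V r M by (intro sum_mono card_homs_rooted) auto
  finally show ?thesis by simp
qed

lemma card_embeddings_connected:
  assumes V: "finite V" "E \<subseteq> two_subsets V" "V \<noteq> {}"
    and r: "\<And>u v. u \<in> V \<Longrightarrow> v \<in> V \<Longrightarrow> (u, v) \<in> reach E"
    and M: "deg_le n M D"
  shows "card (embeddings n V E M) \<le> n * D ^ (card V - 1)"
proof -
  obtain v where v: "v \<in> V" using V(3) by auto
  have "embeddings n V E M \<subseteq> (\<Union>x\<in>{1..n}. {\<phi> \<in> homs n V E M. \<phi> v = x})"
    using v by (auto simp: embeddings_def homs_def)
  then have "card (embeddings n V E M) \<le> card (\<Union>x\<in>{1..n}. {\<phi> \<in> homs n V E M. \<phi> v = x})"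
    by (rule card_mono[rotated]) (use finite_homs[OF V(1)] in auto)
  also have "\<dots> \<le> (\<Sum>x\<in>{1..n}. card {\<phi> \<in> homs n V E M. \<phi> v = x})"
    by (rule card_UN_le) simp
  also have "\<dots> \<le> (\<Sum>x\<in>{1..n}. D ^ (card V - 1))"
    using V v r M by (intro sum_mono card_homs_rooted) auto
  finally show ?thesis by simp
qed

text \<open>A map that does not use the edge \<open>f\<close> survives in \<open>M'\<close>, and one
  that does must hit a chosen end of \<open>f\<close>.\<close>

lemma card_embeddings_diff:
  assumes V: "finite V" "E \<subseteq> two_subsets V" and r: "\<And>u v. u \<in> V \<Longrightarrow> v \<in> V \<Longrightarrow> (u, v) \<in> reach E"
    and M: "deg_le n M D" and M': "M - {f} \<subseteq> M'"
  shows "card (embeddings n V E M) \<le> card (embeddings n V E M') + card V * D ^ (card V - 1)"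
proof -
  \<comment> \<open>If \<open>f\<close> is empty the choice is arbitrary, but then no edge is mapped
    to \<open>f\<close>.\<close>
  let ?x = "SOME x. x \<in> f"
  have "embeddings n V E M \<subseteq> embeddings n V E M' \<union> {\<phi> \<in> homs n V E M. ?x \<in> \<phi> ` V}"
  proof
    fix \<phi> assume \<phi>: "\<phi> \<in> embeddings n V E M"
    show "\<phi> \<in> embeddings n V E M' \<union> {\<phi> \<in> homs n V E M. ?x \<in> \<phi> ` V}"
    proof (cases "f \<in> (`) \<phi> ` E")
      case True
      then obtain e where e: "e \<in> E" "f = \<phi> ` e" by auto
      then have e': "e \<subseteq> V" "e \<noteq> {}" using V(2) by (auto simp: two_subsets_def)
      then have "\<exists>x. x \<in> f" using e(2) by blast
      then have "?x \<in> f" by (rule someI_ex)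
      then have "?x \<in> \<phi> ` V" using e(2) e'(1) by blast
      then show ?thesis using \<phi> embeddings_subset_homs by blast
    next
      case False
      then have "(`) \<phi> ` E \<subseteq> M'" using \<phi> M' unfolding embeddings_def homs_def by blast
      then show ?thesis using \<phi> by (simp add: embeddings_def homs_def)
    qed
  qed
  then have "card (embeddings n V E M)
      \<le> card (embeddings n V E M' \<union> {\<phi> \<in> homs n V E M. ?x \<in> \<phi> ` V})"
    by (rule card_mono[rotated]) (use finite_homs[OF V(1)] finite_embeddings[OF V(1)] in auto)
  also have "\<dots> \<le> card (embeddings n V E M') + card {\<phi> \<in> homs n V E M. ?x \<in> \<phi> ` V}"
    by (rule card_Un_le)
  also have "\<dots> \<le> card (embeddings n V E M') + card V * D ^ (card V - 1)"
    using card_homs_hit[OF V r M] by simp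
  finally show ?thesis .
qed

section \<open>Pairs of embeddings and disjoint unions\<close>

definition overlaps :: "nat \<Rightarrow> 'a set \<Rightarrow> 'a set set \<Rightarrow> 'a set \<Rightarrow> 'a set set \<Rightarrow> nat set set
    \<Rightarrow> (('a \<Rightarrow> nat) \<times> ('a \<Rightarrow> nat)) set" where
  "overlaps n V E V' E' M = {(\<phi>, \<psi>) \<in> embeddings n V E M \<times> embeddings n V' E' M. \<phi> ` V \<inter> \<psi> ` V' \<noteq> {}}"

text \<open>Restricting to the two parts and gluing are mutually inverse. As \<open>V\<close> and
  \<open>V'\<close> are disjoint, a glued map is injective exactly when both maps are and their
  images are disjoint; the remaining pairs are the overlaps.\<close>

lemma card_embeddings_union:
  assumes V: "finite V" "E \<subseteq> two_subsets V" and V': "finite V'" "E' \<subseteq> two_subsets V'"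
    and dis: "V \<inter> V' = {}"
  shows "card (embeddings n (V \<union> V') (E \<union> E') M) + card (overlaps n V E V' E' M)
    = card (embeddings n V E M) * card (embeddings n V' E' M)"
proof -
  let ?A = "embeddings n V E M" and ?B = "embeddings n V' E' M"
  let ?N = "{(\<phi>, \<psi>) \<in> ?A \<times> ?B. \<phi> ` V \<inter> \<psi> ` V' = {}}"
  have rV: "restrict \<phi> V ` e = \<phi> ` e" if "e \<in> E" for \<phi> :: "'a \<Rightarrow> nat" and e
    using that V(2) by (intro image_cong) (auto simp: two_subsets_def)
  have rV': "restrict \<phi> V' ` e = \<phi> ` e" if "e \<in> E'" for \<phi> :: "'a \<Rightarrow> nat" and e
    using that V'(2) by (intro image_cong) (auto simp: two_subsets_def)
  define glue where "glue = (\<lambda>(\<phi>, \<psi>) x. if x \<in> V then \<phi> x else (\<psi> x :: nat))"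
  have gV: "glue (\<phi>, \<psi>) ` e = \<phi> ` e" if "e \<subseteq> V" for \<phi> \<psi> e
    using that by (intro image_cong) (auto simp: glue_def)
  have gV': "glue (\<phi>, \<psi>) ` e = \<psi> ` e" if "e \<subseteq> V'" for \<phi> \<psi> e
    using that dis by (intro image_cong) (auto simp: glue_def)
  have EV: "e \<in> E \<Longrightarrow> e \<subseteq> V" "e \<in> E' \<Longrightarrow> e \<subseteq> V'" for e
    using V(2) V'(2) by (auto simp: two_subsets_def)
  have "bij_betw (\<lambda>\<phi>. (restrict \<phi> V, restrict \<phi> V')) (embeddings n (V \<union> V') (E \<union> E') M) ?N"
  proof (rule bij_betw_byWitness[where f' = glue])
    show "\<forall>\<phi>\<in>embeddings n (V \<union> V') (E \<union> E') M. glue (restrict \<phi> V, restrict \<phi> V') = \<phi>"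
      by (auto simp: glue_def embeddings_def homs_def PiE_iff extensional_def fun_eq_iff)
    show "\<forall>p\<in>?N. (restrict (glue p) V, restrict (glue p) V') = p"
      using dis by (auto simp: glue_def embeddings_def homs_def PiE_iff extensional_def fun_eq_iff)
    show "(\<lambda>\<phi>. (restrict \<phi> V, restrict \<phi> V')) ` embeddings n (V \<union> V') (E \<union> E') M \<subseteq> ?N"
    proof (rule image_subsetI)
      fix \<phi> assume \<phi>: "\<phi> \<in> embeddings n (V \<union> V') (E \<union> E') M"
      have inj: "inj_on \<phi> (V \<union> V')" using \<phi> by (simp add: embeddings_def)
      have "restrict \<phi> V \<in> ?A" "restrict \<phi> V' \<in> ?B"
        using \<phi> rV rV' inj_on_subset[OF inj] by (auto simp: embeddings_def homs_def PiE_iff)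
      moreover have "\<phi> ` V \<inter> \<phi> ` V' = {}"
        using inj dis inj_on_image_Int[OF inj, of V V'] by auto
      ultimately show "(restrict \<phi> V, restrict \<phi> V') \<in> ?N" by auto
    qed
    show "glue ` ?N \<subseteq> embeddings n (V \<union> V') (E \<union> E') M"
    proof (rule image_subsetI)
      fix p assume "p \<in> ?N"
      then obtain \<phi> \<psi> where p: "p = (\<phi>, \<psi>)" "\<phi> \<in> ?A" "\<psi> \<in> ?B" "\<phi> ` V \<inter> \<psi> ` V' = {}" by auto
      have "glue p \<in> V \<union> V' \<rightarrow>\<^sub>E {1..n}"
        using p by (auto simp: glue_def embeddings_def homs_def PiE_iff extensional_def)
      moreover have "glue p ` e \<in> M" if "e \<in> E \<union> E'" for e
        using that p gV gV' EV by (auto simp: embeddings_def homs_def)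
      moreover have "inj_on (glue p) (V \<union> V')"
      proof -
        have "inj_on (glue p) V \<longleftrightarrow> inj_on \<phi> V" "inj_on (glue p) V' \<longleftrightarrow> inj_on \<psi> V'"
          using dis by (auto intro!: inj_on_cong simp: p glue_def)
        then show ?thesis
          using p gV[of V \<phi> \<psi>] gV'[of V' \<phi> \<psi>] dis
          by (simp add: inj_on_Un embeddings_def) blast
      qed
      ultimately show "glue p \<in> embeddings n (V \<union> V') (E \<union> E') M"
        by (auto simp: embeddings_def homs_def)
    qed
  qed
  then have c1: "card (embeddings n (V \<union> V') (E \<union> E') M) = card ?N" by (rule bij_betw_same_card)
  have "?A \<times> ?B = ?N \<union> overlaps n V E V' E' M" "?N \<inter> overlaps n V E V' E' M = {}"
    by (auto simp: overlaps_def)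
  note un = this
  have "finite (?A \<times> ?B)" using finite_embeddings V(1) V'(1) by blast
  then have fin: "finite ?N" "finite (overlaps n V E V' E' M)"
    by (rule rev_finite_subset, auto simp: overlaps_def)+
  have "card (?A \<times> ?B) = card (?N \<union> overlaps n V E V' E' M)"
    using un(1) by (rule arg_cong)
  also have "\<dots> = card ?N + card (overlaps n V E V' E' M)"
    using fin un(2) by (rule card_Un_disjoint)
  finally have "card (?A \<times> ?B) = card ?N + card (overlaps n V E V' E' M)" .
  then show ?thesis using c1 by (simp add: card_cartesian_product)
qed

text \<open>For a fixed first map the second must hit one of at most \<open>card V\<close> vertices,
  and the maps hitting a given vertex are few because \<open>V'\<close> is connected. The first part
  may have any shape.\<close>

lemma card_overlaps:
  assumes V: "finite V" and V': "finite V'" "E' \<subseteq> two_subsets V'"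
    and r: "\<And>u v. u \<in> V' \<Longrightarrow> v \<in> V' \<Longrightarrow> (u, v) \<in> reach E'"
    and M: "deg_le n M D"
  shows "card (overlaps n V E V' E' M) \<le> card (embeddings n V E M) * (card V * (card V' * D ^ (card V' - 1)))"
proof -
  let ?A = "embeddings n V E M" and ?H = "homs n V' E' M"
  let ?S = "\<lambda>\<phi>. \<Union>v\<in>V. {\<psi> \<in> ?H. \<phi> v \<in> \<psi> ` V'}"
  have fS: "finite (?S \<phi>)" for \<phi> :: "'a \<Rightarrow> nat" using V finite_homs[OF V'(1)] by auto
  have "overlaps n V E V' E' M \<subseteq> Sigma ?A ?S"
    using embeddings_subset_homs by (fastforce simp: overlaps_def)
  then have "card (overlaps n V E V' E' M) \<le> card (Sigma ?A ?S)"
    by (rule card_mono[rotated]) (use fS finite_embeddings[OF V] in auto)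
  also have "\<dots> = (\<Sum>\<phi>\<in>?A. card (?S \<phi>))" using fS finite_embeddings[OF V] by (simp add: card_SigmaI)
  also have "\<dots> \<le> (\<Sum>\<phi>\<in>?A. card V * (card V' * D ^ (card V' - 1)))"
  proof (rule sum_mono)
    fix \<phi> :: "'a \<Rightarrow> nat"
    have "card (?S \<phi>) \<le> (\<Sum>v\<in>V. card {\<psi> \<in> ?H. \<phi> v \<in> \<psi> ` V'})" by (rule card_UN_le[OF V])
    also have "\<dots> \<le> (\<Sum>v\<in>V. card V' * D ^ (card V' - 1))"
      using V' r M by (intro sum_mono card_homs_hit) auto
    finally show "card (?S \<phi>) \<le> card V * (card V' * D ^ (card V' - 1))" by simp
  qed
  finally show ?thesis by simp
qed

section \<open>Edge counts and embedding counts of forests\<close>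

text \<open>Each edge is sent to its end on the side away from the root \<open>r\<close>. In a
  forest this assignment is injective, and it never takes the value \<open>r\<close>.\<close>

lemma card_edges_connected:
  assumes V: "finite V" "E \<subseteq> two_subsets V" and r: "r \<in> V" "\<And>v. v \<in> V \<Longrightarrow> (r, v) \<in> reach E"
    and E: "bridges_only E"
  shows "card E < card V"
proof -
  define far where "far e v \<longleftrightarrow> v \<in> e \<and> (r, v) \<notin> reach (E - {e})" for e v
  have two: "\<exists>a b. e = {a, b} \<and> a \<in> V \<and> b \<in> V \<and> a \<noteq> b" if "e \<in> E" for e
  proof -
    have "e \<subseteq> V" "card e = 2" using that V(2) by (auto simp: two_subsets_def)
    then show ?thesis by (auto simp: card_2_iff)
  qed
  have ex: "\<exists>v. far e v" if "e \<in> E" for e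
  proof (rule ccontr)
    assume no: "\<not> ?thesis"
    obtain a b where ab: "e = {a, b}" using two \<open>e \<in> E\<close> by blast
    then have "(r, a) \<in> reach (E - {e})" "(r, b) \<in> reach (E - {e})" using no by (auto simp: far_def)
    then have "(a, b) \<in> reach (E - {e})" by (meson reach_sym reach_trans)
    then show False using E that ab by (auto simp: bridges_only_def)
  qed
  have near: "\<exists>u. e = {u, v} \<and> (r, u) \<in> reach (E - {e})" if e: "e \<in> E" and f: "far e v" for e v
  proof -
    obtain u where u: "e = {u, v}" "v \<in> V" using two[OF e] f by (auto simp: far_def insert_commute)
    have "insert {u, v} (E - {e}) = E" using e u by auto
    then have "(r, v) \<in> reach (insert {u, v} (E - {e}))" using r(2)[OF u(2)] by simp
    then have "(r, u) \<in> reach (E - {e})" using f by (auto simp: far_def dest: reach_insertD)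
    then show ?thesis using u by blast
  qed
  \<comment> \<open>Suppose \<open>e\<close> and \<open>e'\<close> share the far end
    \<open>v\<close>. If the route from \<open>r\<close> to the near end \<open>u\<close> of
    \<open>e\<close> avoids \<open>e'\<close>, it continues through \<open>e\<close> to
    \<open>v\<close> without \<open>e'\<close>. Otherwise it passes through \<open>v\<close>, and
    then either \<open>v\<close> is reached without \<open>e\<close> or \<open>e\<close> is not a
    bridge.\<close>
  have uniq: "e = e'" if e: "e \<in> E" "far e v" and e': "e' \<in> E" "far e' v" for e e' v
  proof (rule ccontr)
    assume ne: "e \<noteq> e'"
    obtain u where u: "e = {u, v}" "(r, u) \<in> reach (E - {e})" using near[OF e] by blast
    obtain u' where u': "e' = {u', v}" using near[OF e'] by blast
    let ?F = "E - {e} - {e'}"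
    have "insert {u', v} ?F = E - {e}" using ne u' e'(1) by auto
    then have "(r, u) \<in> reach (insert {u', v} ?F)" using u(2) by simp
    then consider "(r, u) \<in> reach ?F" | "(v, u) \<in> reach ?F" | "(r, v) \<in> reach ?F"
      by (auto dest: reach_insertD)
    then show False
    proof cases
      case 1
      then have "(r, u) \<in> reach (E - {e'})" by (rule reach_mono) auto
      moreover have "(u, v) \<in> reach (E - {e'})" using e(1) ne u(1) by (intro reach_edge) auto
      ultimately have "(r, v) \<in> reach (E - {e'})" by (rule reach_trans)
      then show False using e'(2) by (simp add: far_def)
    next
      case 2
      then have "(v, u) \<in> reach (E - {e})" by (rule reach_mono) auto
      then have "(u, v) \<in> reach (E - {e})" by (rule reach_sym)
      then show False using E e(1) u(1) by (auto simp: bridges_only_def)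
    next
      case 3
      then have "(r, v) \<in> reach (E - {e})" by (rule reach_mono) auto
      then show False using e(2) by (simp add: far_def)
    qed
  qed
  let ?f = "\<lambda>e. SOME v. far e v"
  have f: "far e (?f e)" if "e \<in> E" for e using ex[OF that] by (rule someI_ex)
  have "inj_on ?f E"
  proof (rule inj_onI)
    fix e e' assume e: "e \<in> E" "e' \<in> E" "?f e = ?f e'"
    have "far e' (?f e)" unfolding e(3) by (rule f[OF e(2)])
    then show "e = e'" by (rule uniq[OF e(1) f[OF e(1)] e(2)])
  qed
  moreover have "?f ` E \<subseteq> V - {r}"
  proof (rule image_subsetI)
    fix e assume e: "e \<in> E"
    have "?f e \<in> V" using f[OF e] two[OF e] by (auto simp: far_def)
    moreover have "?f e \<noteq> r" using f[OF e] by (auto simp: far_def)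
    ultimately show "?f e \<in> V - {r}" by simp
  qed
  ultimately have "card E \<le> card (V - {r})" using V(1) by (intro card_inj_on_le) auto
  also have "\<dots> < card V" using V(1) r(1) by (rule card_Diff1_less)
  finally show ?thesis .
qed

lemma component_split:
  fixes E :: "'a set set"
  assumes V: "E \<subseteq> two_subsets V" and r: "r \<in> V"
  defines "C \<equiv> {v \<in> V. (r, v) \<in> reach E}"
  defines "EC \<equiv> {e \<in> E. e \<subseteq> C}"
  shows "EC \<subseteq> two_subsets C" "E - EC \<subseteq> two_subsets (V - C)"
    "u \<in> C \<Longrightarrow> v \<in> C \<Longrightarrow> (u, v) \<in> reach EC"
proof -
  have cl: "b \<in> C" if "{a, b} \<in> E" "a \<in> C" for a b
    using that V reach_trans[OF _ reach_edge[OF that(1)]] by (auto simp: C_def two_subsets_def)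
  show "EC \<subseteq> two_subsets C" using V by (auto simp: EC_def two_subsets_def)
  show "E - EC \<subseteq> two_subsets (V - C)"
  proof
    fix e assume e: "e \<in> E - EC"
    then obtain a b where ab: "e = {a, b}" "a \<in> V" "b \<in> V" "a \<noteq> b"
      using V by (auto simp: two_subsets_def card_2_iff)
    have "a \<in> C \<longleftrightarrow> b \<in> C" using cl[of a b] cl[of b a] e ab by (auto simp: insert_commute)
    then show "e \<in> two_subsets (V - C)" using e ab by (auto simp: EC_def two_subsets_def)
  qed
  have rC: "(r, v) \<in> reach EC \<and> v \<in> C" if "(r, v) \<in> reach E" for v
    using that unfolding reach_def[of E]
  proof (induction rule: rtrancl_induct)
    case base
    then show ?case using r by (simp add: C_def)
  next
    case (step y z)
    then have z: "z \<in> C" using cl by blast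
    then have "{y, z} \<in> EC" using step by (auto simp: EC_def)
    then show ?case using step.IH z by (auto intro: reach_trans reach_edge)
  qed
  show "(u, v) \<in> reach EC" if "u \<in> C" "v \<in> C"
    using rC[of u] rC[of v] that by (auto simp: C_def intro: reach_trans reach_sym)
qed

text \<open>Components are stripped off one by one; each leaves \<open>n\<close> choices for a root
  and at most \<open>D\<close> for each further vertex. The exponent \<open>card V - card E\<close>
  is the number of trees in the forest. The inequality \<open>card E \<le> card V\<close> is carried
  along so that the truncated differences add up.\<close>

lemma card_embeddings_forest:
  assumes "finite V" "E \<subseteq> two_subsets V" "bridges_only E" "deg_le n M D" "D \<ge> 1"
  shows "card E \<le> card V \<and> card (embeddings n V E M) \<le> n ^ (card V - card E) * D ^ card V"
  using assms(1-3)
proof (induction "card V" arbitrary: V E rule: less_induct)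
  case less
  show ?case
  proof (cases "V = {}")
    case True
    then have "E = {}" using less.prems by (auto simp: two_subsets_def)
    moreover have "card (embeddings n ({} :: 'a set) {} M) \<le> card {\<lambda>_ :: 'a. undefined :: nat}"
      by (rule card_mono) (auto simp: embeddings_def homs_def)
    ultimately show ?thesis using True by simp
  next
    case False
    then obtain r where r: "r \<in> V" by auto
    define C where "C = {v \<in> V. (r, v) \<in> reach E}"
    define EC where "EC = {e \<in> E. e \<subseteq> C}"
    note cs = component_split[OF less.prems(2) r, folded C_def, folded EC_def]
    have rC: "r \<in> C" using r by (simp add: C_def)
    have CV: "C \<subseteq> V" by (auto simp: C_def)
    have fC: "finite C" "finite (V - C)" using CV less.prems(1) finite_subset by auto
    have fE: "finite E" using less.prems(1,2) by (auto simp: two_subsets_def intro: finite_subset[of _ "Pow V"])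
    have cV: "card V = card C + card (V - C)"
      using CV less.prems(1) by (metis card_Diff_subset card_mono finite_subset le_add_diff_inverse)
    have cE: "card E = card EC + card (E - EC)"
      using fE by (metis (no_types, lifting) EC_def card_Diff_subset card_mono finite_subset
          le_add_diff_inverse mem_Collect_eq subsetI)
    have lt: "card (V - C) < card V" using cV rC fC by (auto simp: card_gt_0_iff)
    have IH: "card (E - EC) \<le> card (V - C)"
      "card (embeddings n (V - C) (E - EC) M) \<le> n ^ (card (V - C) - card (E - EC)) * D ^ card (V - C)"
      using less.hyps[OF lt fC(2) cs(2)] bridges_only_subset[OF less.prems(3)] by auto
    have ltC: "card EC < card C"
      by (rule card_edges_connected[OF fC(1) cs(1) rC])
        (use cs(3) rC bridges_only_subset[OF less.prems(3)] in \<open>auto simp: EC_def\<close>)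
    have "card (embeddings n C EC M) \<le> n * D ^ (card C - 1)"
      by (rule card_embeddings_connected[OF fC(1) cs(1) _ cs(3) assms(4)]) (use rC in auto)
    also have "\<dots> \<le> n ^ (card C - card EC) * D ^ card C"
    proof (rule mult_mono)
      show "n \<le> n ^ (card C - card EC)"
        using ltC by (cases "n = 0") (auto intro: self_le_power)
      show "D ^ (card C - 1) \<le> D ^ card C" using assms(5) by (intro power_increasing) auto
    qed auto
    finally have C: "card (embeddings n C EC M) \<le> n ^ (card C - card EC) * D ^ card C" .
    have "C \<union> (V - C) = V" "EC \<union> (E - EC) = E" using CV by (auto simp: EC_def)
    then have "card (embeddings n V E M) \<le> card (embeddings n C EC M) * card (embeddings n (V - C) (E - EC) M)"
      using card_embeddings_union[OF fC(1) cs(1) fC(2) cs(2), of n M] by auto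
    also have "\<dots> \<le> (n ^ (card C - card EC) * D ^ card C)
        * (n ^ (card (V - C) - card (E - EC)) * D ^ card (V - C))"
      by (rule mult_mono[OF C IH(2)]) auto
    also have "\<dots> = n ^ (card V - card E) * D ^ card V"
    proof -
      have "card V - card E = (card C - card EC) + (card (V - C) - card (E - EC))"
        using cV cE ltC IH(1) by linarith
      then show ?thesis using cV by (simp add: power_add)
    qed
    finally show ?thesis using cV cE ltC IH(1) by linarith
  qed
qed

section \<open>Moments of the maximal degree\<close>

text \<open>One more than the maximal degree: it is positive, and it still bounds the degrees after the
  exchange of one edge.\<close>

definition maxdeg :: "nat \<Rightarrow> nat set set \<Rightarrow> nat" where
  "maxdeg n M = Suc (Max ((\<lambda>x. card {e \<in> M. x \<in> e}) ` {0..n}))"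

definition moment :: "nat \<Rightarrow> nat \<Rightarrow> real" where
  "moment n q = (\<integral>w. real (maxdeg n (kruskal (K_edges n) w)) ^ q \<partial>weights n)"

lemma card_incident_less_maxdeg: "x \<le> n \<Longrightarrow> card {e \<in> M. x \<in> e} < maxdeg n M"
  by (auto simp: maxdeg_def less_Suc_eq_le intro!: Max_ge)

lemma maxdeg_le_iff: "maxdeg n M \<le> D \<longleftrightarrow> (\<forall>x\<le>n. card {e \<in> M. x \<in> e} < D)"
  by (auto simp: maxdeg_def Suc_le_eq)

lemma card_star: "card {e \<in> K_edges n. x \<in> e} \<le> n"
proof -
  have "{e \<in> K_edges n. x \<in> e} \<subseteq> (\<lambda>y. {x, y}) ` {1..n}"
    by (auto simp: K_edges_def two_subsets_def card_2_iff)
  from card_mono[OF _ this] card_image_le[of "{1..n}" "\<lambda>y. {x, y}"] show ?thesis by simp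
qed

lemma maxdeg_le: "M \<subseteq> K_edges n \<Longrightarrow> maxdeg n M \<le> Suc n"
  unfolding maxdeg_le_iff less_Suc_eq_le
proof (intro allI impI)
  fix x assume "M \<subseteq> K_edges n"
  then have "card {e \<in> M. x \<in> e} \<le> card {e \<in> K_edges n. x \<in> e}"
    using finite_K_edges[of n] by (intro card_mono) auto
  then show "card {e \<in> M. x \<in> e} \<le> n" using card_star[of n x] by linarith
qed

section \<open>Tree edges are light: cuts and the degree estimate\<close>

definition cut :: "nat \<Rightarrow> nat set \<Rightarrow> nat set set" where
  "cut n S = (\<lambda>(a, b). {a, b}) ` (S \<times> ({1..n} - S))"

lemma cut_subset: "S \<subseteq> {1..n} \<Longrightarrow> cut n S \<subseteq> K_edges n"
  by (auto simp: cut_def K_edges_def two_subsets_def card_2_iff)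

lemma card_cut: "S \<subseteq> {1..n} \<Longrightarrow> card (cut n S) = card S * (n - card S)"
proof -
  assume S: "S \<subseteq> {1..n}"
  have "inj_on (\<lambda>(a, b). {a, b}) (S \<times> ({1..n} - S))"
    by (rule inj_onI) (auto simp: doubleton_eq_iff)
  then have "card (cut n S) = card (S \<times> ({1..n} - S))" unfolding cut_def by (rule card_image)
  also have "\<dots> = card S * (n - card S)"
    using S finite_subset[OF S] by (simp add: card_cartesian_product card_Diff_subset)
  finally show ?thesis .
qed

text \<open>Every component of \<open>F\<close> has more than half of the vertices, since otherwise
  its cut would contain an edge of \<open>F\<close>; two distinct ones do not fit. Asking only for
  sets of at most half the vertices ensures later that each cut has at least
  \<open>card S * (n div 2)\<close> edges.\<close>

lemma reach_all_of_cuts: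
  assumes F: "F \<subseteq> K_edges n"
    and c: "\<And>S. S \<subseteq> {1..n} \<Longrightarrow> S \<noteq> {} \<Longrightarrow> 2 * card S \<le> n \<Longrightarrow> cut n S \<inter> F \<noteq> {}"
    and ab: "a \<in> {1..n}" "b \<in> {1..n}"
  shows "(a, b) \<in> reach F"
proof (rule ccontr)
  assume no: "(a, b) \<notin> reach F"
  define C where "C x = {y \<in> {1..n}. (x, y) \<in> reach F}" for x
  have big: "2 * card (C x) > n" if x: "x \<in> {1..n}" for x
  proof (rule ccontr)
    assume "\<not> ?thesis"
    then have "cut n (C x) \<inter> F \<noteq> {}" using x by (intro c) (auto simp: C_def)
    then obtain g where "g \<in> cut n (C x)" "g \<in> F" by blast
    moreover from this obtain p where "p \<in> C x \<times> ({1..n} - C x)" "g = (\<lambda>(a, b). {a, b}) p"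
      unfolding cut_def by blast
    ultimately obtain u v where uv: "{u, v} \<in> F" "u \<in> C x" "v \<in> {1..n} - C x"
      by (cases p) simp
    have "(x, v) \<in> reach F" using uv(2) reach_edge[OF uv(1)] by (auto simp: C_def intro: reach_trans)
    then show False using uv(3) unfolding C_def by blast
  qed
  have dis: "C a \<inter> C b = {}"
  proof (rule ccontr)
    assume "C a \<inter> C b \<noteq> {}"
    then obtain y where "(a, y) \<in> reach F" "(b, y) \<in> reach F" by (auto simp: C_def)
    then show False using no reach_sym reach_trans by metis
  qed
  have "card (C a) + card (C b) = card (C a \<union> C b)"
    by (rule card_Un_disjoint[symmetric, OF _ _ dis]) (auto simp: C_def)
  also have "\<dots> \<le> card {1..n}" by (rule card_mono) (auto simp: C_def)
  finally show False using big[OF ab(1)] big[OF ab(2)] by simp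
qed

text \<open>The edges below \<open>p\<close> already connect all vertices, so an edge of weight at
  least \<open>p\<close> closes a cycle with strictly lighter ones.\<close>

lemma kruskal_light:
  assumes c: "\<And>S. S \<subseteq> {1..n} \<Longrightarrow> S \<noteq> {} \<Longrightarrow> 2 * card S \<le> n \<Longrightarrow> \<exists>g\<in>cut n S. w g < p"
    and e: "e \<in> kruskal (K_edges n) w"
  shows "w e < p"
proof (rule ccontr)
  assume ge: "\<not> w e < p"
  let ?F = "{g \<in> K_edges n. w g < p}"
  have eK: "e \<in> K_edges n" using e kruskal_subset by blast
  then obtain a b where ab: "e = {a, b}" "a \<in> {1..n}" "b \<in> {1..n}"
    by (auto simp: K_edges_def two_subsets_def card_2_iff)
  have "(a, b) \<in> reach ?F"
  proof (rule reach_all_of_cuts[OF _ _ ab(2,3)])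
    fix S assume S: "S \<subseteq> {1..n}" "S \<noteq> {}" "2 * card S \<le> n"
    show "cut n S \<inter> ?F \<noteq> {}" using c[OF S] cut_subset[OF S(1)] by auto
  qed auto
  then have "(a, b) \<in> reach {g \<in> K_edges n. w g < w e}"
    by (rule reach_mono) (use ge in auto)
  then show False using e ab(1) by (auto simp: kruskal_def)
qed

lemma sum_Pow_power: "finite A \<Longrightarrow> (\<Sum>S\<in>Pow A. (r :: real) ^ card S) = (1 + r) ^ card A"
  using prod_add[of A "\<lambda>_. r" "\<lambda>_. 1 :: real"] by (simp add: add.commute)

lemma weights_UN_box:
  assumes J: "finite \<J>" "\<And>J. J \<in> \<J> \<Longrightarrow> J \<subseteq> K_edges n" and B: "B \<in> sets borel"
    and c: "(\<Sum>J\<in>\<J>. measure unif B ^ card J) \<le> c"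
  shows "(\<Union>J\<in>\<J>. {w \<in> space (weights n). \<forall>e\<in>J. w e \<in> B}) \<in> sets (weights n)"
    "measure (weights n) (\<Union>J\<in>\<J>. {w \<in> space (weights n). \<forall>e\<in>J. w e \<in> B}) \<le> c"
proof -
  interpret prob_space "weights n" by (rule prob_space_weights)
  have m: "{w \<in> space (weights n). \<forall>e\<in>J. w e \<in> B} \<in> sets (weights n)" if "J \<in> \<J>" for J
    by (rule weights_box(2)[OF J(2)[OF that] B])
  show "(\<Union>J\<in>\<J>. {w \<in> space (weights n). \<forall>e\<in>J. w e \<in> B}) \<in> sets (weights n)"
    using J(1) m by (intro sets.finite_UN) auto
  have "measure (weights n) (\<Union>J\<in>\<J>. {w \<in> space (weights n). \<forall>e\<in>J. w e \<in> B})
      \<le> (\<Sum>J\<in>\<J>. measure (weights n) {w \<in> space (weights n). \<forall>e\<in>J. w e \<in> B})"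
    using J(1) m by (intro finite_measure_subadditive_finite) auto
  also have "\<dots> = (\<Sum>J\<in>\<J>. measure unif B ^ card J)"
    by (rule sum.cong[OF refl]) (simp add: weights_box(1)[OF J(2) B])
  finally show "measure (weights n) (\<Union>J\<in>\<J>. {w \<in> space (weights n). \<forall>e\<in>J. w e \<in> B}) \<le> c"
    using c by linarith
qed

text \<open>Outside two bad events all tree edges are lighter than \<open>p\<close> and no vertex
  meets \<open>D\<close> light edges, so the degrees stay below \<open>D\<close>; on the bad events
  the trivial degree bound is used. The first error term sums, by the binomial theorem, the
  probabilities that the cut of a small set has no light edge; the second is a union bound over
  \<open>D\<close> light edges at one of \<open>n\<close> vertices.\<close>

lemma moment_le:
  assumes p: "0 \<le> p" "p \<le> 1" and D: "D > 0"
  shows "moment n q \<le> real D ^ q + real (Suc n) ^ q *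
    (((1 + (1 - p) ^ (n div 2)) ^ n - 1) + real n * ((real n * p) ^ D / fact D))"
proof -
  interpret prob_space "weights n" by (rule prob_space_weights)
  let ?r = "(1 - p) ^ (n div 2)"
  let ?star = "\<lambda>x. {e \<in> K_edges n. x \<in> e}"
  define \<S> where "\<S> = {S \<in> Pow {1..n}. S \<noteq> {} \<and> 2 * card S \<le> n}"
  define B1 where "B1 = (\<Union>J\<in>cut n ` \<S>. {w \<in> space (weights n). \<forall>e\<in>J. w e \<in> {p..}})"
  define B2 where "B2 x = (\<Union>J\<in>{J. J \<subseteq> ?star x \<and> card J = D}.
    {w \<in> space (weights n). \<forall>e\<in>J. w e \<in> {..<p}})" for x
  have fS: "finite \<S>" by (simp add: \<S>_def)
  have "(\<Sum>J\<in>cut n ` \<S>. measure unif {p..} ^ card J) \<le> (\<Sum>S\<in>\<S>. measure unif {p..} ^ card (cut n S))"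
    using sum_image_le[OF fS, of "\<lambda>J. measure unif {p..} ^ card J" "cut n"] by (simp add: o_def)
  also have "\<dots> \<le> (\<Sum>S\<in>\<S>. ?r ^ card S)"
  proof (rule sum_mono)
    fix S assume S: "S \<in> \<S>"
    then have "card (cut n S) = card S * (n - card S)" by (intro card_cut) (auto simp: \<S>_def)
    moreover have "n div 2 \<le> n - card S" using S by (auto simp: \<S>_def)
    ultimately have "card (cut n S) \<ge> (n div 2) * card S" by (simp add: mult.commute)
    then have "(1 - p) ^ card (cut n S) \<le> (1 - p) ^ ((n div 2) * card S)"
      using p by (intro power_decreasing) auto
    then show "measure unif {p..} ^ card (cut n S) \<le> ?r ^ card S"
      using unif_less(2)[OF p] by (simp add: power_mult)
  qed
  also have "\<dots> \<le> (\<Sum>S\<in>Pow {1..n} - {{}}. ?r ^ card S)"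
    using p by (intro sum_mono2) (auto simp: \<S>_def)
  also have "\<dots> = (1 + ?r) ^ n - 1"
    using sum_Pow_power[of "{1..n}" ?r] by (simp add: sum_diff1)
  finally have s1: "(\<Sum>J\<in>cut n ` \<S>. measure unif {p..} ^ card J) \<le> (1 + ?r) ^ n - 1" .
  have b1: "B1 \<in> sets (weights n)" "prob B1 \<le> (1 + ?r) ^ n - 1"
    unfolding B1_def
    by (rule weights_UN_box[OF _ _ _ s1]; use fS cut_subset in \<open>auto simp: \<S>_def\<close>)+
  have b2: "B2 x \<in> sets (weights n)" "prob (B2 x) \<le> (real n * p) ^ D / fact D" for x
  proof -
    have fst: "finite (?star x)" using finite_K_edges[of n] by auto
    have "(\<Sum>J\<in>{J. J \<subseteq> ?star x \<and> card J = D}. measure unif {..<p} ^ card J)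
        = real (card (?star x) choose D) * p ^ D"
      using unif_less(1)[OF p] by (simp add: n_subsets[OF fst])
    also have "\<dots> \<le> real n ^ D / fact D * p ^ D"
    proof (rule mult_right_mono)
      have "(card (?star x) choose D) * fact D \<le> card (?star x) ^ D" by (rule binomial_fact_pow)
      also have "\<dots> \<le> n ^ D" by (rule power_mono[OF card_star]) simp
      finally have "real ((card (?star x) choose D) * fact D) \<le> real (n ^ D)" by (rule of_nat_mono)
      then show "real (card (?star x) choose D) \<le> real n ^ D / fact D" by (simp add: field_simps)
    qed (use p in auto)
    finally have s2: "(\<Sum>J\<in>{J. J \<subseteq> ?star x \<and> card J = D}. measure unif {..<p} ^ card J)
        \<le> (real n * p) ^ D / fact D" by (simp add: power_mult_distrib)
    have fJ: "finite {J. J \<subseteq> ?star x \<and> card J = D}"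
      by (rule finite_subset[of _ "Pow (?star x)"]) (use fst in auto)
    show "B2 x \<in> sets (weights n)" "prob (B2 x) \<le> (real n * p) ^ D / fact D"
      unfolding B2_def by (rule weights_UN_box[OF fJ _ _ s2]; auto)+
  qed
  define B where "B = B1 \<union> (\<Union>x\<in>{1..n}. B2 x)"
  have Bm: "B \<in> sets (weights n)" unfolding B_def using b1(1) b2(1) by blast
  have "prob B \<le> prob B1 + prob (\<Union>x\<in>{1..n}. B2 x)"
    unfolding B_def by (rule measure_Un_le) (use b1(1) b2(1) in auto)
  also have "prob (\<Union>x\<in>{1..n}. B2 x) \<le> (\<Sum>x\<in>{1..n}. prob (B2 x))"
    by (rule finite_measure_subadditive_finite) (use b2(1) in auto)
  also have "\<dots> \<le> (\<Sum>x\<in>{1..n}. (real n * p) ^ D / fact D)"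
    by (rule sum_mono) (rule b2(2))
  also have "\<dots> = real n * ((real n * p) ^ D / fact D)" by simp
  finally have pB: "prob B \<le> ((1 + ?r) ^ n - 1) + real n * ((real n * p) ^ D / fact D)"
    using b1(2) by linarith
  have pt: "real (maxdeg n (kruskal (K_edges n) w)) ^ q \<le> real D ^ q + real (Suc n) ^ q * indicator B w"
    if w: "w \<in> space (weights n)" for w
  proof (cases "w \<in> B")
    case True
    have "real (maxdeg n (kruskal (K_edges n) w)) ^ q \<le> real (Suc n) ^ q"
      using maxdeg_le[OF kruskal_subset] by (intro power_mono of_nat_mono) auto
    also have "\<dots> \<le> real D ^ q + real (Suc n) ^ q * indicator B w" using True by simp
    finally show ?thesis .
  next
    case False
    have c: "\<exists>g\<in>cut n S. w g < p" if "S \<subseteq> {1..n}" "S \<noteq> {}" "2 * card S \<le> n" for S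
    proof (rule ccontr)
      assume "\<not> ?thesis"
      then have "w \<in> B1" using that w unfolding B1_def by (auto simp: \<S>_def not_less)
      then show False using False by (simp add: B_def)
    qed
    have "maxdeg n (kruskal (K_edges n) w) \<le> D"
      unfolding maxdeg_le_iff
    proof (intro allI impI)
      fix x assume "x \<le> n"
      show "card {e \<in> kruskal (K_edges n) w. x \<in> e} < D"
      proof (rule ccontr)
        assume "\<not> ?thesis"
        then obtain J where J: "J \<subseteq> {e \<in> kruskal (K_edges n) w. x \<in> e}" "card J = D"
          by (meson not_less obtain_subset_with_card_n)
        have sub: "J \<subseteq> ?star x" using J(1) kruskal_subset by blast
        have lt: "\<forall>e\<in>J. w e \<in> {..<p}" using J(1) kruskal_light[OF c] by auto
        have "w \<in> B2 x" unfolding B2_def using w sub lt J(2) by blast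
        then have "x \<notin> {1..n}" using False by (auto simp: B_def)
        \<comment> \<open>\<open>maxdeg\<close> also ranges over the label 0, which is no vertex;
          there \<open>J\<close> is empty, contradicting \<open>D > 0\<close>.\<close>
        then have "x = 0" using \<open>x \<le> n\<close> by auto
        then have e: "?star x = {}" by (auto simp: K_edges_def two_subsets_def)
        have "J = {}" using sub unfolding e by simp
        then show False using J(2) D by simp
      qed
    qed
    then have "real (maxdeg n (kruskal (K_edges n) w)) ^ q \<le> real D ^ q"
      by (intro power_mono of_nat_mono) auto
    then show ?thesis using False by simp
  qed
  have "moment n q \<le> (\<integral>w. real D ^ q + real (Suc n) ^ q * indicator B w \<partial>weights n)"
    unfolding moment_def
    using pt Bm kruskal_fun_integrable[OF order_refl, of n "\<lambda>M. real (maxdeg n M) ^ q"]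
    by (intro integral_mono) (auto simp: emeasure_eq_measure)
  also have "\<dots> = real D ^ q + real (Suc n) ^ q * prob B"
    using Bm by (simp add: prob_space emeasure_eq_measure)
  also have "\<dots> \<le> real D ^ q + real (Suc n) ^ q *
      (((1 + ?r) ^ n - 1) + real n * ((real n * p) ^ D / fact D))"
    using pB by (intro add_left_mono mult_left_mono) auto
  finally show ?thesis .
qed

text \<open>Threshold weight (ln n)^2 / n and degree bound (ln n)^3 make the exceptional event
  superpolynomially unlikely, while powers of the degree bound stay below sqrt n.\<close>

lemma moment_asymp: "(\<lambda>n. moment n q / sqrt (real n)) \<longlonglongrightarrow> 0"
proof -
  define U where "U x = ((ln x ^ 3 + 1) ^ q + (x + 1) ^ q *
    (2 * (x * exp (- (ln x ^ 2) / 4)) + x * exp (- (ln x ^ 3)))) / sqrt x" for x :: real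
  have upper: "\<forall>\<^sub>F n in sequentially. moment n q / sqrt (real n) \<le> U (real n)"
  proof -
    have e1: "\<forall>\<^sub>F n in sequentially. ln (real n) ^ 2 / real n \<le> 1"
      by real_asymp
    \<comment> \<open>This makes \<open>(ln n)^2 / D\<close> at most \<open>exp (- 2)\<close>, which
      beats the factor \<open>exp D\<close> coming from the factorial.\<close>
    have e2: "\<forall>\<^sub>F n in sequentially. exp 2 \<le> ln (real n)"
      by real_asymp
    have e3: "\<forall>\<^sub>F n in sequentially. n \<ge> (2 :: nat)"
      by (rule eventually_ge_at_top)
    \<comment> \<open>Keeps the argument \<open>y\<close> of the exponential between 0 and 1, where
      \<open>exp y \<le> 1 + 2 * y\<close>.\<close>
    have e4: "\<forall>\<^sub>F n in sequentially. real n * exp (- (ln (real n) ^ 2) / 4) \<le> 1"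
      by real_asymp
    show ?thesis
      using e1 e2 e3 e4
    proof eventually_elim
      case (elim n)
      let ?l = "ln (real n)"
      define p where "p = ?l ^ 2 / real n"
      define D where "D = nat \<lceil>?l ^ 3\<rceil>"
      have p: "0 \<le> p" "p \<le> 1" using elim by (auto simp: p_def)
      have l1: "?l \<ge> 1" using elim(2) exp_ge_add_one_self[of "2 :: real"] by linarith
      have D: "?l ^ 3 \<le> real D" "real D \<le> ?l ^ 3 + 1"
        using l1 unfolding D_def by (linarith | simp)+
      have Dpos: "real D > 0" using D(1) l1 by (smt (verit) one_le_power)
      have np: "real n * p = ?l ^ 2" using elim by (simp add: p_def)
      have r: "(1 - p) ^ (n div 2) \<le> exp (- (?l ^ 2) / 4)"
      proof -
        have "(1 - p) ^ (n div 2) \<le> exp (- p) ^ (n div 2)"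
          using p exp_ge_add_one_self[of "- p"] by (intro power_mono) auto
        also have "\<dots> = exp (- (real (n div 2) * p))" by (simp flip: exp_of_nat_mult)
        also have "\<dots> \<le> exp (- (?l ^ 2) / 4)"
        proof -
          have "real n / 4 \<le> real (n div 2)" using elim(3) by linarith
          then have "real n / 4 * p \<le> real (n div 2) * p" using p by (intro mult_right_mono) auto
          then show ?thesis using np by (simp add: field_simps)
        qed
        finally show ?thesis .
      qed
      have "(1 + (1 - p) ^ (n div 2)) ^ n \<le> exp (exp (- (?l ^ 2) / 4)) ^ n"
      proof (rule power_mono)
        show "1 + (1 - p) ^ (n div 2) \<le> exp (exp (- (?l ^ 2) / 4))"
          using r exp_ge_add_one_self[of "exp (- (?l ^ 2) / 4)"] by linarith
      qed (use p in simp)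
      also have "\<dots> = exp (real n * exp (- (?l ^ 2) / 4))"
        by (simp flip: exp_of_nat_mult)
      also have "\<dots> \<le> 1 + 2 * (real n * exp (- (?l ^ 2) / 4))"
      proof -
        let ?y = "real n * exp (- (?l ^ 2) / 4)"
        have y: "0 \<le> ?y" "?y \<le> 1" using elim(4) by auto
        have "?y ^ 2 \<le> ?y" using y by (simp add: power2_eq_square mult_left_le)
        then show ?thesis using exp_bound[OF y] by linarith
      qed
      finally have t1: "(1 + (1 - p) ^ (n div 2)) ^ n - 1 \<le> 2 * (real n * exp (- (?l ^ 2) / 4))"
        by linarith
      have t2: "(real n * p) ^ D / fact D \<le> exp (- (?l ^ 3))"
      proof -
        \<comment> \<open>A weak form of Stirling's bound: a single term of the exponential series
          is at most the sum.\<close>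
        have f: "real D ^ D / fact D \<le> exp (real D)"
        proof -
          have "(\<lambda>k. real D ^ k /\<^sub>R fact k) sums exp (real D)" by (rule exp_converges)
          then have "(\<Sum>k\<in>{D}. real D ^ k /\<^sub>R fact k) \<le> exp (real D)"
            unfolding sums_iff using sum_le_suminf[of "\<lambda>k. real D ^ k /\<^sub>R fact k" "{D}"] by auto
          then show ?thesis by (simp add: divide_inverse mult.commute)
        qed
        have "(real n * p) ^ D / fact D = (?l ^ 2 / real D) ^ D * (real D ^ D / fact D)"
          using Dpos by (simp add: np power_divide)
        also have "\<dots> \<le> exp (- 2) ^ D * exp (real D)"
        proof (intro mult_mono power_mono f)
          have "?l ^ 2 * exp 2 \<le> ?l ^ 2 * ?l" using elim(2) by (intro mult_left_mono) auto
          also have "\<dots> = ?l ^ 3" by (simp add: eval_nat_numeral)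
          finally have "?l ^ 2 * exp 2 \<le> real D" using D(1) by linarith
          then show "?l ^ 2 / real D \<le> exp (- 2)"
            using Dpos by (simp add: exp_minus field_simps)
        qed auto
        also have "\<dots> = exp (- real D)"
          by (simp flip: exp_of_nat_mult exp_add)
        also have "\<dots> \<le> exp (- (?l ^ 3))" using D(1) by simp
        finally show ?thesis .
      qed
      have "moment n q \<le> real D ^ q + real (Suc n) ^ q *
          (((1 + (1 - p) ^ (n div 2)) ^ n - 1) + real n * ((real n * p) ^ D / fact D))"
        using Dpos by (intro moment_le[OF p]) simp
      also have "\<dots> \<le> (?l ^ 3 + 1) ^ q + (real n + 1) ^ q *
          (2 * (real n * exp (- (?l ^ 2) / 4)) + real n * exp (- (?l ^ 3)))"
        using D t1 t2 p by (intro add_mono mult_mono power_mono mult_left_mono) (auto intro!: add_nonneg_nonneg)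
      finally have "moment n q \<le> (?l ^ 3 + 1) ^ q + (real n + 1) ^ q *
          (2 * (real n * exp (- (?l ^ 2) / 4)) + real n * exp (- (?l ^ 3)))" .
      then show ?case unfolding U_def by (intro divide_right_mono) auto
    qed
  qed
  have lim: "(\<lambda>n. U (real n)) \<longlonglongrightarrow> 0"
  proof -
    have "(\<lambda>n. (ln (real n) ^ 3 + 1) ^ q / sqrt (real n)) \<longlonglongrightarrow> 0"
      by real_asymp
    moreover have "(\<lambda>n. (real n + 1) ^ q * (2 * (real n * exp (- (ln (real n) ^ 2) / 4))) / sqrt (real n)) \<longlonglongrightarrow> 0"
      by real_asymp
    moreover have "(\<lambda>n. (real n + 1) ^ q * (real n * exp (- (ln (real n) ^ 3))) / sqrt (real n)) \<longlonglongrightarrow> 0"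
      by real_asymp
    ultimately show ?thesis unfolding U_def
      by (simp only: add_divide_distrib distrib_left tendsto_add_zero)
  qed
  have "\<forall>\<^sub>F n in sequentially. 0 \<le> moment n q / sqrt (real n)"
    unfolding moment_def by (intro always_eventually allI divide_nonneg_nonneg integral_nonneg) auto
  from tendsto_sandwich[OF this upper tendsto_const lim] show ?thesis .
qed

section \<open>Mean and variance of the embedding counts\<close>

text \<open>Once the edge is deleted its weight is never looked at. This is the independence of one
  coordinate that \<open>efron_stein\<close> asks of the comparison function.\<close>

lemma kruskal_delete_update: "kruskal (E - {e}) (w(e := y)) = kruskal (E - {e}) w"
proof -
  have "{g \<in> E - {e}. (w(e := y)) g < (w(e := y)) f} = {g \<in> E - {e}. w g < w f}" if "f \<in> E - {e}" for f
    using that by auto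
  then have "f \<in> kruskal (E - {e}) (w(e := y)) \<longleftrightarrow> f \<in> kruskal (E - {e}) w" if "f \<in> E - {e}" for f
    using that by (simp only: kruskal_def mem_Collect_eq)
  then show ?thesis using kruskal_subset by blast
qed

lemma finite_kruskal: "finite (kruskal (K_edges n) w)"
  using kruskal_subset finite_K_edges by (rule finite_subset)

lemma deg_le_maxdeg: "finite M \<Longrightarrow> deg_le n M (maxdeg n M)"
  unfolding deg_le_def using card_incident_less_maxdeg by (auto intro!: less_imp_le)

lemma maxdeg_pos: "maxdeg n M \<ge> 1"
  by (simp add: maxdeg_def)

text \<open>Each edge is counted at a vertex it contains. The degree factor is the origin of the
  \<open>+ 1\<close> in the moment of order \<open>2 * card V + 1\<close>.\<close>

lemma card_kruskal_le: "card (kruskal (K_edges n) w) \<le> n * maxdeg n (kruskal (K_edges n) w)"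
proof -
  let ?M = "kruskal (K_edges n) w"
  have "?M \<subseteq> (\<Union>x\<in>{1..n}. {e \<in> ?M. x \<in> e})"
  proof
    fix e assume e: "e \<in> ?M"
    then have "e \<in> K_edges n" using kruskal_subset by blast
    then obtain a b where "e = {a, b}" "a \<in> {1..n}"
      by (auto simp: K_edges_def two_subsets_def card_2_iff)
    then show "e \<in> (\<Union>x\<in>{1..n}. {e \<in> ?M. x \<in> e})" using e by blast
  qed
  then have "card ?M \<le> card (\<Union>x\<in>{1..n}. {e \<in> ?M. x \<in> e})"
    by (rule card_mono[rotated]) (use finite_kruskal in auto)
  also have "\<dots> \<le> (\<Sum>x\<in>{1..n}. card {e \<in> ?M. x \<in> e})" by (rule card_UN_le) simp
  also have "\<dots> \<le> (\<Sum>x\<in>{1..n}. maxdeg n ?M)"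
    using card_incident_less_maxdeg by (intro sum_mono) (auto intro!: less_imp_le)
  finally show ?thesis by simp
qed

text \<open>If \<open>e\<close> is in the tree, deletion removes it and brings in at most one other
  edge, so each of the two edge sets contains the other up to one edge. The comparison of embedding
  counts then applies in both directions.\<close>

lemma embeddings_kruskal_delete:
  assumes V: "finite V" "E \<subseteq> two_subsets V" and r: "\<And>u v. u \<in> V \<Longrightarrow> v \<in> V \<Longrightarrow> (u, v) \<in> reach E"
    and inj: "inj_on w (K_edges n)" and e: "e \<in> K_edges n"
  defines "M \<equiv> kruskal (K_edges n) w" and "M' \<equiv> kruskal (K_edges n - {e}) w"
  shows "\<bar>real (card (embeddings n V E M)) - real (card (embeddings n V E M'))\<bar>
    \<le> of_bool (e \<in> M) * (real (card V) * real (maxdeg n M) ^ card V)"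
proof (cases "e \<in> M")
  case False
  then have "M' = M" unfolding M_def M'_def by (rule kruskal_delete_nonmember[OF finite_K_edges e])
  then show ?thesis by simp
next
  case True
  let ?D = "maxdeg n M"
  have card_e: "card e = 2" using e by (simp add: K_edges_def two_subsets_def)
  have sub: "M - {e} \<subseteq> M'" unfolding M_def M'_def by (rule kruskal_delete_supset)
  \<comment> \<open>\<open>f\<close> is the replacement edge; if none arises, any \<open>f\<close>
    will do.\<close>
  have "\<exists>f. M' - {f} \<subseteq> M"
  proof (cases "M' - M = {}")
    case False
    then obtain f where f: "f \<in> M' - M" by blast
    have "g = f" if "g \<in> M' - M" for g
      using kruskal_delete_le_one[OF inj e card_e] f that unfolding M_def M'_def by blast
    then show ?thesis by blast
  qed blast
  then obtain f where f: "M' - {f} \<subseteq> M" by blast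
  have fin: "finite M" "finite M'"
    unfolding M_def M'_def
    by (rule finite_kruskal, rule finite_subset[OF kruskal_subset]) (simp add: finite_K_edges)
  have dM: "deg_le n M ?D" by (rule deg_le_maxdeg[OF fin(1)])
  have dM': "deg_le n M' ?D"
    unfolding deg_le_def
  proof (intro conjI ballI fin(2))
    fix x assume x: "x \<in> {1..n}"
    have "{e \<in> M'. x \<in> e} \<subseteq> insert f {e \<in> M. x \<in> e}" using f by blast
    then have "card {e \<in> M'. x \<in> e} \<le> card (insert f {e \<in> M. x \<in> e})"
      by (rule card_mono[rotated]) (use fin in simp)
    also have "\<dots> \<le> Suc (card {e \<in> M. x \<in> e})" by (rule card_insert_le_m1) auto
    also have "\<dots> \<le> ?D" using card_incident_less_maxdeg[of x n M] x by auto
    finally show "card {e \<in> M'. x \<in> e} \<le> ?D" .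
  qed
  have "card V * ?D ^ (card V - 1) \<le> card V * ?D ^ card V"
    using maxdeg_pos by (intro mult_left_mono power_increasing) auto
  moreover have "card (embeddings n V E M) \<le> card (embeddings n V E M') + card V * ?D ^ (card V - 1)"
    by (rule card_embeddings_diff[OF V r dM sub])
  moreover have "card (embeddings n V E M') \<le> card (embeddings n V E M) + card V * ?D ^ (card V - 1)"
    by (rule card_embeddings_diff[OF V r dM' f])
  ultimately have "card (embeddings n V E M) \<le> card (embeddings n V E M') + card V * ?D ^ card V"
    "card (embeddings n V E M') \<le> card (embeddings n V E M) + card V * ?D ^ card V" by linarith+
  then have "real (card (embeddings n V E M)) \<le> real (card (embeddings n V E M') + card V * ?D ^ card V)"
    "real (card (embeddings n V E M')) \<le> real (card (embeddings n V E M) + card V * ?D ^ card V)"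
    by (simp_all only: of_nat_le_iff)
  then show ?thesis using True by simp
qed

text \<open>Deleting an edge outside the tree changes nothing, so in the Efron-Stein bound only the
  edges of the tree contribute; there are O(n) of them instead of O(n^2).\<close>

lemma variance_embeddings:
  fixes n :: nat
  assumes V: "finite V" "E \<subseteq> two_subsets V" and r: "\<And>u v. u \<in> V \<Longrightarrow> v \<in> V \<Longrightarrow> (u, v) \<in> reach E"
  defines "X \<equiv> \<lambda>w :: nat set \<Rightarrow> real. real (card (embeddings n V E (kruskal (K_edges n) w)))"
  shows "(\<integral>w. (X w)\<^sup>2 \<partial>weights n) - (\<integral>w. X w \<partial>weights n)\<^sup>2
    \<le> real n * (real (card V))\<^sup>2 * moment n (2 * card V + 1)"
proof -
  let ?v = "card V" and ?K = "K_edges n"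
  let ?h = "\<lambda>M. real (card (embeddings n V E M))" and ?M = "\<lambda>w. kruskal (K_edges n) w"
  let ?D = "\<lambda>w. real (maxdeg n (kruskal (K_edges n) w))"
  let ?c = "\<lambda>w. (real ?v)\<^sup>2 * ?D w ^ (2 * ?v)"
  let ?g = "\<lambda>e w. ?h (kruskal (?K - {e}) w)"
  obtain B where B: "\<And>F w. F \<subseteq> ?K \<Longrightarrow> \<bar>?h (kruskal F w)\<bar> \<le> B"
    using kruskal_fun_bounded[of n ?h] by blast
  have "(\<integral>w. (X w)\<^sup>2 \<partial>weights n) - (\<integral>w. X w \<partial>weights n)\<^sup>2
      \<le> (\<Sum>e\<in>?K. \<integral>w. (X w - ?g e w)\<^sup>2 \<partial>weights n)"
    unfolding weights_def
  proof (rule efron_stein[where B = B])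
    show "prob_space unif" by (rule prob_space_unif)
    show "X \<in> borel_measurable (PiM ?K (\<lambda>_. unif))"
      unfolding X_def weights_def[symmetric] by (rule kruskal_fun_measurable) simp
    show "?g e \<in> borel_measurable (PiM ?K (\<lambda>_. unif))" for e
      unfolding weights_def[symmetric] by (rule kruskal_fun_measurable) auto
    show "\<bar>X w\<bar> \<le> B" for w unfolding X_def by (rule B) simp
    show "\<bar>?g e w\<bar> \<le> B" for e w by (rule B) auto
  qed (simp_all add: finite_K_edges kruskal_delete_update)
  also have "\<dots> \<le> (\<Sum>e\<in>?K. \<integral>w. of_bool (e \<in> ?M w) * ?c w \<partial>weights n)"
  proof (rule sum_mono)
    fix e assume e: "e \<in> ?K"
    show "(\<integral>w. (X w - ?g e w)\<^sup>2 \<partial>weights n) \<le> (\<integral>w. of_bool (e \<in> ?M w) * ?c w \<partial>weights n)"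
    proof (rule integral_mono_AE')
      show "integrable (weights n) (\<lambda>w. of_bool (e \<in> ?M w) * ?c w)"
        by (rule kruskal_fun_integrable[OF order_refl, of n
            "\<lambda>M. of_bool (e \<in> M) * ((real ?v)\<^sup>2 * real (maxdeg n M) ^ (2 * ?v))"])
      \<comment> \<open>The pointwise bound rests on the exchange of a single edge, which is
        available for injective weights, hence almost surely.\<close>
      show "AE w in weights n. (X w - ?g e w)\<^sup>2 \<le> of_bool (e \<in> ?M w) * ?c w"
        using AE_weights_inj
      proof (rule AE_mp, intro AE_I2 impI)
        fix w :: "nat set \<Rightarrow> real" assume inj: "inj_on w ?K"
        have "(X w - ?g e w)\<^sup>2 \<le> (of_bool (e \<in> ?M w) * (real ?v * ?D w ^ ?v))\<^sup>2"
          using embeddings_kruskal_delete[OF V r inj e] unfolding X_def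
          by (simp add: abs_le_square_iff[symmetric])
        also have "\<dots> = of_bool (e \<in> ?M w) * ?c w"
          by (cases "e \<in> ?M w") (simp_all add: power_mult_distrib power_mult[symmetric] mult.commute)
        finally show "(X w - ?g e w)\<^sup>2 \<le> of_bool (e \<in> ?M w) * ?c w" .
      qed
    qed simp
  qed
  also have "\<dots> = (\<integral>w. (\<Sum>e\<in>?K. of_bool (e \<in> ?M w) * ?c w) \<partial>weights n)"
    by (rule Bochner_Integration.integral_sum[symmetric])
      (rule kruskal_fun_integrable[OF order_refl, of n
            "\<lambda>M. of_bool (_ \<in> M) * ((real ?v)\<^sup>2 * real (maxdeg n M) ^ (2 * ?v))"])
  also have "\<dots> \<le> (\<integral>w. real n * (real ?v)\<^sup>2 * ?D w ^ (2 * ?v + 1) \<partial>weights n)"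
  proof (rule integral_mono)
    show "integrable (weights n) (\<lambda>w. \<Sum>e\<in>?K. of_bool (e \<in> ?M w) * ?c w)"
      by (rule kruskal_fun_integrable[OF order_refl, of n
            "\<lambda>M. \<Sum>e\<in>?K. of_bool (e \<in> M) * ((real ?v)\<^sup>2 * real (maxdeg n M) ^ (2 * ?v))"])
    show "integrable (weights n) (\<lambda>w. real n * (real ?v)\<^sup>2 * ?D w ^ (2 * ?v + 1))"
      by (rule kruskal_fun_integrable[OF order_refl, of n
            "\<lambda>M. real n * (real ?v)\<^sup>2 * real (maxdeg n M) ^ (2 * ?v + 1)"])
    fix w
    have "(\<Sum>e\<in>?K. of_bool (e \<in> ?M w) :: real) = real (card (?M w))"
    proof -
      have "?K \<inter> ?M w = ?M w" using kruskal_subset by blast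
      then show ?thesis using finite_K_edges by (simp add: Collect_mem_eq Int_def[symmetric])
    qed
    then have "(\<Sum>e\<in>?K. of_bool (e \<in> ?M w) * ?c w) = real (card (?M w)) * ?c w"
      by (simp add: sum_distrib_right[symmetric])
    also have "\<dots> \<le> real (n * maxdeg n (?M w)) * ?c w"
      by (intro mult_right_mono of_nat_mono card_kruskal_le) simp
    also have "\<dots> = real n * (real ?v)\<^sup>2 * ?D w ^ (2 * ?v + 1)" by simp
    finally show "(\<Sum>e\<in>?K. of_bool (e \<in> ?M w) * ?c w) \<le> real n * (real ?v)\<^sup>2 * ?D w ^ (2 * ?v + 1)" .
  qed
  also have "\<dots> = real n * (real ?v)\<^sup>2 * moment n (2 * ?v + 1)"
    unfolding moment_def by simp
  finally show ?thesis .
qed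

lemma labelling_exists:
  assumes "finite (verts G)" "card (verts G) \<le> n"
  obtains \<phi> where "labelling n G \<phi>"
proof -
  have "card (verts G) \<le> card {1..n}" using assms by simp
  then obtain \<phi> where "\<phi> ` verts G \<subseteq> {1..n}" "inj_on \<phi> (verts G)"
    using card_le_inj[OF assms(1) finite_atLeastAtMost[of 1 n]] by blast
  then show thesis using that by (auto simp: labelling_def)
qed

text \<open>Linearity of expectation over all injections, which have equal probability by
  exchangeability. For \<open>card V > n\<close> both sides vanish, since truncated subtraction puts
  a factor 0 into the product.\<close>

lemma mean_embeddings:
  assumes V: "finite V" "E \<subseteq> two_subsets V" and n: "n \<ge> 1"
  shows "(\<integral>w. real (card (embeddings n V E (kruskal (K_edges n) w))) \<partial>weights n)
    = real (\<Prod>i<card V. n - i) * in_mst_prob n (V, E)"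
proof -
  interpret prob_space "weights n" by (rule prob_space_weights)
  let ?I = "{\<phi> \<in> V \<rightarrow>\<^sub>E {1..n}. inj_on \<phi> V}" and ?M = "\<lambda>w. kruskal (K_edges n) w"
  have fI: "finite ?I" by (rule finite_subset[of _ "V \<rightarrow>\<^sub>E {1..n}"]) (auto intro: finite_PiE V)
  have e: "real (card (embeddings n V E M)) = (\<Sum>\<phi>\<in>?I. of_bool ((`) \<phi> ` E \<subseteq> M))" for M
  proof -
    have "embeddings n V E M = {\<phi> \<in> ?I. (`) \<phi> ` E \<subseteq> M}"
      by (auto simp: embeddings_def homs_def)
    also have "{\<phi> \<in> ?I. (`) \<phi> ` E \<subseteq> M} = ?I \<inter> {\<phi>. (`) \<phi> ` E \<subseteq> M}" by blast
    finally show ?thesis using fI by (simp only: sum_of_bool_eq)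
  qed
  have p: "(\<integral>w. of_bool ((`) \<phi> ` E \<subseteq> ?M w) \<partial>weights n) = in_mst_prob n (V, E)" if "\<phi> \<in> ?I" for \<phi>
  proof -
    have l: "labelling n (V, E) \<phi>" using that by (auto simp: labelling_def)
    have "(\<integral>w. of_bool ((`) \<phi> ` E \<subseteq> ?M w) \<partial>weights n)
        = (\<integral>w. indicator (labelled_in_mst n (V, E) \<phi>) w \<partial>weights n :: real)"
    proof (rule integral_cong_AE)
      show "(\<lambda>w. of_bool ((`) \<phi> ` E \<subseteq> ?M w) :: real) \<in> borel_measurable (weights n)"
        by (rule kruskal_fun_measurable[OF order_refl, of "\<lambda>M. of_bool ((`) \<phi> ` E \<subseteq> M)"])
      show "indicator (labelled_in_mst n (V, E) \<phi>) \<in> borel_measurable (weights n)"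
        by (rule borel_measurable_indicator[OF labelled_in_mst_sets])
      show "AE w in weights n. of_bool ((`) \<phi> ` E \<subseteq> ?M w)
          = (indicator (labelled_in_mst n (V, E) \<phi>) w :: real)"
        using AE_mst_eq_kruskal[OF n]
        by (rule AE_mp) (intro AE_I2 impI, simp add: labelled_in_mst_def)
    qed
    also have "\<dots> = prob (labelled_in_mst n (V, E) \<phi>)"
      by (simp add: sets.Int_space_eq2[OF labelled_in_mst_sets])
    also have "\<dots> = in_mst_prob n (V, E)"
      using V l by (intro in_mst_prob_eq[symmetric]) (auto simp: fin_graph_def)
    finally show ?thesis .
  qed
  have "(\<integral>w. real (card (embeddings n V E (?M w))) \<partial>weights n)
      = (\<Sum>\<phi>\<in>?I. \<integral>w. of_bool ((`) \<phi> ` E \<subseteq> ?M w) \<partial>weights n)"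
    unfolding e
    by (rule Bochner_Integration.integral_sum)
      (rule kruskal_fun_integrable[OF order_refl, of _ "\<lambda>M. of_bool ((`) _ ` E \<subseteq> M)"])
  also have "\<dots> = real (card ?I) * in_mst_prob n (V, E)" using p by simp
  also have "card ?I = (\<Prod>i<card V. n - i)"
    using card_inj_on_subset_funcset[OF V(1) finite_atLeastAtMost order_refl, of 1 n]
    by (simp add: atLeast0LessThan)
  finally show ?thesis .
qed

text \<open>A labelling of the larger vertex set labels both graphs, and the event involves only the
  edges.\<close>

lemma in_mst_prob_isolated:
  assumes "finite V" "E \<subseteq> two_subsets V" "card V \<le> n"
  shows "in_mst_prob n (\<Union>E, E) = in_mst_prob n (V, E)"
proof -
  have sub: "\<Union>E \<subseteq> V" using assms(2) by (auto simp: two_subsets_def)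
  obtain \<phi> where l: "labelling n (V, E) \<phi>" using labelling_exists[of "(V, E)" n] assms by auto
  have l': "labelling n (\<Union>E, E) \<phi>"
    using l sub by (auto simp: labelling_def intro: inj_on_subset)
  have "fin_graph (V, E)" "fin_graph (\<Union>E, E)"
    using assms finite_subset[OF sub assms(1)] by (auto simp: fin_graph_def two_subsets_def)
  then show ?thesis
    using in_mst_prob_eq[OF _ l] in_mst_prob_eq[OF _ l'] by (simp add: labelled_in_mst_def)
qed

lemma in_mst_prob_no_edges:
  assumes "finite V" "card V \<le> n"
  shows "in_mst_prob n (V, {}) = 1"
proof -
  interpret prob_space "weights n" by (rule prob_space_weights)
  obtain \<phi> where l: "labelling n (V, {}) \<phi>" using labelling_exists[of "(V, {})" n] assms by auto
  have "fin_graph (V, {})" using assms by (simp add: fin_graph_def)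
  from in_mst_prob_eq[OF this l] show ?thesis by (simp add: labelled_in_mst_def prob_space)
qed

section \<open>Lower bound for the containment probability\<close>

text \<open>A walk in the image lifts step by step to a walk from \<open>u\<close>, because
  injectivity makes preimages in \<open>V\<close> unique; a detour around an image edge would thus
  lift to one around the original edge.\<close>

lemma bridges_only_image:
  assumes inj: "inj_on \<phi> V" and E: "E \<subseteq> two_subsets V" "bridges_only E"
  shows "bridges_only ((`) \<phi> ` E)"
  unfolding bridges_only_def
proof (intro allI impI notI)
  fix a b assume ab: "{a, b} \<in> (`) \<phi> ` E" and r: "(a, b) \<in> reach ((`) \<phi> ` E - {{a, b}})"
  obtain e where e: "e \<in> E" "{a, b} = \<phi> ` e" using ab by auto
  then obtain u v where uv: "u \<in> e" "v \<in> e" "a = \<phi> u" "b = \<phi> v" by blast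
  have eV: "e \<subseteq> V" and "card e = 2" using e(1) E(1) by (auto simp: two_subsets_def)
  have "card {a, b} = 2"
    unfolding e(2) using \<open>card e = 2\<close> inj_on_subset[OF inj eV] by (simp add: card_image)
  then have "a \<noteq> b" by auto
  then have e': "e = {u, v}" using uv \<open>card e = 2\<close> by (auto simp: card_2_iff)
  have "\<exists>x\<in>V. y = \<phi> x \<and> (u, x) \<in> reach (E - {e})" if "(a, y) \<in> reach ((`) \<phi> ` E - {{a, b}})" for y
    using that unfolding reach_def[of "(`) \<phi> ` E - {{a, b}}"]
  proof (induction rule: rtrancl_induct)
    case base
    then show ?case using uv eV by auto
  next
    case (step y z)
    then obtain x where x: "x \<in> V" "y = \<phi> x" "(u, x) \<in> reach (E - {e})" by blast
    have "{y, z} \<in> (`) \<phi> ` E - {{a, b}}" using step.hyps(2) by simp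
    then obtain g where g: "g \<in> E" "{y, z} = \<phi> ` g" "{y, z} \<noteq> {a, b}" by blast
    have gV: "g \<subseteq> V" "card g = 2" using g(1) E(1) by (auto simp: two_subsets_def)
    obtain x' where x': "x' \<in> g" "y = \<phi> x'" using g(2) by blast
    then have xx: "x' = x" using x gV inj by (auto dest: inj_onD)
    obtain t where t: "t \<in> g" "z = \<phi> t" using g(2) by blast
    have "card {y, z} = 2"
      unfolding g(2) using gV inj_on_subset[OF inj] by (simp add: card_image)
    then have "y \<noteq> z" by auto
    then have "g = {x, t}" using x' xx t gV(2) by (auto simp: card_2_iff)
    moreover have "g \<noteq> e" using g(2,3) e(2) by auto
    ultimately have "(x, t) \<in> reach (E - {e})" using g(1) by (intro reach_edge) auto
    then show ?case using x t gV(1) by (auto intro: reach_trans)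
  qed
  from this[OF r] obtain x where x: "x \<in> V" "b = \<phi> x" "(u, x) \<in> reach (E - {e})" by blast
  have "x = v" using x(1,2) uv(2,4) eV inj by (auto dest: inj_onD)
  then show False using x(3) E(2) e(1) e' by (auto simp: bridges_only_def)
qed

text \<open>The event that the edges of the forest are light and all other edges at its vertices are heavy.\<close>

lemma in_mst_prob_ge:
  assumes V: "finite V" "E \<subseteq> two_subsets V" "bridges_only E" and n: "n \<ge> 2" "card V \<le> n"
  shows "exp (- 4 * real (card E)) / real n ^ card E \<le> in_mst_prob n (V, E)"
proof -
  interpret prob_space "weights n" by (rule prob_space_weights)
  have fg: "fin_graph (V, E)" using V by (simp add: fin_graph_def)
  obtain \<phi> where l: "labelling n (V, E) \<phi>" using labelling_exists[of "(V, E)" n] V n by auto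
  then have inj: "inj_on \<phi> V" and im: "\<phi> ` V \<subseteq> {1..n}" by (auto simp: labelling_def)
  let ?K = "K_edges n" and ?m = "card E"
  define F where "F = (`) \<phi> ` E"
  have fE: "finite E" using V(1,2) by (auto simp: two_subsets_def intro: finite_subset[of _ "Pow V"])
  have FK: "F \<subseteq> ?K"
  proof
    fix f assume "f \<in> F"
    then obtain e where e: "e \<in> E" "f = \<phi> ` e" by (auto simp: F_def)
    then have e': "e \<subseteq> V" "card e = 2" using V(2) by (auto simp: two_subsets_def)
    then have "card f = 2" unfolding e(2) using inj_on_subset[OF inj] by (simp add: card_image)
    moreover have "f \<subseteq> {1..n}" unfolding e(2) using im e'(1) by blast
    ultimately show "f \<in> ?K" by (simp add: K_edges_def two_subsets_def)
  qed
  have finF: "finite F" using fE by (simp add: F_def)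
  have cF: "card F \<le> ?m" unfolding F_def by (rule card_image_le[OF fE])
  have bF: "bridges_only F" unfolding F_def by (rule bridges_only_image[OF inj V(2,3)])
  define W where "W = \<Union>F"
  \<comment> \<open>\<open>C\<close> consists of the edges through which a walk could leave the
    forest: they meet one of its vertices but are not in it.\<close>
  define C where "C = {g \<in> ?K. g \<inter> W \<noteq> {}} - F"
  have cW: "card W \<le> 2 * ?m"
  proof -
    have "card W \<le> (\<Sum>f\<in>F. card f)" unfolding W_def by (rule card_Union_le_sum_card)
    also have "\<dots> = 2 * card F"
      using FK by (simp add: K_edges_def two_subsets_def subset_iff)
    finally show ?thesis using cF by linarith
  qed
  have finW: "finite W" 
    by (rule finite_subset[of _ "{1..n}"]) (use FK in \<open>auto simp: W_def K_edges_def two_subsets_def\<close>)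
  have cC: "card C \<le> 2 * ?m * n"
  proof -
    have "C \<subseteq> (\<Union>x\<in>W. {e \<in> ?K. x \<in> e})" by (auto simp: C_def)
    then have "card C \<le> card (\<Union>x\<in>W. {e \<in> ?K. x \<in> e})"
      by (rule card_mono[rotated]) (use finW finite_K_edges in auto)
    also have "\<dots> \<le> (\<Sum>x\<in>W. card {e \<in> ?K. x \<in> e})" by (rule card_UN_le[OF finW])
    also have "\<dots> \<le> (\<Sum>x\<in>W. n)" by (intro sum_mono card_star)
    also have "\<dots> \<le> 2 * ?m * n" using cW by simp
    finally show ?thesis .
  qed
  \<comment> \<open>At this threshold each forest edge costs a factor \<open>1 / n\<close>, while
    the at most \<open>2 * card E * n\<close> edges of \<open>C\<close> are all heavy with
    probability bounded below.\<close>
  let ?p = "1 / real n"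
  let ?B = "\<lambda>e. if e \<in> F then {..<?p} else {?p..}"
  let ?A = "{w \<in> space (weights n). \<forall>e\<in>F \<union> C. w e \<in> ?B e}"
  have JK: "F \<union> C \<subseteq> ?K" using FK by (auto simp: C_def)
  have finC: "finite C" using JK finite_K_edges finite_subset by blast
  have p: "0 \<le> ?p" "?p \<le> 1" using n by auto
  have "prob ?A = (\<Prod>e\<in>F \<union> C. measure unif (?B e))"
    by (rule weights_box(1)[OF JK]) auto
  also have "\<dots> = (\<Prod>e\<in>F. measure unif (?B e)) * (\<Prod>e\<in>C. measure unif (?B e))"
    using finF finC by (intro prod.union_disjoint) (auto simp: C_def)
  also have "(\<Prod>e\<in>F. measure unif (?B e)) = ?p ^ card F"
    using unif_less(1)[OF p] by simp
  also have "(\<Prod>e\<in>C. measure unif (?B e)) = (1 - ?p) ^ card C"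
  proof -
    have "(\<Prod>e\<in>C. measure unif (?B e)) = (\<Prod>e\<in>C. 1 - ?p)"
      by (rule prod.cong) (use unif_less(2)[OF p] in \<open>auto simp: C_def\<close>)
    then show ?thesis by simp
  qed
  finally have pA: "prob ?A = ?p ^ card F * (1 - ?p) ^ card C" .
  have "exp (- 4 * real ?m) / real n ^ ?m = ?p ^ ?m * exp (- 4 * real ?m)"
    by (simp add: power_divide)
  also have "\<dots> \<le> ?p ^ card F * (1 - ?p) ^ card C"
  proof (rule mult_mono)
    show "?p ^ ?m \<le> ?p ^ card F" using p cF by (intro power_decreasing) auto
    \<comment> \<open>For \<open>n \<ge> 2\<close> the quotient \<open>n / (n - 1)\<close> is at
      most 2. Together with the bound on \<open>card C\<close> this produces the exponent
      \<open>4 * card E\<close>.\<close>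
    have q: "exp (- 2) \<le> (1 - ?p) ^ n"
    proof -
      have n1: "real n - 1 > 0" using n by simp
      have "1 / (1 - ?p) = 1 + 1 / (real n - 1)" using n by (simp add: field_simps)
      also have "\<dots> \<le> exp (1 / (real n - 1))" by (rule exp_ge_add_one_self)
      finally have "(1 / (1 - ?p)) ^ n \<le> exp (1 / (real n - 1)) ^ n"
        using n by (intro power_mono) auto
      also have "\<dots> = exp (real n * (1 / (real n - 1)))" by (simp flip: exp_of_nat_mult)
      also have "\<dots> \<le> exp 2" using n n1 by (simp add: field_simps)
      finally have "1 / (1 - ?p) ^ n \<le> exp 2" by (simp add: power_divide)
      moreover have "(1 - ?p) ^ n > 0" using n by simp
      ultimately show ?thesis by (simp add: exp_minus field_simps)
    qed
    have "exp (- 4 * real ?m) = exp (- 2) ^ (2 * ?m)" by (simp flip: exp_of_nat_mult)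
    also have "\<dots> \<le> ((1 - ?p) ^ n) ^ (2 * ?m)" using q by (intro power_mono) auto
    also have "\<dots> = (1 - ?p) ^ (2 * ?m * n)" by (simp add: power_mult[symmetric] mult.commute)
    also have "\<dots> \<le> (1 - ?p) ^ card C" using p cC by (intro power_decreasing) auto
    finally show "exp (- 4 * real ?m) \<le> (1 - ?p) ^ card C" .
  qed (use p in auto)
  also have "\<dots> = prob ?A" by (rule pA[symmetric])
  also have "\<dots> \<le> prob (labelled_in_mst n (V, E) \<phi>)"
  proof (rule finite_measure_mono_AE[OF _ labelled_in_mst_sets])
    show "AE w in weights n. w \<in> ?A \<longrightarrow> w \<in> labelled_in_mst n (V, E) \<phi>"
    proof (rule AE_mp[OF AE_mst_eq_kruskal])
      show "n \<ge> 1" using n by simp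
      show "AE w in weights n. mst n w = kruskal ?K w \<longrightarrow> w \<in> ?A \<longrightarrow> w \<in> labelled_in_mst n (V, E) \<phi>"
      proof (intro AE_I2 impI)
        fix w assume mst: "mst n w = kruskal ?K w" and w: "w \<in> ?A"
        have light: "w e < ?p" if "e \<in> F" for e using w that by force
        have heavy: "w e \<ge> ?p" if "e \<in> C" for e
        proof -
          have "e \<notin> F" using that by (simp add: C_def)
          then show ?thesis using w that by force
        qed
        have "F \<subseteq> kruskal ?K w"
        proof
          fix e assume e: "e \<in> F"
          have "(u, v) \<notin> reach {g \<in> ?K. w g < w e}" if uv: "e = {u, v}" for u v
          proof
            assume "(u, v) \<in> reach {g \<in> ?K. w g < w e}"
            \<comment> \<open>A walk from a forest vertex along edges lighter than \<open>e\<close>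
              can use neither \<open>C\<close> nor \<open>e\<close>; it stays in the forest without
              \<open>e\<close>, where the ends of \<open>e\<close> are separated.\<close>
            then have "v \<in> W \<and> (u, v) \<in> reach (F - {e})"
              unfolding reach_def[of "{g \<in> ?K. w g < w e}"]
            proof (induction rule: rtrancl_induct)
              case base
              then show ?case using e uv by (auto simp: W_def)
            next
              case (step y z)
              then have yz: "{y, z} \<in> ?K" "w {y, z} < w e" by auto
              then have "{y, z} \<notin> C" using heavy light[OF e] by force
              then have "{y, z} \<in> F" using yz(1) step.IH by (auto simp: C_def)
              moreover have "{y, z} \<noteq> e" using yz(2) by auto
              ultimately show ?case using step.IH
                by (auto simp: W_def intro: reach_trans reach_edge)
            qed
            then show False using bF e uv by (auto simp: bridges_only_def)
          qed
          then show "e \<in> kruskal ?K w" using e FK by (auto simp: kruskal_def)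
        qed
        then show "w \<in> labelled_in_mst n (V, E) \<phi>"
          using mst w by (simp add: labelled_in_mst_def F_def)
      qed
    qed
  qed
  also have "\<dots> = in_mst_prob n (V, E)" by (rule in_mst_prob_eq[OF fg l, symmetric])
  finally show ?thesis .
qed

section \<open>Asymptotic factorisation\<close>

lemma moment_mono: "q \<le> q' \<Longrightarrow> moment n q \<le> moment n q'"
  unfolding moment_def
  by (intro integral_mono power_increasing
      kruskal_fun_integrable[OF order_refl, of n "\<lambda>M. real (maxdeg n M) ^ _"])
    (use maxdeg_pos in auto)

lemma moment_ge_1: "moment n q \<ge> 1"
proof -
  interpret prob_space "weights n" by (rule prob_space_weights)
  have "(\<integral>w. 1 \<partial>weights n) \<le> moment n q"
    unfolding moment_def
    by (intro integral_mono one_le_power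
        kruskal_fun_integrable[OF order_refl, of n "\<lambda>M. real (maxdeg n M) ^ q"])
      (use maxdeg_pos in auto)
  then show ?thesis by (simp add: prob_space)
qed

lemma falling_add_le: "(\<Prod>i<a + t. n - i) \<le> (\<Prod>i<a. n - i) * (\<Prod>i<t. (n :: nat) - i)"
proof (induction t)
  case (Suc t)
  have "(\<Prod>i<a + Suc t. n - i) = (\<Prod>i<a + t. n - i) * (n - (a + t))" by simp
  also have "\<dots> \<le> ((\<Prod>i<a. n - i) * (\<Prod>i<t. n - i)) * (n - t)"
    by (intro mult_le_mono Suc.IH) simp
  finally show ?case by (simp add: mult.assoc)
qed simp

lemma falling_bounds:
  assumes "a \<le> k" "k \<le> n"
  shows "real (\<Prod>i<a. n - i) \<le> real n ^ a" "(real n - real k) ^ a \<le> real (\<Prod>i<a. n - i)"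
proof -
  have "real (\<Prod>i<a. n - i) \<le> (\<Prod>i<a. real n)"
    unfolding of_nat_prod by (rule prod_mono) auto
  then show "real (\<Prod>i<a. n - i) \<le> real n ^ a" by simp
  have "(\<Prod>i<a. real n - real k) \<le> real (\<Prod>i<a. n - i)"
    unfolding of_nat_prod using assms by (intro prod_mono) (auto simp: of_nat_diff)
  then show "(real n - real k) ^ a \<le> real (\<Prod>i<a. n - i)" by simp
qed

text \<open>The number of injections is at least \<open>(n / 2) ^ card V\<close>, since
  \<open>2 * k \<le> n\<close>; the powers of \<open>n\<close> in the probability bound then cancel
  down to the number of components.\<close>

lemma mean_embeddings_ge:
  assumes V: "finite V" "E \<subseteq> two_subsets V" "bridges_only E"
    and k: "card V \<le> k" "1 \<le> k" "2 * k \<le> n" and E: "card E \<le> card V"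
  shows "real n ^ (card V - card E) * ((1 / 2) ^ card V * exp (- 4 * real (card V)))
    \<le> real (\<Prod>i<card V. n - i) * in_mst_prob n (V, E)"
proof -
  let ?v = "card V" and ?e = "card E"
  have n: "real n > 0" using k by simp
  have "real n ^ (?v - ?e) * ((1 / 2) ^ ?v * exp (- 4 * real ?v))
      \<le> real n ^ (?v - ?e) * ((1 / 2) ^ ?v * exp (- 4 * real ?e))"
    using E by (intro mult_left_mono) auto
  also have "\<dots> = (real n / 2) ^ ?v * (exp (- 4 * real ?e) / real n ^ ?e)"
    using n E by (simp add: power_diff power_divide)
  also have "\<dots> \<le> real (\<Prod>i<?v. n - i) * in_mst_prob n (V, E)"
  proof (rule mult_mono)
    have "(real n / 2) ^ ?v \<le> (real n - real k) ^ ?v" using k by (intro power_mono) auto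
    also have "\<dots> \<le> real (\<Prod>i<?v. n - i)" using k by (intro falling_bounds) auto
    finally show "(real n / 2) ^ ?v \<le> real (\<Prod>i<?v. n - i)" .
    show "exp (- 4 * real ?e) / real n ^ ?e \<le> in_mst_prob n (V, E)"
      using k by (intro in_mst_prob_ge V) auto
  qed (auto intro!: prod_nonneg)
  finally show ?thesis .
qed

section \<open>The error terms and the estimate for two parts\<close>

text \<open>Bounds the relative excess of the product of the two numbers of injections over the
  number of injections of the union.\<close>

definition ratio_err :: "nat \<Rightarrow> nat \<Rightarrow> real" where
  "ratio_err k n = (real n / (real n - real k)) ^ k - 1"

text \<open>The covariance bound divided by the lower bound for the product of the means:
  \<open>sqrt n\<close> against \<open>n\<close> leaves the moment over \<open>sqrt n\<close>, and
  \<open>2 ^ k\<close> and \<open>exp (4 * k)\<close> invert the constants of the means.\<close>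

definition cov_err :: "nat \<Rightarrow> nat \<Rightarrow> real" where
  "cov_err k n = 2 * (real k)\<^sup>2 * 2 ^ k * exp (4 * real k) * (moment n (2 * k + 1) / sqrt (real n))"

text \<open>This is \<open>(1 + ratio_err k n) * (1 + cov_err k n) - 1\<close>.\<close>

definition step_err :: "nat \<Rightarrow> nat \<Rightarrow> real" where
  "step_err k n = ratio_err k n + (1 + ratio_err k n) * cov_err k n"

lemma step_err_tendsto: "step_err k \<longlonglongrightarrow> 0"
proof -
  have "(\<lambda>n. real n / (real n - real k)) \<longlonglongrightarrow> 1" by real_asymp
  then have "(\<lambda>n. (real n / (real n - real k)) ^ k - 1) \<longlonglongrightarrow> 1 ^ k - 1"
    by (intro tendsto_intros)
  then have r: "ratio_err k \<longlonglongrightarrow> 0" by (simp add: ratio_err_def[abs_def])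
  have "cov_err k \<longlonglongrightarrow> 2 * (real k)\<^sup>2 * 2 ^ k * exp (4 * real k) * 0"
    unfolding cov_err_def[abs_def] by (intro tendsto_intros moment_asymp)
  then have c: "cov_err k \<longlonglongrightarrow> 0" by simp
  have "(\<lambda>n. ratio_err k n + (1 + ratio_err k n) * cov_err k n) \<longlonglongrightarrow> 0 + (1 + 0) * 0"
    by (intro tendsto_intros r c)
  then show ?thesis by (simp add: step_err_def[abs_def])
qed

lemma step_err_nonneg: "2 * k \<le> n \<Longrightarrow> 1 \<le> k \<Longrightarrow> 0 \<le> ratio_err k n \<and> 0 \<le> cov_err k n"
  using moment_ge_1[of n "2 * k + 1"]
  by (auto simp: ratio_err_def cov_err_def intro!: one_le_power mult_nonneg_nonneg divide_nonneg_nonneg)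

text \<open>Only the tree count is centred, so the variance bound is applied to the connected part
  alone; the forest count enters through its pointwise bound by a power of the degree. The factor 2
  allows for two errors, the covariance and the overlaps.\<close>

lemma embeddings_covariance:
  assumes A: "finite VA" "EA \<subseteq> two_subsets VA" "bridges_only EA"
    and T: "finite VT" "ET \<subseteq> two_subsets VT" "VT \<noteq> {}"
    and r: "\<And>u v. u \<in> VT \<Longrightarrow> v \<in> VT \<Longrightarrow> (u, v) \<in> reach ET"
    and dis: "VA \<inter> VT = {}"
    and k: "card VA + card VT \<le> k" and n: "n \<ge> 1"
  shows "\<bar>real (\<Prod>i<card VA + card VT. n - i) * in_mst_prob n (VA \<union> VT, EA \<union> ET)
      - (real (\<Prod>i<card VA. n - i) * in_mst_prob n (VA, EA))
        * (real (\<Prod>i<card VT. n - i) * in_mst_prob n (VT, ET))\<bar>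
    \<le> real n ^ (card VA - card EA) * (2 * (real k)\<^sup>2 * (moment n (2 * k + 1) * sqrt (real n)))"
proof -
  interpret prob_space "weights n" by (rule prob_space_weights)
  let ?a = "card VA" and ?t = "card VT"
  let ?R = "moment n (2 * k + 1)"
  define N where "N = real n ^ (?a - card EA)"
  define EE where "EE h = (\<integral>w. h (kruskal (K_edges n) w) \<partial>weights n)" for h :: "nat set set \<Rightarrow> real"
  have int: "integrable (weights n) (\<lambda>w. h (kruskal (K_edges n) w))" for h :: "nat set set \<Rightarrow> real"
    by (rule kruskal_fun_integrable) simp
  have EE_mono: "EE h \<le> EE h'" if "\<And>M. finite M \<Longrightarrow> h M \<le> h' M" for h h'
    unfolding EE_def by (intro integral_mono int that finite_kruskal)
  have EE_add: "EE (\<lambda>M. h M + h' M) = EE h + EE h'" for h h'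
    unfolding EE_def by (intro Bochner_Integration.integral_add int)
  have EE_diff: "EE (\<lambda>M. h M - h' M) = EE h - EE h'" for h h'
    unfolding EE_def by (intro Bochner_Integration.integral_diff int)
  have EE_mult: "EE (\<lambda>M. c * h M) = c * EE h" for c h
    unfolding EE_def by simp
  have EE_const: "EE (\<lambda>M. c) = c" for c
    unfolding EE_def by (simp add: prob_space)
  have EE_abs: "\<bar>EE h\<bar> \<le> EE (\<lambda>M. \<bar>h M\<bar>)" for h
    unfolding EE_def by (rule integral_abs_bound)
  have EE_D: "EE (\<lambda>M. real (maxdeg n M) ^ q) = moment n q" for q
    unfolding EE_def moment_def ..
  let ?D = "\<lambda>M. real (maxdeg n M)"
  let ?XA = "\<lambda>M. real (card (embeddings n VA EA M))"
  let ?XT = "\<lambda>M. real (card (embeddings n VT ET M))"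
  let ?XF = "\<lambda>M. real (card (embeddings n (VA \<union> VT) (EA \<union> ET) M))"
  let ?O = "\<lambda>M. real (card (overlaps n VA EA VT ET M))"
  have cF: "card (VA \<union> VT) = ?a + ?t" using A(1) T(1) dis by (rule card_Un_disjoint)
  have two: "EA \<union> ET \<subseteq> two_subsets (VA \<union> VT)" using A(2) T(2) by (auto simp: two_subsets_def)
  have mA: "EE ?XA = real (\<Prod>i<?a. n - i) * in_mst_prob n (VA, EA)"
    unfolding EE_def by (rule mean_embeddings[OF A(1,2) n])
  have mT: "EE ?XT = real (\<Prod>i<?t. n - i) * in_mst_prob n (VT, ET)"
    unfolding EE_def by (rule mean_embeddings[OF T(1,2) n])
  have mF: "EE ?XF = real (\<Prod>i<?a + ?t. n - i) * in_mst_prob n (VA \<union> VT, EA \<union> ET)"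
    unfolding EE_def using mean_embeddings[OF _ two n] A(1) T(1) cF by simp
  have split: "?XF M = ?XA M * ?XT M - ?O M" for M
    using card_embeddings_union[OF A(1,2) T(1,2) dis, of n M]
    by (metis add_diff_cancel_right' of_nat_add of_nat_mult)
  have t1: "1 \<le> ?t" using T(1,3) by (simp add: card_gt_0_iff Suc_le_eq)
  then have k1: "1 \<le> k" using k by simp
  have N: "0 < N" "0 < sqrt (real n)" "1 \<le> sqrt (real n)" using n by (auto simp: N_def)
  have D1: "1 \<le> ?D M" for M using maxdeg_pos[of n M] by simp
  have R: "1 \<le> ?R" by (rule moment_ge_1)
  have XA: "?XA M \<le> N * ?D M ^ ?a" if M: "finite M" for M
  proof -
    have "card (embeddings n VA EA M) \<le> n ^ (?a - card EA) * maxdeg n M ^ ?a"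
      using card_embeddings_forest[OF A deg_le_maxdeg[OF M] maxdeg_pos] by simp
    then have "?XA M \<le> real (n ^ (?a - card EA) * maxdeg n M ^ ?a)" by (rule of_nat_mono)
    then show ?thesis by (simp add: N_def)
  qed
  have EO: "EE ?O \<le> N * ((real k)\<^sup>2 * ?R)"
  proof -
    have "EE ?O \<le> EE (\<lambda>M. N * (real k)\<^sup>2 * ?D M ^ (2 * k + 1))"
    proof (rule EE_mono)
      fix M :: "nat set set" assume M: "finite M"
      have "card (overlaps n VA EA VT ET M)
          \<le> card (embeddings n VA EA M) * (?a * (?t * maxdeg n M ^ (?t - 1)))"
        by (rule card_overlaps[OF A(1) T(1,2) r deg_le_maxdeg[OF M]])
      then have "?O M \<le> real (card (embeddings n VA EA M) * (?a * (?t * maxdeg n M ^ (?t - 1))))"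
        by (rule of_nat_mono)
      also have "\<dots> = ?XA M * (real ?a * real ?t) * ?D M ^ (?t - 1)" by simp
      also have "\<dots> \<le> (N * ?D M ^ ?a) * (real k * real k) * ?D M ^ (?t - 1)"
        using k N by (intro mult_mono XA M) auto
      also have "\<dots> = N * (real k)\<^sup>2 * ?D M ^ (?a + (?t - 1))"
        by (simp add: power_add power2_eq_square)
      also have "\<dots> \<le> N * (real k)\<^sup>2 * ?D M ^ (2 * k + 1)"
        using k N D1 by (intro mult_left_mono power_increasing) auto
      finally show "?O M \<le> N * (real k)\<^sup>2 * ?D M ^ (2 * k + 1)" .
    qed
    then show ?thesis unfolding EE_mult EE_D by (simp add: mult.assoc)
  qed
  have EO0: "0 \<le> EE ?O" unfolding EE_def by (rule Bochner_Integration.integral_nonneg) simp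
  have XA2: "EE (\<lambda>M. (?XA M)\<^sup>2) \<le> N\<^sup>2 * ?R"
  proof -
    have "EE (\<lambda>M. (?XA M)\<^sup>2) \<le> EE (\<lambda>M. N\<^sup>2 * ?D M ^ (2 * k + 1))"
    proof (rule EE_mono)
      fix M :: "nat set set" assume M: "finite M"
      have "(?XA M)\<^sup>2 \<le> (N * ?D M ^ ?a)\<^sup>2" by (intro power_mono XA M) simp
      also have "\<dots> = N\<^sup>2 * ?D M ^ (2 * ?a)"
        by (simp add: power_mult_distrib power_mult[symmetric] mult.commute)
      also have "\<dots> \<le> N\<^sup>2 * ?D M ^ (2 * k + 1)"
        using k D1 by (intro mult_left_mono power_increasing) auto
      finally show "(?XA M)\<^sup>2 \<le> N\<^sup>2 * ?D M ^ (2 * k + 1)" .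
    qed
    then show ?thesis unfolding EE_mult EE_D .
  qed
  define Y where "Y M = ?XT M - EE ?XT" for M
  have Y2: "EE (\<lambda>M. (Y M)\<^sup>2) \<le> real n * (real k)\<^sup>2 * ?R"
  proof -
    have "(Y M)\<^sup>2 = (?XT M)\<^sup>2 - 2 * EE ?XT * ?XT M + (EE ?XT)\<^sup>2" for M
      unfolding Y_def by (simp add: power2_diff algebra_simps)
    then have "EE (\<lambda>M. (Y M)\<^sup>2) = EE (\<lambda>M. (?XT M)\<^sup>2) - (EE ?XT)\<^sup>2"
      by (simp only: EE_add EE_diff EE_mult EE_const) (simp add: power2_eq_square)
    also have "\<dots> \<le> real n * (real ?t)\<^sup>2 * moment n (2 * ?t + 1)"
      unfolding EE_def by (rule variance_embeddings[OF T(1,2) r])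
    also have "\<dots> \<le> real n * (real k)\<^sup>2 * ?R"
      using k moment_ge_1[of n "2 * ?t + 1"] by (intro mult_mono power_mono moment_mono) auto
    finally show ?thesis .
  qed
  \<comment> \<open>the weight that balances the two terms of the AM-GM bound of the covariance\<close>
  let ?l = "sqrt (real n) / N"
  have l: "?l > 0" using N by simp
  have "EE (\<lambda>M. ?XA M * ?XT M) - EE ?XA * EE ?XT = EE (\<lambda>M. ?XA M * Y M)"
  proof -
    have "?XA M * Y M = ?XA M * ?XT M - EE ?XT * ?XA M" for M
      unfolding Y_def by (simp add: algebra_simps)
    then show ?thesis by (simp only: EE_diff EE_mult) simp
  qed
  also have "\<bar>\<dots>\<bar> \<le> EE (\<lambda>M. \<bar>?XA M * Y M\<bar>)" by (rule EE_abs)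
  also have "\<dots> \<le> EE (\<lambda>M. ?l / 2 * (?XA M)\<^sup>2 + 1 / (2 * ?l) * (Y M)\<^sup>2)"
  proof (rule EE_mono)
    fix M
    have "0 \<le> (?l * ?XA M - \<bar>Y M\<bar>)\<^sup>2 / (2 * ?l)" using l by (intro divide_nonneg_pos) auto
    also have "\<dots> = ?l / 2 * (?XA M)\<^sup>2 + 1 / (2 * ?l) * (Y M)\<^sup>2 - ?XA M * \<bar>Y M\<bar>"
      using N by (simp add: power2_eq_square field_simps)
    finally show "\<bar>?XA M * Y M\<bar> \<le> ?l / 2 * (?XA M)\<^sup>2 + 1 / (2 * ?l) * (Y M)\<^sup>2"
      by (simp add: abs_mult)
  qed
  also have "\<dots> = ?l / 2 * EE (\<lambda>M. (?XA M)\<^sup>2) + 1 / (2 * ?l) * EE (\<lambda>M. (Y M)\<^sup>2)"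
    by (simp only: EE_add EE_mult)
  also have "\<dots> \<le> ?l / 2 * (N\<^sup>2 * ?R) + 1 / (2 * ?l) * (real n * (real k)\<^sup>2 * ?R)"
    using l N by (intro add_mono mult_left_mono XA2 Y2) auto
  also have "\<dots> = N * (?R * sqrt (real n)) * ((1 + (real k)\<^sup>2) / 2)"
  proof -
    have "?l / 2 * (N\<^sup>2 * ?R) = N * (?R * sqrt (real n)) / 2"
      using N by (simp add: power2_eq_square field_simps)
    moreover have "1 / (2 * ?l) * (real n * (real k)\<^sup>2 * ?R) = N * (?R * (real n / sqrt (real n))) * (real k)\<^sup>2 / 2"
      using N by (simp add: field_simps)
    moreover have "real n / sqrt (real n) = sqrt (real n)" by (rule real_div_sqrt) simp
    ultimately show ?thesis by (simp only:) (simp add: algebra_simps add_divide_distrib)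
  qed
  \<comment> \<open>\<open>(1 + k^2) / 2\<close> is at most \<open>k^2\<close> because
    \<open>k \<ge> 1\<close>.\<close>
  also have "\<dots> \<le> N * (?R * sqrt (real n)) * (real k)\<^sup>2"
    using N R k1 by (intro mult_left_mono) auto
  finally have cov: "\<bar>EE (\<lambda>M. ?XA M * ?XT M) - EE ?XA * EE ?XT\<bar> \<le> N * (?R * sqrt (real n)) * (real k)\<^sup>2" .
  have "EE ?XF = EE (\<lambda>M. ?XA M * ?XT M) - EE ?O" by (simp only: split EE_diff)
  \<comment> \<open>The overlap bound lacks the factor \<open>sqrt n\<close>; it is weakened to the
    form of the covariance term.\<close>
  moreover have "EE ?O \<le> N * (?R * sqrt (real n)) * (real k)\<^sup>2"
  proof -
    have "N * ((real k)\<^sup>2 * ?R) * 1 \<le> N * ((real k)\<^sup>2 * ?R) * sqrt (real n)"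
      using N R by (intro mult_left_mono) auto
    then show ?thesis using EO by (simp add: algebra_simps)
  qed
  ultimately have "\<bar>EE ?XF - EE ?XA * EE ?XT\<bar> \<le> 2 * (N * (?R * sqrt (real n)) * (real k)\<^sup>2)"
    using cov EO0 by linarith
  then show ?thesis unfolding mA mT mF N_def by (simp add: algebra_simps)
qed

text \<open>The additive error becomes a relative one on division by the product \<open>Q\<close> of
  the two means, which is at least of order \<open>n\<close> times
  \<open>n ^ (card VA - card EA)\<close>. Passing from means to probabilities costs a quotient of
  falling factorials.\<close>

lemma two_parts:
  assumes A: "finite VA" "EA \<subseteq> two_subsets VA" "bridges_only EA"
    and T: "finite VT" "ET \<subseteq> two_subsets VT" "bridges_only ET" "VT \<noteq> {}"
    and r: "\<And>u v. u \<in> VT \<Longrightarrow> v \<in> VT \<Longrightarrow> (u, v) \<in> reach ET"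
    and dis: "VA \<inter> VT = {}"
    and k: "card VA + card VT \<le> k" and n: "2 * k \<le> n"
  shows "\<exists>\<delta>. \<bar>\<delta>\<bar> \<le> step_err k n \<and> in_mst_prob n (VA \<union> VT, EA \<union> ET)
    = (1 + \<delta>) * (in_mst_prob n (VA, EA) * in_mst_prob n (VT, ET))"
proof -
  let ?a = "card VA" and ?t = "card VT" and ?eA = "card EA" and ?eT = "card ET"
  let ?fA = "real (\<Prod>i<?a. n - i)" and ?fT = "real (\<Prod>i<?t. n - i)" and ?fF = "real (\<Prod>i<?a + ?t. n - i)"
  let ?pA = "in_mst_prob n (VA, EA)" and ?pT = "in_mst_prob n (VT, ET)"
    and ?pF = "in_mst_prob n (VA \<union> VT, EA \<union> ET)"
  let ?N = "real n ^ (?a - ?eA)" and ?R = "moment n (2 * k + 1)"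
  have t1: "1 \<le> ?t" using T(1,4) by (simp add: card_gt_0_iff Suc_le_eq)
  then have k1: "1 \<le> k" using k by simp
  then have n0: "real n > 0" using n by simp
  have eA: "?eA \<le> ?a"
  proof -
    \<comment> \<open>The empty target with \<open>D = 1\<close> is only a vehicle: the wanted
      conclusion \<open>card EA \<le> card VA\<close> does not involve the target.\<close>
    have "deg_le n {} 1" by (simp add: deg_le_def)
    then show ?thesis using card_embeddings_forest[OF A, of n "{}" 1] by simp
  qed
  obtain v where v: "v \<in> VT" using T(4) by blast
  have eT: "?eT < ?t" by (rule card_edges_connected[OF T(1,2) v r[OF v] T(3)])
  have N: "?N > 0" using n0 by simp
  have gA: "?N * ((1 / 2) ^ ?a * exp (- 4 * real ?a)) \<le> ?fA * ?pA"
    using k k1 n eA by (intro mean_embeddings_ge[OF A]) auto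
  \<comment> \<open>A tree has fewer edges than vertices, so its mean supplies at least one full
    power of \<open>n\<close>.\<close>
  have "real n * ((1 / 2) ^ ?t * exp (- 4 * real ?t)) \<le> real n ^ (?t - ?eT) * ((1 / 2) ^ ?t * exp (- 4 * real ?t))"
    using eT n0 by (intro mult_right_mono self_le_power) auto
  also have "\<dots> \<le> ?fT * ?pT"
    using k k1 n eT by (intro mean_embeddings_ge[OF T(1-3)]) auto
  finally have gT: "real n * ((1 / 2) ^ ?t * exp (- 4 * real ?t)) \<le> ?fT * ?pT" .
  define Q where "Q = (?fA * ?pA) * (?fT * ?pT)"
  have "?N * real n * ((1 / 2) ^ k * exp (- 4 * real k))
      \<le> ?N * real n * ((1 / 2) ^ (?a + ?t) * exp (- 4 * real (?a + ?t)))"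
    using k N n0 by (intro mult_left_mono mult_mono power_decreasing) auto
  also have "\<dots> = (?N * ((1 / 2) ^ ?a * exp (- 4 * real ?a))) * (real n * ((1 / 2) ^ ?t * exp (- 4 * real ?t)))"
    by (simp add: power_add exp_add[symmetric] algebra_simps)
  also have "\<dots> \<le> Q" unfolding Q_def
    using n0 N by (intro mult_mono gA gT order_trans[OF _ gA]) auto
  finally have Q: "?N * real n * ((1 / 2) ^ k * exp (- 4 * real k)) \<le> Q" .
  have Qpos: "Q > 0" using N n0 by (intro less_le_trans[OF _ Q]) auto
  have err: "\<bar>?fF * ?pF - Q\<bar> \<le> ?N * (2 * (real k)\<^sup>2 * (?R * sqrt (real n)))"
    unfolding Q_def using n k1 by (intro embeddings_covariance[OF A T(1,2,4) r dis k]) auto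
  also have "\<dots> = cov_err k n * (?N * real n * ((1 / 2) ^ k * exp (- 4 * real k)))"
  proof -
    have "real n / sqrt (real n) = sqrt (real n)" by (rule real_div_sqrt) simp
    moreover have "(2 :: real) ^ k * (1 / 2) ^ k = 1" by (simp add: power_mult_distrib[symmetric])
    moreover have "exp (4 * real k) * exp (- 4 * real k) = 1" by (simp add: exp_add[symmetric])
    moreover have "cov_err k n * (?N * real n * ((1 / 2) ^ k * exp (- 4 * real k)))
      = ?N * (2 * (real k)\<^sup>2 * (?R * (real n / sqrt (real n))))
        * (2 ^ k * (1 / 2) ^ k) * (exp (4 * real k) * exp (- 4 * real k))"
      unfolding cov_err_def by simp
    ultimately show ?thesis by (simp only: mult_1_right)
  qed
  also have "\<dots> \<le> cov_err k n * Q"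
    using step_err_nonneg[OF n k1] by (intro mult_left_mono Q) auto
  finally have err': "\<bar>?fF * ?pF - Q\<bar> \<le> cov_err k n * Q" .
  define \<delta>' where "\<delta>' = (?fF * ?pF - Q) / Q"
  have d': "\<bar>\<delta>'\<bar> \<le> cov_err k n" using err' Qpos by (simp add: \<delta>'_def abs_divide divide_le_eq)
  have eq: "?fF * ?pF = (1 + \<delta>') * Q" using Qpos by (simp add: \<delta>'_def field_simps)
  have nk: "real n - real k > 0" using n k1 by simp
  have fF: "?fF \<ge> (real n - real k) ^ (?a + ?t)" using k n by (intro falling_bounds) auto
  have fFpos: "?fF > 0" using nk by (intro less_le_trans[OF _ fF]) auto
  define \<rho> where "\<rho> = ?fA * ?fT / ?fF"
  have \<rho>1: "1 \<le> \<rho>"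
  proof -
    have "?fF \<le> real ((\<Prod>i<?a. n - i) * (\<Prod>i<?t. n - i))" by (intro of_nat_mono falling_add_le)
    then show ?thesis unfolding \<rho>_def using fFpos by simp
  qed
  have \<rho>2: "\<rho> \<le> 1 + ratio_err k n"
  proof -
    have "?fA * ?fT \<le> real n ^ ?a * real n ^ ?t"
      using k n by (intro mult_mono falling_bounds[of _ k] of_nat_0_le_iff) auto
    then have "\<rho> \<le> real n ^ (?a + ?t) / (real n - real k) ^ (?a + ?t)"
      unfolding \<rho>_def power_add[of "real n"] using fF nk by (intro frac_le) auto
    also have "\<dots> = (real n / (real n - real k)) ^ (?a + ?t)" by (simp add: power_divide)
    also have "\<dots> \<le> (real n / (real n - real k)) ^ k"
      using k nk by (intro power_increasing) auto
    finally show ?thesis by (simp add: ratio_err_def)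
  qed
  show ?thesis
  \<comment> \<open>Two multiplicative corrections, \<open>\<rho>\<close> from the injections and
    \<open>1 + \<delta>'\<close> from the covariance, combine to a single one.\<close>
  proof (intro exI[of _ "\<rho> * (1 + \<delta>') - 1"] conjI)
    have z: "?fF \<noteq> 0" using fFpos by linarith
    have "?pF * ?fF = (1 + \<delta>') * Q" using eq by (simp only: mult.commute[of ?pF ?fF])
    then have "?pF = (1 + \<delta>') * Q / ?fF" by (rule nonzero_eq_divide_eq[OF z, THEN iffD2])
    also have "\<dots> = \<rho> * (1 + \<delta>') * (?pA * ?pT)" by (simp add: \<rho>_def Q_def)
    finally show "?pF = (1 + (\<rho> * (1 + \<delta>') - 1)) * (?pA * ?pT)" by simp
    have "\<rho> * (1 + \<delta>') - 1 = (\<rho> - 1) + \<rho> * \<delta>'" by (simp add: algebra_simps)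
    also have "\<bar>\<dots>\<bar> \<le> \<bar>\<rho> - 1\<bar> + \<bar>\<rho> * \<delta>'\<bar>" by (rule abs_triangle_ineq)
    also have "\<dots> = (\<rho> - 1) + \<rho> * \<bar>\<delta>'\<bar>" using \<rho>1 by (simp add: abs_mult)
    also have "\<dots> \<le> ratio_err k n + (1 + ratio_err k n) * cov_err k n"
      using \<rho>1 \<rho>2 d' by (intro add_mono mult_mono) auto
    finally show "\<bar>\<rho> * (1 + \<delta>') - 1\<bar> \<le> step_err k n" by (simp add: step_err_def)
  qed
qed

section \<open>Splitting off components and the induction\<close>

lemma component_of_eq:
  "component_of G v = ({u \<in> verts G. (v, u) \<in> reach (edges G)},
    {e \<in> edges G. e \<subseteq> {u \<in> verts G. (v, u) \<in> reach (edges G)}})"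
  by (simp add: component_of_def adj_rtrancl Let_def)

text \<open>A walk that starts outside \<open>C\<close> never meets \<open>C\<close>, so the other
  components are unchanged when \<open>C\<close> and its edges go. The second claim keeps the
  split-off factor from merging with another one in the product over a set.\<close>

lemma components_delete:
  assumes V: "E \<subseteq> two_subsets V" and r: "r \<in> V"
  defines "C \<equiv> {v \<in> V. (r, v) \<in> reach E}"
  defines "EC \<equiv> {e \<in> E. e \<subseteq> C}"
  shows "components (V, E) = insert (C, EC) (components (V - C, E - EC))"
    "(C, EC) \<notin> components (V - C, E - EC)"
proof -
  have T: "component_of (V, E) r = (C, EC)" by (simp add: component_of_eq C_def EC_def)
  have rC: "r \<in> C" using r by (simp add: C_def)
  have CE: "component_of (V, E) v = (C, EC)" if v: "v \<in> C" for v
  proof -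
    have "(v, u) \<in> reach E \<longleftrightarrow> (r, u) \<in> reach E" for u
    proof -
      have rv: "(r, v) \<in> reach E" using v by (simp add: C_def)
      show ?thesis using reach_trans[OF rv] reach_trans[OF reach_sym[OF rv]] by blast
    qed
    then show ?thesis by (simp add: component_of_eq C_def EC_def)
  qed
  have out: "(v, u) \<in> reach (E - EC) \<and> u \<notin> C" if v: "v \<in> V - C" and vu: "(v, u) \<in> reach E" for u v
    using vu unfolding reach_def[of E]
  proof (induction rule: rtrancl_induct)
    case base
    then show ?case using v by simp
  next
    case (step y z)
    then have yz: "{y, z} \<in> E" by simp
    then have "{y, z} \<in> E - EC" using step.IH by (auto simp: EC_def)
    moreover have "z \<notin> C"
    proof
      assume z: "z \<in> C"
      have "{z, y} \<in> E" using yz by (simp add: insert_commute)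
      then have "(r, y) \<in> reach E" "y \<in> V"
        using z V reach_trans[OF _ reach_edge] by (auto simp: C_def two_subsets_def)
      then show False using step.IH by (simp add: C_def)
    qed
    moreover have "(v, y) \<in> reach (E - EC)" using step.IH by simp
    ultimately show ?case using reach_trans reach_edge by metis
  qed
  have CO: "component_of (V - C, E - EC) v = component_of (V, E) v" if v: "v \<in> V - C" for v
  proof -
    have eq: "{u \<in> V - C. (v, u) \<in> reach (E - EC)} = {u \<in> V. (v, u) \<in> reach E}" (is "?L = ?R")
    proof
      show "?L \<subseteq> ?R" by (auto elim: reach_mono)
      show "?R \<subseteq> ?L" using out[OF v] by auto
    qed
    have dis: "?R \<inter> C = {}" using out[OF v] by auto
    have "{e \<in> E - EC. e \<subseteq> ?R} = {e \<in> E. e \<subseteq> ?R}"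
    proof (intro equalityI subsetI)
      fix e assume e: "e \<in> {e \<in> E. e \<subseteq> ?R}"
      then have "e \<noteq> {}" using V by (auto simp: two_subsets_def)
      then have "e \<notin> EC" using e dis by (auto simp: EC_def)
      then show "e \<in> {e \<in> E - EC. e \<subseteq> ?R}" using e by simp
    qed auto
    then show ?thesis using eq by (simp add: component_of_eq)
  qed
  have V': "V = C \<union> (V - C)" by (auto simp: C_def)
  have "components (V, E) = component_of (V, E) ` C \<union> component_of (V, E) ` (V - C)"
    unfolding components_def using V' by (metis fst_conv image_Un)
  also have "component_of (V, E) ` C = {(C, EC)}" using CE rC by auto
  also have "component_of (V, E) ` (V - C) = components (V - C, E - EC)"
    unfolding components_def using CO by (intro image_cong) auto
  finally show "components (V, E) = insert (C, EC) (components (V - C, E - EC))" by simp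
  show "(C, EC) \<notin> components (V - C, E - EC)"
  proof
    assume "(C, EC) \<in> components (V - C, E - EC)"
    then obtain v where v: "v \<in> V - C" "(C, EC) = component_of (V - C, E - EC) v"
      by (auto simp: components_def)
    then have "C = {u \<in> V - C. (v, u) \<in> reach (E - EC)}" by (simp add: component_of_eq)
    then show False using rC by blast
  qed
qed

lemma is_forest_iff: "is_forest (V, E) \<longleftrightarrow> finite V \<and> E \<subseteq> two_subsets V \<and> bridges_only E"
  using forest_bridges_only[of "(V, E)"] bridges_only_no_cycle[of "(V, E)"]
  by (auto simp: is_forest_def fin_graph_def)

lemma prod_components_no_edges:
  assumes "finite V" "card V \<le> n"
  shows "(\<Prod>T\<in>components (V, {}). in_mst_prob n T) = 1"
proof (rule prod.neutral, rule ballI)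
  fix T assume "T \<in> components (V, {})"
  then obtain C where C: "T = (C, {})" "C \<subseteq> V" by (auto simp: components_def component_of_eq)
  have "card C \<le> n" using card_mono[OF assms(1) C(2)] assms(2) by linarith
  then show "in_mst_prob n T = 1"
    unfolding C(1) using finite_subset[OF C(2) assms(1)] by (intro in_mst_prob_no_edges)
qed

text \<open>Isolated vertices are dropped before the two-part estimate, so that the number of vertices,
  and with it the error, is bounded in terms of the number of edges.\<close>

lemma split_component:
  assumes V: "finite V" "E \<subseteq> two_subsets V" "bridges_only E" and ne: "E \<noteq> {}"
    and n: "card V \<le> n" "4 * card E \<le> n"
  obtains C EC \<delta> where "C \<subseteq> V" "EC \<subseteq> E" "EC \<noteq> {}" "E - EC \<subseteq> two_subsets (V - C)"
    "components (V, E) = insert (C, EC) (components (V - C, E - EC))"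
    "(C, EC) \<notin> components (V - C, E - EC)"
    "\<bar>\<delta>\<bar> \<le> step_err (2 * card E) n"
    "in_mst_prob n (V, E) = (1 + \<delta>) * (in_mst_prob n (V - C, E - EC) * in_mst_prob n (C, EC))"
proof -
  obtain e where e: "e \<in> E" using ne by blast
  \<comment> \<open>The root is the end of an edge, so its component has an edge and the remaining
    forest has strictly fewer.\<close>
  then obtain r where re: "r \<in> e" "e \<subseteq> V" using V(2) by (fastforce simp: two_subsets_def)
  then have r: "r \<in> V" by blast
  define C where "C = {v \<in> V. (r, v) \<in> reach E}"
  define EC where "EC = {e \<in> E. e \<subseteq> C}"
  note cs = component_split[OF V(2) r, folded C_def, folded EC_def]
  note cd = components_delete[OF V(2) r, folded C_def, folded EC_def]
  have CV: "C \<subseteq> V" by (auto simp: C_def)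
  have rC: "r \<in> C" using r by (simp add: C_def)
  have eC: "e \<in> EC"
  proof -
    have "e \<in> two_subsets (V - C) \<Longrightarrow> False" using re rC by (auto simp: two_subsets_def)
    then show ?thesis using e cs(2) by blast
  qed
  have fC: "finite C" "finite (V - C)" using CV V(1) finite_subset by auto
  have fE: "finite E" using V(1,2) by (auto simp: two_subsets_def intro: finite_subset[of _ "Pow V"])
  let ?U = "\<Union>(E - EC)"
  have UV: "?U \<subseteq> V - C" using cs(2) by (auto simp: two_subsets_def)
  have CU: "C \<subseteq> \<Union>EC"
  proof
    fix v assume v: "v \<in> C"
    show "v \<in> \<Union>EC"
    proof (rule reach_closed[OF cs(3)[OF rC v]])
      show "r \<in> \<Union>EC" using eC re by blast
    qed blast
  qed
  then have CU': "C = \<Union>EC" using cs(1) by (auto simp: two_subsets_def)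
  have UE: "?U \<union> C = \<Union>E" "(E - EC) \<union> EC = E" unfolding CU' by (auto simp: EC_def)
  \<comment> \<open>Each edge covers two vertices; this is where the parameter
    \<open>2 * card E\<close> of the error comes from.\<close>
  have "card (\<Union>E) \<le> (\<Sum>f\<in>E. card f)" by (rule card_Union_le_sum_card)
  also have "\<dots> = (\<Sum>f\<in>E. 2)" using V(2) by (intro sum.cong) (auto simp: two_subsets_def)
  finally have cE: "card (\<Union>E) \<le> 2 * card E" by simp
  have dis: "?U \<inter> C = {}" using UV by blast
  have fU: "finite ?U" using UV fC(2) by (rule finite_subset)
  have "card ?U + card C = card (\<Union>E)"
    using card_Un_disjoint[OF fU fC(1) dis] UE by simp
  then have kk: "card ?U + card C \<le> 2 * card E" using cE by simp
  have "\<exists>\<delta>. \<bar>\<delta>\<bar> \<le> step_err (2 * card E) n \<and> in_mst_prob n (?U \<union> C, (E - EC) \<union> EC)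
    = (1 + \<delta>) * (in_mst_prob n (?U, E - EC) * in_mst_prob n (C, EC))"
  proof (rule two_parts)
    show "E - EC \<subseteq> two_subsets ?U" using V(2) by (auto simp: two_subsets_def)
    show "bridges_only (E - EC)" "bridges_only EC"
      using bridges_only_subset[OF V(3)] by (auto simp: EC_def)
    show "2 * (2 * card E) \<le> n" using n by simp
  qed (use fU fC cs rC dis kk in auto)
  then obtain \<delta> where \<delta>: "\<bar>\<delta>\<bar> \<le> step_err (2 * card E) n"
    "in_mst_prob n (\<Union>E, E) = (1 + \<delta>) * (in_mst_prob n (?U, E - EC) * in_mst_prob n (C, EC))"
    unfolding UE by blast
  have "in_mst_prob n (\<Union>E, E) = in_mst_prob n (V, E)"
    by (rule in_mst_prob_isolated[OF V(1,2) n(1)])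
  moreover have "in_mst_prob n (?U, E - EC) = in_mst_prob n (V - C, E - EC)"
  proof (rule in_mst_prob_isolated[OF fC(2) cs(2)])
    show "card (V - C) \<le> n" using card_mono[OF V(1), of "V - C"] n(1) by simp
  qed
  ultimately have "in_mst_prob n (V, E)
    = (1 + \<delta>) * (in_mst_prob n (V - C, E - EC) * in_mst_prob n (C, EC))" using \<delta>(2) by simp
  then show thesis using that[OF CV _ _ cs(2) cd \<delta>(1)] eC by (auto simp: EC_def)
qed

text \<open>The error function is chosen before the forest and depends on the number of edges only.
  It serves all forests with \<open>m\<close> edges on at most \<open>n\<close> vertices, so
  isolated vertices may even grow in number with \<open>n\<close>; a fixed forest meets the vertex
  condition as soon as \<open>n\<close> is large.\<close>

theorem corollary1p2:
  fixes m :: nat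
  shows "\<exists>\<epsilon> :: nat \<Rightarrow> real. \<epsilon> \<longlonglongrightarrow> 0 \<and>
    (\<forall>\<^sub>F n in sequentially. \<forall>F :: 'a graph.
       is_forest F \<longrightarrow> card (edges F) = m \<longrightarrow> card (verts F) \<le> n \<longrightarrow>
       (\<exists>\<delta>. \<bar>\<delta>\<bar> \<le> \<epsilon> n \<and>
          in_mst_prob n F = (1 + \<delta>) * (\<Prod>T\<in>components F. in_mst_prob n T)))"
proof (induction m rule: less_induct)
  case (less m)
  define P where "P \<epsilon> i n \<longleftrightarrow> (\<forall>F :: 'a graph.
       is_forest F \<longrightarrow> card (edges F) = i \<longrightarrow> card (verts F) \<le> n \<longrightarrow>
       (\<exists>\<delta>. \<bar>\<delta>\<bar> \<le> \<epsilon> n \<and>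
          in_mst_prob n F = (1 + \<delta>) * (\<Prod>T\<in>components F. in_mst_prob n T)))"
    for \<epsilon> :: "nat \<Rightarrow> real" and i n
  have goal: "\<exists>\<epsilon>. \<epsilon> \<longlonglongrightarrow> 0 \<and> (\<forall>\<^sub>F n in sequentially. P \<epsilon> m n)"
  proof (cases "m = 0")
    case True
    have "P (\<lambda>_. 0) m n" for n
      unfolding P_def
    proof (intro allI impI exI[of _ 0] conjI)
      fix F :: "'a graph"
      assume F: "is_forest F" "card (edges F) = m" "card (verts F) \<le> n"
      obtain V E where VE: "F = (V, E)" by (cases F)
      have V: "finite V" "E \<subseteq> two_subsets V" using F(1) by (simp_all add: VE is_forest_iff)
      have "finite E" using V by (auto simp: two_subsets_def intro: finite_subset[of _ "Pow V"])
      then have "E = {}" using F(2) True by (simp add: VE)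
      then show "in_mst_prob n F = (1 + 0) * (\<Prod>T\<in>components F. in_mst_prob n T)"
        using V F(3) by (simp add: VE in_mst_prob_no_edges prod_components_no_edges)
    qed simp
    then show ?thesis by (intro exI[of _ "\<lambda>_. 0"]) simp
  next
    case False
    \<comment> \<open>The rest after a component is split off may have any number
      \<open>i < m\<close> of edges, so an error function is chosen for each \<open>i\<close>; the
      sum of their absolute values dominates them all.\<close>
    have "\<forall>i\<in>{..<m}. \<exists>\<epsilon>. \<epsilon> \<longlonglongrightarrow> 0 \<and> (\<forall>\<^sub>F n in sequentially. P \<epsilon> i n)"
      using less.IH unfolding P_def by blast
    then obtain \<epsilon> where \<epsilon>: "\<And>i. i < m \<Longrightarrow> \<epsilon> i \<longlonglongrightarrow> 0"
      "\<And>i. i < m \<Longrightarrow> \<forall>\<^sub>F n in sequentially. P (\<epsilon> i) i n"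
      using bchoice[of "{..<m}" "\<lambda>i \<epsilon>. \<epsilon> \<longlonglongrightarrow> 0 \<and> (\<forall>\<^sub>F n in sequentially. P \<epsilon> i n)"] by auto
    define S where "S n = (\<Sum>i<m. \<bar>\<epsilon> i n\<bar>)" for n
    \<comment> \<open>The error of the split composed with that of the remaining forest, after the
      pattern \<open>(1 + \<delta>) * (1 + \<gamma>) - 1\<close>.\<close>
    define \<eta> where "\<eta> n = step_err (2 * m) n + (1 + step_err (2 * m) n) * S n" for n
    have "S \<longlonglongrightarrow> (\<Sum>i<m. \<bar>0\<bar>)"
      unfolding S_def by (intro tendsto_sum tendsto_rabs \<epsilon>(1)) simp
    then have S: "S \<longlonglongrightarrow> 0" by simp
    have "\<eta> \<longlonglongrightarrow> 0 + (1 + 0) * 0"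
      unfolding \<eta>_def[abs_def] by (intro tendsto_intros step_err_tendsto S)
    then have \<eta>: "\<eta> \<longlonglongrightarrow> 0" by simp
    have "\<forall>\<^sub>F n in sequentially. \<forall>i\<in>{..<m}. P (\<epsilon> i) i n"
      using \<epsilon>(2) by (intro eventually_ball_finite) auto
    \<comment> \<open>The two-part estimate is applied with \<open>k = 2 * m\<close> and asks for
      \<open>2 * k \<le> n\<close>.\<close>
    moreover have "\<forall>\<^sub>F n in sequentially. n \<ge> 4 * m" by (rule eventually_ge_at_top)
    ultimately have "\<forall>\<^sub>F n in sequentially. P \<eta> m n"
    proof eventually_elim
      case (elim n)
      show ?case
        unfolding P_def
      proof (intro allI impI)
        fix F :: "'a graph"
        assume F: "is_forest F" "card (edges F) = m" "card (verts F) \<le> n"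
        obtain V E where VE: "F = (V, E)" by (cases F)
        have V: "finite V" "E \<subseteq> two_subsets V" "bridges_only E"
          using F(1) by (simp_all add: VE is_forest_iff)
        have E: "card E = m" "card V \<le> n" using F by (simp_all add: VE)
        have fE: "finite E" using E False by (auto intro: card_ge_0_finite)
        have "E \<noteq> {}" using E False by auto
        then obtain C EC \<delta> where C: "C \<subseteq> V" "EC \<subseteq> E" "EC \<noteq> {}" "E - EC \<subseteq> two_subsets (V - C)"
          "components (V, E) = insert (C, EC) (components (V - C, E - EC))"
          "(C, EC) \<notin> components (V - C, E - EC)"
          "\<bar>\<delta>\<bar> \<le> step_err (2 * m) n"
          "in_mst_prob n (V, E) = (1 + \<delta>) * (in_mst_prob n (V - C, E - EC) * in_mst_prob n (C, EC))"
          using split_component[OF V _ E(2)] E(1) elim(2) by metis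
        define i where "i = card (E - EC)"
        have "E - EC \<subset> E" using C(2,3) by blast
        then have i: "i < m" unfolding i_def E(1)[symmetric] using fE by (intro psubset_card_mono)
        have "is_forest (V - C, E - EC)"
          using V C(4) bridges_only_subset[OF V(3)] by (simp add: is_forest_iff)
        moreover have "card (V - C) \<le> n" using card_mono[OF V(1), of "V - C"] E(2) by simp
        moreover have "P (\<epsilon> i) i n" using elim(1) i by simp
        ultimately obtain \<gamma> where \<gamma>: "\<bar>\<gamma>\<bar> \<le> \<epsilon> i n"
          "in_mst_prob n (V - C, E - EC) = (1 + \<gamma>) * (\<Prod>T\<in>components (V - C, E - EC). in_mst_prob n T)"
          unfolding P_def by (metis fst_conv snd_conv i_def)
        have "\<bar>\<epsilon> i n\<bar> \<le> S n"
          unfolding S_def using i by (intro member_le_sum) auto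
        then have \<gamma>S: "\<bar>\<gamma>\<bar> \<le> S n" using \<gamma>(1) by linarith
        have fin: "finite (components (V - C, E - EC))" using V(1) by (simp add: components_def)
        show "\<exists>\<delta>. \<bar>\<delta>\<bar> \<le> \<eta> n \<and> in_mst_prob n F = (1 + \<delta>) * (\<Prod>T\<in>components F. in_mst_prob n T)"
        proof (intro exI[of _ "\<delta> + (1 + \<delta>) * \<gamma>"] conjI)
          have "\<bar>\<delta> + (1 + \<delta>) * \<gamma>\<bar> \<le> \<bar>\<delta>\<bar> + \<bar>1 + \<delta>\<bar> * \<bar>\<gamma>\<bar>"
            by (metis abs_mult abs_triangle_ineq)
          also have "\<dots> \<le> step_err (2 * m) n + (1 + step_err (2 * m) n) * S n"
            using C(7) \<gamma>S by (intro add_mono mult_mono) auto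
          finally show "\<bar>\<delta> + (1 + \<delta>) * \<gamma>\<bar> \<le> \<eta> n" by (simp add: \<eta>_def)
          have "in_mst_prob n F = (1 + \<delta>) * ((1 + \<gamma>) * (\<Prod>T\<in>components F. in_mst_prob n T))"
            unfolding VE C(8) \<gamma>(2) C(5) using C(6) fin by simp
          then show "in_mst_prob n F
              = (1 + (\<delta> + (1 + \<delta>) * \<gamma>)) * (\<Prod>T\<in>components F. in_mst_prob n T)"
            by (simp add: algebra_simps)
        qed
      qed
    qed
    then show ?thesis using \<eta> by blast
  qed
  then show ?case unfolding P_def .
qed

end
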